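(* Let $h\in(0,1]$ be fixed, and let $V$, $H$, $F$, $G$, $B$, $R$, $\mathcal{L}_r$ be as defined in the context. Let $(u_h,\eta_h,\lambda_h)\in V\times H\times H$ be a saddle point of $\mathcal{L}_r$ on $V\times H\times H$. Suppose that there are constants $\alpha_0,\alpha_1$ such that for all $n$ $$0<\alpha_0\le\rho_n\le\alpha_1<2r,$$ and let $(u_h^n,\eta_h^n,\lambda_h^n)\in V\times H\times H$ be the iterates given by Algorithm 1 (described in the context). Then, as $n\to\infty$, \begin{align*} u_h^n&\to u_h \text{ in } V,\\ \eta_h^n&\to\eta_h=Bu_h\text{ in } H,\\ \lambda_h^{n+1}-\lambda_h^n&\to0\text{ in } H, \end{align*} and the sequence $(\lambda_h^n)$ is bounded in $H$. Moreover, \begin{align*} [\![u_h^n-u_h]\!]&\to0\text{ in } L^2(\Gamma_{int}),\\ u_h^n&\to u_h\text{ in } L^2(\partial\Omega),\\ R(u_h^n)&\to R(u_h)\text{ in } H,\\ \nabla u_h^n&\to\nabla u_h\text{ in } H. \end{align*}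
   Context: **Setting.** $\Omega\subset\mathbb{R}^N$ is a bounded connected polygonal (polyhedral) domain with Lipschitz boundary. $p:\overline\Omega\to[p_1,2]$ with $1<p_1\le2$ is $\log$-Hölder continuous, i.e. $|p(x)-p(y)|\le C_{log}/\log(e+1/|x-y|)$ for some constant $C_{log}$ and all $x,y\in\overline\Omega$. $p'(x)$ is the conjugate exponent, $1/p(x)+1/p'(x)=1$. $\xi\in L^2(\Omega)$ and $u_D\in W^{1,p(\cdot)}(\Omega)$ (that is, $u_D$ and $\nabla u_D$ have finite modular $\int_\Omega|\cdot|^{p(x)}dx$) has trace in $L^2(\partial\Omega)$. **Mesh.** $\mathcal{T}_h$ is a member of a family $(\mathcal{T}_h)_{h\in(0,1]}$ of partitions of $\overline\Omega$ into closed polyhedral elements $\kappa$ with $\operatorname{diam}(\kappa)\le h$, each $\kappa$ being the image under an invertible affine map of one of finitely many reference polyhedra (independent of $h$). Set $\mathcal{E}_h=\{\kappa\cap\kappa':\dim_H(\kappa\cap\kappa')=N-1\}\cup\{\kappa\cap\partial\Omega:\dim_H(\kappa\cap\partial\Omega)=N-1\}$ (with $\dim_H$ the Hausdorff dimension, $\kappa\neq\kappa'$ in $\mathcal T_h$), $\Gamma_{int}=\bigcup\{e\in\mathcal{E}_h:\dim_H(e\cap\partial\Omega)<N-1\}$. With $h_\kappa=\operatorname{diam}(\kappa)$, $h_e=\operatorname{diam}(e)$, there are positive constants independent of $h$ such that: (a) $C_1h_\kappa^N\le|\kappa|\le C_2h_\kappa^N$; (b) for every $e\in\mathcal{E}_h$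 there are $x_e\in e$ and $\rho_e\ge C_1\operatorname{diam}(e)$ with $B_{\rho_e}(x_e)\cap A_e\subset e$, $A_e$ being the affine hyperplane spanned by $e$; and $ch_\kappa\le h_e\le Ch_\kappa$, $ch_{\kappa'}\le h_e\le Ch_{\kappa'}$ when $e=\kappa\cap\kappa'$. $\mathbf{h}(x)=\operatorname{diam}(e)$ for $x\in e\in\mathcal{E}_h$. **Spaces and operators.** $S^j(\mathcal{T}_h)=\{u\in L^1(\Omega):u|_\kappa\in P^j\ \forall\kappa\in\mathcal{T}_h\}$, $P^j$ being the polynomials of degree at most $j$. Fix $k,l\in\mathbb{N}_0$ with $l\ge k-1$; $V=S^k(\mathcal{T}_h)$ with the $L^2(\Omega)$ norm, and $H=S^l(\mathcal{T}_h)^N$ with the $L^2(\Omega)^N$ norm $\|\cdot\|$ and inner product $\langle\cdot,\cdot\rangle$. $\nabla v$ is the elementwise gradient. On an interior face with neighbouring elements $\kappa^\pm$ and outward unit normals $\nu^\pm$, $[\![u]\!]=u^+\nu^++u^-\nu^-$ and $\{\phi\}=(\phi^++\phi^-)/2$. The lifting operator $R=R_h$ takes values in $S^l(\mathcal{T}_h)^N$ and is defined by $\int_\Omega R(u)\cdot\phi\,dx=-\int_{\Gamma_{int}}[\![u]\!]\cdot\{\phi\}\,dS$ for all $\phi\in S^l(\mathcal{T}_h)^N$. **Functionals.** $F:H\to\mathbb{R}$, $F(q)=\int_\Omega|q|^{p(x)}dx$; $G:V\to\mathbb{R}$, $$G(v)=\int_\Omega|v-\xi|^2dx+\int_{\Gamma_{int}}|[\![v]\!]|^2\mathbf{h}^{-2/p'(x)}dS+\int_{\partial\Omega}|v-u_D|^2\mathbf{h}^{-2/p'(x)}dS;$$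 $B:V\to H$, $Bv=R(v)+\nabla v$. For $r\ge0$, $$\mathcal{L}_r(v,q,\mu)=F(q)+G(v)+\langle\mu,Bv-q\rangle+\tfrac r2\|Bv-q\|^2,\qquad (v,q,\mu)\in V\times H\times H.$$ $(u,\eta,\lambda)$ is a saddle point of $\mathcal{L}_r$ if $\mathcal{L}_r(u,\eta,\mu)\le\mathcal{L}_r(u,\eta,\lambda)\le\mathcal{L}_r(v,q,\lambda)$ for all $(v,q,\mu)\in V\times H\times H$. **Algorithm 1.** Let $\lambda_h^0\in H$ be arbitrary. For $n\ge0$, given $\lambda_h^n$, define $(u_h^n,\eta_h^n,\lambda_h^{n+1})\in V\times H\times H$ by $$\mathcal{L}_r(u_h^n,\eta_h^n,\lambda_h^n)\le\mathcal{L}_r(v,q,\lambda_h^n)\quad\forall(v,q)\in V\times H,\qquad \lambda_h^{n+1}=\lambda_h^n+\rho_n(Bu_h^n-\eta_h^n),\quad\rho_n>0.$$ *)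

theory Defs
  imports "HOL-Analysis.Analysis"
begin

section \<open>Hausdorff measure and dimension\<close>

text \<open>The factor \<open>unit_ball_vol s / 2 powr s\<close> makes the \<open>s\<close>-dimensional measure agree with surface
  area for integral \<open>s\<close>.  The case \<open>s = 0\<close> is split off because \<open>0 powr 0 = 0\<close>.\<close>

definition hausdorff_weight :: "real \<Rightarrow> 'a::euclidean_space set \<Rightarrow> real" where
  "hausdorff_weight s U =
     (if U = {} then 0 else if s = 0 then 1 else unit_ball_vol s * (diameter U / 2) powr s)"

definition hausdorff_content :: "real \<Rightarrow> real \<Rightarrow> 'a::euclidean_space set \<Rightarrow> ennreal" where
  "hausdorff_content s \<delta> A =
     (INF U \<in> {U :: nat \<Rightarrow> 'a set. A \<subseteq> (\<Union>i. U i) \<and> (\<forall>i. bounded (U i) \<and> diameter (U i) \<le> \<delta>)}.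
        \<Sum>i. ennreal (hausdorff_weight s (U i)))"

definition hausdorff_outer :: "real \<Rightarrow> 'a::euclidean_space set \<Rightarrow> ennreal" where
  "hausdorff_outer s A = (SUP \<delta> \<in> {0<..}. hausdorff_content s \<delta> A)"

text \<open>Only finite values occur in Euclidean space, so the dimension is taken in \<open>real\<close>.\<close>

definition hausdorff_dim :: "'a::euclidean_space set \<Rightarrow> real" where
  "hausdorff_dim A = Inf {s. 0 \<le> s \<and> hausdorff_outer s A = 0}"

text \<open>The outer measure above is a metric outer measure, hence countably additive on Borel sets,
  so that \<open>measure_of\<close> does not degenerate to the zero measure.\<close>

definition hausdorff_measure :: "real \<Rightarrow> 'a::euclidean_space measure" where
  "hausdorff_measure s = measure_of UNIV (sets borel) (hausdorff_outer s)"

text \<open>The surface measure \<open>dS\<close> on a set \<open>A\<close>, completed as \<open>lebesgue\<close> is.\<close>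

definition surface_on :: "'a::euclidean_space set \<Rightarrow> 'a measure" where
  "surface_on A = restrict_space (completion (hausdorff_measure (real DIM('a) - 1))) A"

section \<open>Square-integrable functions\<close>

text \<open>Elements of function spaces are represented by functions, and equality in these spaces is
  equality almost everywhere.\<close>

definition L2 :: "'a measure \<Rightarrow> ('a \<Rightarrow> 'b::euclidean_space) set" where
  "L2 M = {f. f \<in> borel_measurable M \<and> integrable M (\<lambda>x. (norm (f x))\<^sup>2)}"

definition L2_norm_on :: "'a measure \<Rightarrow> ('a \<Rightarrow> 'b::euclidean_space) \<Rightarrow> real" where
  "L2_norm_on M f = sqrt (\<integral>x. (norm (f x))\<^sup>2 \<partial>M)"

definition L2_inner :: "'a measure \<Rightarrow> ('a \<Rightarrow> 'b::euclidean_space) \<Rightarrow> ('a \<Rightarrow> 'b) \<Rightarrow> real" where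
  "L2_inner M f g = (\<integral>x. f x \<bullet> g x \<partial>M)"

text \<open>Membership is part of the notion: the Bochner integral of a non-integrable function is \<open>0\<close>,
  so the limit of the norms alone would not express convergence.\<close>

definition tendsto_L2 ::
    "'a measure \<Rightarrow> (nat \<Rightarrow> 'a \<Rightarrow> 'b::euclidean_space) \<Rightarrow> ('a \<Rightarrow> 'b) \<Rightarrow> bool" where
  "tendsto_L2 M f g \<longleftrightarrow> (\<forall>n. f n \<in> L2 M) \<and> g \<in> L2 M \<and>
     (\<lambda>n. L2_norm_on M (\<lambda>x. f n x - g x)) \<longlonglongrightarrow> 0"

section \<open>Domain, exponent and Sobolev data\<close>

definition polyhedral :: "'a::euclidean_space set \<Rightarrow> bool" where
  "polyhedral S \<longleftrightarrow> (\<exists>P. finite P \<and> (\<forall>C\<in>P. polytope C) \<and> S = \<Union>P)"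

definition lipschitz_boundary :: "'a::euclidean_space set \<Rightarrow> bool" where
  "lipschitz_boundary \<Omega> \<longleftrightarrow>
     (\<forall>x\<in>frontier \<Omega>. \<exists>U \<nu> L \<gamma>. open U \<and> x \<in> U \<and> norm \<nu> = 1 \<and>
        L-lipschitz_on {y. \<nu> \<bullet> y = 0} \<gamma> \<and>
        \<Omega> \<inter> U = {y \<in> U. \<gamma> (y - (\<nu> \<bullet> y) *\<^sub>R \<nu>) < \<nu> \<bullet> y})"

definition polyhedral_domain :: "'a::euclidean_space set \<Rightarrow> bool" where
  "polyhedral_domain \<Omega> \<longleftrightarrow> open \<Omega> \<and> \<Omega> \<noteq> {} \<and> bounded \<Omega> \<and> connected \<Omega> \<and>
     polyhedral (closure \<Omega>) \<and> lipschitz_boundary \<Omega>"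

definition log_hoelder_on :: "'a::euclidean_space set \<Rightarrow> ('a \<Rightarrow> real) \<Rightarrow> bool" where
  "log_hoelder_on S p \<longleftrightarrow>
     (\<exists>C. \<forall>x\<in>S. \<forall>y\<in>S. \<bar>p x - p y\<bar> \<le> C / ln (exp 1 + 1 / norm (x - y)))"

definition conj_exponent :: "real \<Rightarrow> real" where
  "conj_exponent q = q / (q - 1)"

lemma conj_exponent: "1 < q \<Longrightarrow> 1 / q + 1 / conj_exponent q = 1"
  by (simp add: conj_exponent_def field_simps)

definition C1_gradient :: "('a::euclidean_space \<Rightarrow> real) \<Rightarrow> ('a \<Rightarrow> 'a) \<Rightarrow> bool" where
  "C1_gradient f Df \<longleftrightarrow> (\<forall>x. GDERIV f x :> Df x) \<and> continuous_on UNIV Df"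

definition locally_integrable_on ::
    "'a::euclidean_space set \<Rightarrow> ('a \<Rightarrow> 'b::euclidean_space) \<Rightarrow> bool" where
  "locally_integrable_on \<Omega> f \<longleftrightarrow> (\<forall>K. compact K \<and> K \<subseteq> \<Omega> \<longrightarrow> integrable (lebesgue_on K) f)"

definition weak_gradient ::
    "'a::euclidean_space set \<Rightarrow> ('a \<Rightarrow> real) \<Rightarrow> ('a \<Rightarrow> 'a) \<Rightarrow> bool" where
  "weak_gradient \<Omega> u Du \<longleftrightarrow> locally_integrable_on \<Omega> u \<and> locally_integrable_on \<Omega> Du \<and>
     (\<forall>\<phi> D\<phi>. C1_gradient \<phi> D\<phi> \<and> compact (closure {x. \<phi> x \<noteq> 0}) \<and> closure {x. \<phi> x \<noteq> 0} \<subseteq> \<Omega> \<longrightarrow>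
        (\<integral>x. u x *\<^sub>R D\<phi> x \<partial>lebesgue_on \<Omega>) = - (\<integral>x. \<phi> x *\<^sub>R Du x \<partial>lebesgue_on \<Omega>))"

definition finite_modular ::
    "'a::euclidean_space set \<Rightarrow> ('a \<Rightarrow> real) \<Rightarrow> ('a \<Rightarrow> 'b::euclidean_space) \<Rightarrow> bool" where
  "finite_modular \<Omega> p f \<longleftrightarrow> f \<in> borel_measurable (lebesgue_on \<Omega>) \<and>
     integrable (lebesgue_on \<Omega>) (\<lambda>x. norm (f x) powr p x)"

definition W1p :: "'a::euclidean_space set \<Rightarrow> ('a \<Rightarrow> real) \<Rightarrow> ('a \<Rightarrow> real) set" where
  "W1p \<Omega> p = {u. \<exists>Du. weak_gradient \<Omega> u Du \<and> finite_modular \<Omega> p u \<and> finite_modular \<Omega> p Du}"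

text \<open>\<open>w\<close> is the image of \<open>u\<close> under the continuous extension to \<open>W\<^sup>1\<^sup>,\<^sup>1(\<Omega>)\<close> of the restriction of \<open>C\<^sup>1\<close>
  functions to the boundary.\<close>

definition is_trace ::
    "'a::euclidean_space set \<Rightarrow> ('a \<Rightarrow> real) \<Rightarrow> ('a \<Rightarrow> real) \<Rightarrow> bool" where
  "is_trace \<Omega> u w \<longleftrightarrow> integrable (surface_on (frontier \<Omega>)) w \<and>
     (\<exists>Du f Df. weak_gradient \<Omega> u Du \<and>
        integrable (lebesgue_on \<Omega>) u \<and> integrable (lebesgue_on \<Omega>) Du \<and>
        (\<forall>m::nat. C1_gradient (f m) (Df m)) \<and>
        (\<lambda>m. \<integral>x. \<bar>f m x - u x\<bar> \<partial>lebesgue_on \<Omega>) \<longlonglongrightarrow> 0 \<and>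
        (\<lambda>m. \<integral>x. norm (Df m x - Du x) \<partial>lebesgue_on \<Omega>) \<longlonglongrightarrow> 0 \<and>
        (\<lambda>m. \<integral>x. \<bar>f m x - w x\<bar> \<partial>surface_on (frontier \<Omega>)) \<longlonglongrightarrow> 0)"

section \<open>Meshes\<close>

definition reference_polyhedron :: "'a::euclidean_space set \<Rightarrow> bool" where
  "reference_polyhedron K \<longleftrightarrow> polyhedral K \<and> interior K \<noteq> {} \<and> closure (interior K) = K"

definition affine_image_of :: "'a::euclidean_space set \<Rightarrow> 'a set \<Rightarrow> bool" where
  "affine_image_of K \<kappa> \<longleftrightarrow> (\<exists>A b. linear A \<and> bij A \<and> \<kappa> = (\<lambda>x. A x + b) ` K)"

definition mesh_partition :: "'a::euclidean_space set \<Rightarrow> 'a set set \<Rightarrow> bool" where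
  "mesh_partition \<Omega> T \<longleftrightarrow> finite T \<and> \<Union>T = closure \<Omega> \<and>
     (\<forall>\<kappa>\<in>T. \<forall>\<kappa>'\<in>T. \<kappa> \<noteq> \<kappa>' \<longrightarrow> interior \<kappa> \<inter> interior \<kappa>' = {})"

definition faces :: "'a::euclidean_space set \<Rightarrow> 'a set set \<Rightarrow> 'a set set" where
  "faces \<Omega> T =
     {\<kappa> \<inter> \<kappa>' | \<kappa> \<kappa>'. \<kappa> \<in> T \<and> \<kappa>' \<in> T \<and> \<kappa> \<noteq> \<kappa>' \<and> hausdorff_dim (\<kappa> \<inter> \<kappa>') = real DIM('a) - 1} \<union>
     {\<kappa> \<inter> frontier \<Omega> | \<kappa>. \<kappa> \<in> T \<and> hausdorff_dim (\<kappa> \<inter> frontier \<Omega>) = real DIM('a) - 1}"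

definition Gamma_int :: "'a::euclidean_space set \<Rightarrow> 'a set set \<Rightarrow> 'a set" where
  "Gamma_int \<Omega> T = \<Union>{e \<in> faces \<Omega> T. hausdorff_dim (e \<inter> frontier \<Omega>) < real DIM('a) - 1}"

text \<open>\<open>T h\<close> is the partition with parameter \<open>h\<close>; all constants and the set of reference polyhedra
  are independent of \<open>h\<close>.\<close>

definition mesh_family :: "'a::euclidean_space set \<Rightarrow> (real \<Rightarrow> 'a set set) \<Rightarrow> bool" where
  "mesh_family \<Omega> T \<longleftrightarrow>
     (\<exists>\<R>. finite \<R> \<and> (\<forall>K\<in>\<R>. reference_polyhedron K) \<and>
        (\<forall>h\<in>{0<..1}. mesh_partition \<Omega> (T h) \<and>
           (\<forall>\<kappa>\<in>T h. diameter \<kappa> \<le> h \<and> (\<exists>K\<in>\<R>. affine_image_of K \<kappa>)))) \<and>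
     (\<exists>C\<^sub>1>0. \<exists>C\<^sub>2>0. \<exists>c>0. \<exists>C>0. \<forall>h\<in>{0<..1}.
        (\<forall>\<kappa>\<in>T h. C\<^sub>1 * diameter \<kappa> ^ DIM('a) \<le> measure lebesgue \<kappa> \<and>
                 measure lebesgue \<kappa> \<le> C\<^sub>2 * diameter \<kappa> ^ DIM('a)) \<and>
        (\<forall>e\<in>faces \<Omega> (T h). aff_dim e = int DIM('a) - 1 \<and>
           (\<exists>x\<in>e. \<exists>\<rho>\<ge>C\<^sub>1 * diameter e. ball x \<rho> \<inter> affine hull e \<subseteq> e)) \<and>
        (\<forall>\<kappa>\<in>T h. \<forall>\<kappa>'\<in>T h. \<kappa> \<noteq> \<kappa>' \<and> hausdorff_dim (\<kappa> \<inter> \<kappa>') = real DIM('a) - 1 \<longrightarrow>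
           c * diameter \<kappa> \<le> diameter (\<kappa> \<inter> \<kappa>') \<and> diameter (\<kappa> \<inter> \<kappa>') \<le> C * diameter \<kappa> \<and>
           c * diameter \<kappa>' \<le> diameter (\<kappa> \<inter> \<kappa>') \<and> diameter (\<kappa> \<inter> \<kappa>') \<le> C * diameter \<kappa>'))"

text \<open>The choice matters only where faces overlap, a set of surface measure zero.\<close>

definition face_size :: "'a::euclidean_space set \<Rightarrow> 'a set set \<Rightarrow> 'a \<Rightarrow> real" where
  "face_size \<Omega> T x = diameter (SOME e. e \<in> faces \<Omega> T \<and> x \<in> e)"

text \<open>The set \<open>\<kappa>\<close> coincides with a half-space near \<open>x\<close>, which for a polyhedral \<open>\<kappa>\<close> holds at almost
  every boundary point; elsewhere the normal is set to \<open>0\<close>.\<close>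

definition is_outward_normal :: "'a::euclidean_space set \<Rightarrow> 'a \<Rightarrow> 'a \<Rightarrow> bool" where
  "is_outward_normal \<kappa> x \<nu> \<longleftrightarrow> norm \<nu> = 1 \<and>
     (\<exists>r>0. \<kappa> \<inter> ball x r = {y \<in> ball x r. \<nu> \<bullet> (y - x) \<le> 0})"

definition outward_normal :: "'a::euclidean_space set \<Rightarrow> 'a \<Rightarrow> 'a" where
  "outward_normal \<kappa> x =
     (if \<exists>\<nu>. is_outward_normal \<kappa> x \<nu> then (THE \<nu>. is_outward_normal \<kappa> x \<nu>) else 0)"

section \<open>Broken polynomial spaces\<close>

definition multi_indices :: "nat \<Rightarrow> ('a::euclidean_space \<Rightarrow> nat) set" where
  "multi_indices j = {\<alpha>. (\<forall>b. b \<notin> Basis \<longrightarrow> \<alpha> b = 0) \<and> (\<Sum>b\<in>Basis. \<alpha> b) \<le> j}"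

definition poly_space :: "nat \<Rightarrow> ('a::euclidean_space \<Rightarrow> real) set" where
  "poly_space j = {q. \<exists>c. q = (\<lambda>x. \<Sum>\<alpha>\<in>multi_indices j. c \<alpha> * (\<Prod>b\<in>Basis. (x \<bullet> b) ^ \<alpha> b))}"

definition broken_poly ::
    "'a::euclidean_space set \<Rightarrow> 'a set set \<Rightarrow> nat \<Rightarrow> ('a \<Rightarrow> real) set" where
  "broken_poly \<Omega> T j = {u. integrable (lebesgue_on \<Omega>) u \<and>
     (\<forall>\<kappa>\<in>T. \<exists>q\<in>poly_space j. AE x in lebesgue_on \<kappa>. u x = q x)}"

definition broken_poly_vec ::
    "'a::euclidean_space set \<Rightarrow> 'a set set \<Rightarrow> nat \<Rightarrow> ('a \<Rightarrow> 'a) set" where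
  "broken_poly_vec \<Omega> T j = {\<phi>. \<forall>b\<in>Basis. (\<lambda>x. \<phi> x \<bullet> b) \<in> broken_poly \<Omega> T j}"

text \<open>The polynomial that \<open>u\<close> equals on \<open>\<kappa>\<close>, unique because \<open>\<kappa>\<close> has interior points.  Its values on
  the boundary of \<open>\<kappa>\<close> are the trace of \<open>u\<close> from inside \<open>\<kappa>\<close>.\<close>

definition elem_poly :: "'a::euclidean_space set \<Rightarrow> ('a \<Rightarrow> real) \<Rightarrow> 'a \<Rightarrow> real" where
  "elem_poly \<kappa> u = (SOME q. real_polynomial_function q \<and> (AE x in lebesgue_on \<kappa>. u x = q x))"

definition elem_poly_vec :: "'a::euclidean_space set \<Rightarrow> ('a \<Rightarrow> 'a) \<Rightarrow> 'a \<Rightarrow> 'a" where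
  "elem_poly_vec \<kappa> \<phi> x = (\<Sum>b\<in>Basis. elem_poly \<kappa> (\<lambda>y. \<phi> y \<bullet> b) x *\<^sub>R b)"

definition grad :: "('a::euclidean_space \<Rightarrow> real) \<Rightarrow> 'a \<Rightarrow> 'a" where
  "grad f x = (THE D. GDERIV f x :> D)"

text \<open>The sum has at most one term, as interiors of distinct elements are disjoint.\<close>

definition broken_grad :: "'a::euclidean_space set set \<Rightarrow> ('a \<Rightarrow> real) \<Rightarrow> 'a \<Rightarrow> 'a" where
  "broken_grad T v x = (\<Sum>\<kappa> | \<kappa> \<in> T \<and> x \<in> interior \<kappa>. grad (elem_poly \<kappa> v) x)"

text \<open>Almost every point of an interior face lies in exactly the two elements \<open>\<kappa>\<^sup>+\<close> and \<open>\<kappa>\<^sup>-\<close> adjacent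
  to it, and almost every boundary point in exactly one element, so that the following sums are
  \<open>u\<^sup>+ \<nu>\<^sup>+ + u\<^sup>- \<nu>\<^sup>-\<close>, \<open>(\<phi>\<^sup>+ + \<phi>\<^sup>-) / 2\<close> and the one-sided trace, respectively.\<close>

definition jump :: "'a::euclidean_space set set \<Rightarrow> ('a \<Rightarrow> real) \<Rightarrow> 'a \<Rightarrow> 'a" where
  "jump T u x = (\<Sum>\<kappa> | \<kappa> \<in> T \<and> x \<in> \<kappa>. elem_poly \<kappa> u x *\<^sub>R outward_normal \<kappa> x)"

definition average :: "'a::euclidean_space set set \<Rightarrow> ('a \<Rightarrow> 'a) \<Rightarrow> 'a \<Rightarrow> 'a" where
  "average T \<phi> x = (1 / 2) *\<^sub>R (\<Sum>\<kappa> | \<kappa> \<in> T \<and> x \<in> \<kappa>. elem_poly_vec \<kappa> \<phi> x)"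

definition boundary_trace :: "'a::euclidean_space set set \<Rightarrow> ('a \<Rightarrow> real) \<Rightarrow> 'a \<Rightarrow> real" where
  "boundary_trace T u x = (\<Sum>\<kappa> | \<kappa> \<in> T \<and> x \<in> \<kappa>. elem_poly \<kappa> u x)"

section \<open>Operators and functionals\<close>

definition is_lifting ::
    "'a::euclidean_space set \<Rightarrow> 'a set set \<Rightarrow> nat \<Rightarrow> ('a \<Rightarrow> real) \<Rightarrow> ('a \<Rightarrow> 'a) \<Rightarrow> bool" where
  "is_lifting \<Omega> T l u w \<longleftrightarrow> w \<in> broken_poly_vec \<Omega> T l \<and>
     (\<forall>\<phi>\<in>broken_poly_vec \<Omega> T l.
        (\<integral>x. w x \<bullet> \<phi> x \<partial>lebesgue_on \<Omega>) =
        - (\<integral>x. jump T u x \<bullet> average T \<phi> x \<partial>surface_on (Gamma_int \<Omega> T)))"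

text \<open>The lifting is unique up to null sets (Riesz representation); \<open>lifting\<close> is a representative.\<close>

definition lifting ::
    "'a::euclidean_space set \<Rightarrow> 'a set set \<Rightarrow> nat \<Rightarrow> ('a \<Rightarrow> real) \<Rightarrow> 'a \<Rightarrow> 'a" where
  "lifting \<Omega> T l u = (SOME w. is_lifting \<Omega> T l u w)"

definition B_op ::
    "'a::euclidean_space set \<Rightarrow> 'a set set \<Rightarrow> nat \<Rightarrow> ('a \<Rightarrow> real) \<Rightarrow> 'a \<Rightarrow> 'a" where
  "B_op \<Omega> T l v x = lifting \<Omega> T l v x + broken_grad T v x"

definition F_fun :: "'a::euclidean_space set \<Rightarrow> ('a \<Rightarrow> real) \<Rightarrow> ('a \<Rightarrow> 'a) \<Rightarrow> real" where
  "F_fun \<Omega> p q = (\<integral>x. norm (q x) powr p x \<partial>lebesgue_on \<Omega>)"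

text \<open>\<open>g\<close> is the trace of the boundary datum.\<close>

definition G_fun ::
    "'a::euclidean_space set \<Rightarrow> 'a set set \<Rightarrow> ('a \<Rightarrow> real) \<Rightarrow> ('a \<Rightarrow> real) \<Rightarrow> ('a \<Rightarrow> real) \<Rightarrow>
     ('a \<Rightarrow> real) \<Rightarrow> real" where
  "G_fun \<Omega> T p \<xi> g v =
     (\<integral>x. \<bar>v x - \<xi> x\<bar>\<^sup>2 \<partial>lebesgue_on \<Omega>) +
     (\<integral>x. (norm (jump T v x))\<^sup>2 * face_size \<Omega> T x powr (- 2 / conj_exponent (p x))
        \<partial>surface_on (Gamma_int \<Omega> T)) +
     (\<integral>x. \<bar>boundary_trace T v x - g x\<bar>\<^sup>2 * face_size \<Omega> T x powr (- 2 / conj_exponent (p x))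
        \<partial>surface_on (frontier \<Omega>))"

definition Lagr ::
    "'a::euclidean_space set \<Rightarrow> 'a set set \<Rightarrow> nat \<Rightarrow> ('a \<Rightarrow> real) \<Rightarrow> ('a \<Rightarrow> real) \<Rightarrow> ('a \<Rightarrow> real) \<Rightarrow>
     real \<Rightarrow> ('a \<Rightarrow> real) \<Rightarrow> ('a \<Rightarrow> 'a) \<Rightarrow> ('a \<Rightarrow> 'a) \<Rightarrow> real" where
  "Lagr \<Omega> T l p \<xi> g r v q \<mu> =
     F_fun \<Omega> p q + G_fun \<Omega> T p \<xi> g v +
     L2_inner (lebesgue_on \<Omega>) \<mu> (\<lambda>x. B_op \<Omega> T l v x - q x) +
     r / 2 * (L2_norm_on (lebesgue_on \<Omega>) (\<lambda>x. B_op \<Omega> T l v x - q x))\<^sup>2"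

definition saddle_point ::
    "'v set \<Rightarrow> 'q set \<Rightarrow> 'm set \<Rightarrow> ('v \<Rightarrow> 'q \<Rightarrow> 'm \<Rightarrow> real) \<Rightarrow> 'v \<Rightarrow> 'q \<Rightarrow> 'm \<Rightarrow> bool" where
  "saddle_point V H M \<L> u \<eta> lam \<longleftrightarrow> u \<in> V \<and> \<eta> \<in> H \<and> lam \<in> M \<and>
     (\<forall>v\<in>V. \<forall>q\<in>H. \<forall>\<mu>\<in>M. \<L> u \<eta> \<mu> \<le> \<L> u \<eta> lam \<and> \<L> u \<eta> lam \<le> \<L> v q lam)"

definition algorithm1 ::
    "'a::euclidean_space set \<Rightarrow> ('a \<Rightarrow> real) set \<Rightarrow> ('a \<Rightarrow> 'a) set \<Rightarrow> (('a \<Rightarrow> real) \<Rightarrow> 'a \<Rightarrow> 'a) \<Rightarrow>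
     (('a \<Rightarrow> real) \<Rightarrow> ('a \<Rightarrow> 'a) \<Rightarrow> ('a \<Rightarrow> 'a) \<Rightarrow> real) \<Rightarrow> (nat \<Rightarrow> real) \<Rightarrow>
     (nat \<Rightarrow> 'a \<Rightarrow> real) \<Rightarrow> (nat \<Rightarrow> 'a \<Rightarrow> 'a) \<Rightarrow> (nat \<Rightarrow> 'a \<Rightarrow> 'a) \<Rightarrow> bool" where
  "algorithm1 \<Omega> V H B \<L> \<rho> us \<eta>s lams \<longleftrightarrow> lams 0 \<in> H \<and>
     (\<forall>n. us n \<in> V \<and> \<eta>s n \<in> H \<and> lams (Suc n) \<in> H \<and> 0 < \<rho> n \<and>
        (\<forall>v\<in>V. \<forall>q\<in>H. \<L> (us n) (\<eta>s n) (lams n) \<le> \<L> v q (lams n)) \<and>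
        (AE x in lebesgue_on \<Omega>. lams (Suc n) x = lams n x + \<rho> n *\<^sub>R (B (us n) x - \<eta>s n x)))"

end

(* All spaces involved are finite-dimensional modulo null sets, so every operator that is linear up
   to null sets is bounded for the L2 norms: Gram-Schmidt provides an orthonormal basis, and the
   lifting exists by Riesz representation.  It therefore suffices to show that u_n tends to u in L2
   and that the residual w_n = B u_n - eta_n tends to 0.

   G is strongly convex because of its term |v - xi|^2, and F is convex.  The variational inequality
   at the iterate, tested with the saddle point, and the one at the saddle point, tested with the
   iterate, add up to
     <lam_n - lam, w_n> + r |w_n|^2 + 2 |u_n - u|^2 <= 0,
   whence |lam_n - lam|^2 decreases in each step by at least
     4 rho_n |u_n - u|^2 + rho_n (2 r - rho_n) |w_n|^2.

   Of the surface measure only its finiteness on the faces is needed.  It follows from covering a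
   bounded piece of a hyperplane by small cubes. *)

theory Submission
  imports Defs
begin

section \<open>Finite-dimensional subspaces of \<open>L\<^sup>2\<close>\<close>

text \<open>Members of the spaces are concrete functions, equality is meant up to null sets, and
  \<open>lifting\<close> and \<open>elem_poly\<close> are choices. Two devices deal with this.
  Operators are required to be linear in the sense of \<open>AE_linear\<close>, which accepts any
  representative of a combination. And a polynomial is determined by its values almost everywhere on
  a nonempty open set; hence element polynomials depend only on the almost everywhere class, and
  jumps, averages, traces and gradients are linear at every point. This gives a meaning to values on
  faces, which are null sets for the volume. A nonintegrable function has Bochner integral 0, so
  each convexity step must come with integrability; it is drawn from bounded Borel representatives
  on finite measures. The saddle point inequality in the multiplier, tested with
  \<open>lam + (B u - eta)\<close>, forces \<open>eta = B u\<close>. Therefore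
  \<open>eta_n - eta\<close> is \<open>(B u_n - B u) - w_n\<close>, and
  \<open>lam_(n+1) - lam_n\<close> is \<open>rho_n w_n\<close>, so both follow from the limits of
  \<open>u_n\<close> and \<open>w_n\<close>. For the multipliers themselves the decrease gives
  boundedness.\<close>

lemma L2D:
  assumes "f \<in> L2 M"
  shows "f \<in> borel_measurable M" "integrable M (\<lambda>x. (norm (f x))\<^sup>2)"
  using assms by (auto simp: L2_def)

lemma L2_zero: "(\<lambda>x. 0) \<in> L2 M"
  by (simp add: L2_def)

lemma L2_lincomb:
  fixes f g :: "'a \<Rightarrow> 'b::euclidean_space"
  assumes "f \<in> L2 M" "g \<in> L2 M"
  shows "(\<lambda>x. a *\<^sub>R f x + b *\<^sub>R g x) \<in> L2 M"
proof -
  have [measurable]: "f \<in> borel_measurable M" "g \<in> borel_measurable M"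
    using assms by (auto simp: L2_def)
  have "integrable M (\<lambda>x. (norm (a *\<^sub>R f x + b *\<^sub>R g x))\<^sup>2)"
  proof (rule Bochner_Integration.integrable_bound)
    show "integrable M (\<lambda>x. 2 * a\<^sup>2 * (norm (f x))\<^sup>2 + 2 * b\<^sup>2 * (norm (g x))\<^sup>2)"
      using assms by (intro Bochner_Integration.integrable_add integrable_mult_right L2D)
    have "(norm (a *\<^sub>R f x + b *\<^sub>R g x))\<^sup>2 \<le> 2 * a\<^sup>2 * (norm (f x))\<^sup>2 + 2 * b\<^sup>2 * (norm (g x))\<^sup>2" for x
    proof -
      have "(norm (a *\<^sub>R f x + b *\<^sub>R g x))\<^sup>2 \<le> (\<bar>a\<bar> * norm (f x) + \<bar>b\<bar> * norm (g x))\<^sup>2"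
        by (rule power_mono) (auto intro: norm_triangle_le)
      also have "\<dots> \<le> 2 * (\<bar>a\<bar> * norm (f x))\<^sup>2 + 2 * (\<bar>b\<bar> * norm (g x))\<^sup>2"
        using sum_squares_bound[of "\<bar>a\<bar> * norm (f x)" "\<bar>b\<bar> * norm (g x)"]
        by (simp add: power2_sum)
      finally show ?thesis by (simp add: power_mult_distrib)
    qed
    then show "AE x in M. norm ((norm (a *\<^sub>R f x + b *\<^sub>R g x))\<^sup>2)
        \<le> norm (2 * a\<^sup>2 * (norm (f x))\<^sup>2 + 2 * b\<^sup>2 * (norm (g x))\<^sup>2)"
      by (intro AE_I2) (simp add: abs_of_nonneg)
  qed measurable
  then show ?thesis by (simp add: L2_def)
qed

lemma L2_diff:
  fixes f g :: "'a \<Rightarrow> 'b::euclidean_space"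
  shows "f \<in> L2 M \<Longrightarrow> g \<in> L2 M \<Longrightarrow> (\<lambda>x. f x - g x) \<in> L2 M"
  using L2_lincomb[of f M g 1 "-1"] by simp

lemma L2_scaleR:
  fixes f :: "'a \<Rightarrow> 'b::euclidean_space"
  shows "f \<in> L2 M \<Longrightarrow> (\<lambda>x. c *\<^sub>R f x) \<in> L2 M"
  using L2_lincomb[of f M f c 0] by simp

lemma L2_sum:
  fixes f :: "'i \<Rightarrow> 'a \<Rightarrow> 'b::euclidean_space"
  assumes "\<And>i. i \<in> I \<Longrightarrow> f i \<in> L2 M"
  shows "(\<lambda>x. \<Sum>i\<in>I. f i x) \<in> L2 M"
  using assms
proof (induction I rule: infinite_finite_induct)
  case (insert i I)
  then show ?case using L2_lincomb[of "f i" M "\<lambda>x. \<Sum>i\<in>I. f i x" 1 1] by simp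
qed (auto simp: L2_zero)

lemma L2_bounded:
  fixes f :: "'a \<Rightarrow> 'b::euclidean_space"
  assumes "finite_measure M" "f \<in> borel_measurable M" "\<And>x. x \<in> space M \<Longrightarrow> norm (f x) \<le> K"
  shows "f \<in> L2 M"
proof -
  interpret finite_measure M by fact
  note [measurable] = assms(2)
  have "integrable M (\<lambda>x. (norm (f x))\<^sup>2)"
  proof (rule integrable_const_bound)
    show "AE x in M. norm ((norm (f x))\<^sup>2) \<le> K\<^sup>2"
      using assms(3) by (intro AE_I2) (simp add: power_mono)
  qed measurable
  then show ?thesis using assms(2) by (simp add: L2_def)
qed

lemma L2_inner_integrable:
  fixes f g :: "'a \<Rightarrow> 'b::euclidean_space"
  assumes "f \<in> L2 M" "g \<in> L2 M"
  shows "integrable M (\<lambda>x. f x \<bullet> g x)"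
proof -
  have [measurable]: "f \<in> borel_measurable M" "g \<in> borel_measurable M"
    using assms by (auto simp: L2_def)
  show ?thesis
  proof (rule Bochner_Integration.integrable_bound)
    show "integrable M (\<lambda>x. (norm (f x))\<^sup>2 + (norm (g x))\<^sup>2)"
      using assms by (intro Bochner_Integration.integrable_add L2D)
    have "\<bar>f x \<bullet> g x\<bar> \<le> (norm (f x))\<^sup>2 + (norm (g x))\<^sup>2" for x
    proof -
      have "\<bar>f x \<bullet> g x\<bar> \<le> norm (f x) * norm (g x)" by (rule Cauchy_Schwarz_ineq2)
      also have "\<dots> \<le> (norm (f x))\<^sup>2 + (norm (g x))\<^sup>2"
        using sum_squares_bound[of "norm (f x)" "norm (g x)"]
          mult_nonneg_nonneg[OF norm_ge_zero norm_ge_zero, of "f x" "g x"] by linarith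
      finally show ?thesis .
    qed
    then show "AE x in M. norm (f x \<bullet> g x) \<le> norm ((norm (f x))\<^sup>2 + (norm (g x))\<^sup>2)"
      by (intro AE_I2) (simp add: abs_of_nonneg)
  qed measurable
qed

lemma L2_inner_commute: "L2_inner M f g = L2_inner M g f"
  by (simp add: L2_inner_def inner_commute)

lemma L2_inner_self: "L2_inner M f f = (L2_norm_on M f)\<^sup>2"
  by (simp add: L2_inner_def L2_norm_on_def power2_norm_eq_inner)

lemma L2_inner_lincomb_left:
  fixes f g h :: "'a \<Rightarrow> 'b::euclidean_space"
  assumes "f \<in> L2 M" "g \<in> L2 M" "h \<in> L2 M"
  shows "L2_inner M (\<lambda>x. a *\<^sub>R f x + b *\<^sub>R g x) h = a * L2_inner M f h + b * L2_inner M g h"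
  using L2_inner_integrable[OF assms(1,3)] L2_inner_integrable[OF assms(2,3)]
  by (simp add: L2_inner_def inner_add_left)

lemma L2_inner_lincomb_right:
  fixes f g h :: "'a \<Rightarrow> 'b::euclidean_space"
  assumes "f \<in> L2 M" "g \<in> L2 M" "h \<in> L2 M"
  shows "L2_inner M h (\<lambda>x. a *\<^sub>R f x + b *\<^sub>R g x) = a * L2_inner M h f + b * L2_inner M h g"
  using L2_inner_lincomb_left[OF assms] by (simp add: L2_inner_commute)

lemma L2_inner_sum_left:
  fixes f :: "'i \<Rightarrow> 'a \<Rightarrow> 'b::euclidean_space"
  assumes "\<And>i. i \<in> I \<Longrightarrow> f i \<in> L2 M" "h \<in> L2 M"
  shows "L2_inner M (\<lambda>x. \<Sum>i\<in>I. c i *\<^sub>R f i x) h = (\<Sum>i\<in>I. c i * L2_inner M (f i) h)"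
  using L2_inner_integrable[OF assms(1) assms(2)]
  by (simp add: L2_inner_def inner_sum_left)

lemma L2_inner_cong_AE:
  fixes f g f' g' :: "'a \<Rightarrow> 'b::euclidean_space"
  assumes "f \<in> L2 M" "g \<in> L2 M" "f' \<in> L2 M" "g' \<in> L2 M"
    and "AE x in M. f x = f' x" "AE x in M. g x = g' x"
  shows "L2_inner M f g = L2_inner M f' g'"
  unfolding L2_inner_def
proof (rule integral_cong_AE)
  show "AE x in M. f x \<bullet> g x = f' x \<bullet> g' x" using assms(5,6) by eventually_elim simp
qed (use assms in \<open>auto simp: L2_def\<close>)

lemma L2_inner_self_eq_0:
  fixes f :: "'a \<Rightarrow> 'b::euclidean_space"
  assumes "f \<in> L2 M"
  shows "L2_inner M f f = 0 \<longleftrightarrow> (AE x in M. f x = 0)"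
proof -
  have "integrable M (\<lambda>x. f x \<bullet> f x)" using assms by (intro L2_inner_integrable)
  then have "(\<integral>x. f x \<bullet> f x \<partial>M) = 0 \<longleftrightarrow> (AE x in M. f x \<bullet> f x = 0)"
    by (intro integral_nonneg_eq_0_iff_AE) auto
  then show ?thesis by (simp add: L2_inner_def)
qed

lemma L2_inner_lincomb_self:
  fixes f g :: "'a \<Rightarrow> 'b::euclidean_space"
  assumes "f \<in> L2 M" "g \<in> L2 M"
  shows "L2_inner M (\<lambda>x. a *\<^sub>R f x + b *\<^sub>R g x) (\<lambda>x. a *\<^sub>R f x + b *\<^sub>R g x) =
    a\<^sup>2 * L2_inner M f f + 2 * a * b * L2_inner M f g + b\<^sup>2 * L2_inner M g g"
  using assms L2_inner_commute[of M f g]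
  by (simp add: L2_inner_lincomb_left L2_inner_lincomb_right L2_lincomb power2_eq_square algebra_simps)

lemma L2_inner_self_nonneg: "0 \<le> L2_inner M f f"
  by (simp add: L2_inner_self)

text \<open>The expansions for \<open>b\<close> and \<open>-b\<close> add up to the parallelogram
  identity, in which the nonnegative square belonging to \<open>-b\<close> is dropped.\<close>

lemma L2_inner_lincomb_self_le:
  fixes f g :: "'a \<Rightarrow> 'b::euclidean_space"
  assumes "f \<in> L2 M" "g \<in> L2 M"
  shows "L2_inner M (\<lambda>x. a *\<^sub>R f x + b *\<^sub>R g x) (\<lambda>x. a *\<^sub>R f x + b *\<^sub>R g x) \<le>
    2 * a\<^sup>2 * L2_inner M f f + 2 * b\<^sup>2 * L2_inner M g g"
  using L2_inner_lincomb_self[OF assms, of a b] L2_inner_lincomb_self[OF assms, of a "-b"]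
    L2_inner_self_nonneg[of M "\<lambda>x. a *\<^sub>R f x + (-b) *\<^sub>R g x"]
  by (simp add: algebra_simps)

section \<open>Subspaces, orthonormal expansions and finite dimension\<close>

definition L2_subspace :: "'a measure \<Rightarrow> ('a \<Rightarrow> 'b::euclidean_space) set \<Rightarrow> bool" where
  "L2_subspace M S \<longleftrightarrow> S \<subseteq> L2 M \<and> (\<lambda>x. 0) \<in> S \<and>
     (\<forall>f\<in>S. \<forall>g\<in>S. \<forall>a b. (\<lambda>x. a *\<^sub>R f x + b *\<^sub>R g x) \<in> S)"

lemma L2_subspaceD:
  assumes "L2_subspace M S"
  shows "S \<subseteq> L2 M" "(\<lambda>x. 0) \<in> S" "f \<in> S \<Longrightarrow> g \<in> S \<Longrightarrow> (\<lambda>x. a *\<^sub>R f x + b *\<^sub>R g x) \<in> S"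
  using assms by (auto simp: L2_subspace_def)

lemma L2_subspace_diff:
  assumes "L2_subspace M S" "f \<in> S" "g \<in> S"
  shows "(\<lambda>x. f x - g x) \<in> S"
  using L2_subspaceD(3)[OF assms, of 1 "-1"] by simp

lemma L2_subspace_sum:
  assumes "L2_subspace M S" "\<And>i. i \<in> I \<Longrightarrow> f i \<in> S"
  shows "(\<lambda>x. \<Sum>i\<in>I. c i *\<^sub>R f i x) \<in> S"
  using assms(2)
proof (induction I rule: infinite_finite_induct)
  case (insert i I)
  then show ?case
    using L2_subspaceD(3)[OF assms(1), of "f i" "\<lambda>x. \<Sum>i\<in>I. c i *\<^sub>R f i x" "c i" 1] by simp
qed (auto simp: L2_subspaceD(2)[OF assms(1)])

definition orthonormal_L2 :: "'a measure \<Rightarrow> ('a \<Rightarrow> 'b::euclidean_space) set \<Rightarrow> bool" where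
  "orthonormal_L2 M E \<longleftrightarrow> finite E \<and> E \<subseteq> L2 M \<and>
     (\<forall>e\<in>E. \<forall>e'\<in>E. L2_inner M e e' = (if e = e' then 1 else 0))"

text \<open>Gram-Schmidt modulo null sets. The residual of a new vector after projection is either
  almost everywhere zero and discarded, or normalised and added, so dependent vectors in
  \<open>X\<close> do no harm. Carrying the Fourier expansion through the induction delivers the
  coefficients along with the basis.\<close>

lemma gram_schmidt_L2:
  fixes S :: "('a \<Rightarrow> 'b::euclidean_space) set"
  assumes S: "L2_subspace M S" and "finite X" "X \<subseteq> S"
  shows "\<exists>E\<subseteq>S. orthonormal_L2 M E \<and>
    (\<forall>f\<in>X. AE x in M. f x = (\<Sum>e\<in>E. L2_inner M f e *\<^sub>R e x))"
  using assms(2,3)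
proof (induction X rule: finite_induct)
  case empty
  show ?case by (intro exI[of _ "{}"]) (auto simp: orthonormal_L2_def)
next
  case (insert f X)
  then obtain E where E: "E \<subseteq> S" "orthonormal_L2 M E"
    and EX: "\<forall>f\<in>X. AE x in M. f x = (\<Sum>e\<in>E. L2_inner M f e *\<^sub>R e x)" by auto
  have SL: "S \<subseteq> L2 M" using S by (rule L2_subspaceD)
  have fS: "f \<in> S" and XS: "X \<subseteq> S" using insert by auto
  have finE: "finite E" and EL: "E \<subseteq> L2 M" using E by (auto simp: orthonormal_L2_def)
  define P where "P = (\<lambda>x. \<Sum>e\<in>E. L2_inner M f e *\<^sub>R e x)"
  have PS: "P \<in> S" unfolding P_def by (rule L2_subspace_sum[OF S, where f = "\<lambda>e. e"]) (use E in auto)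
  have Pe: "L2_inner M P e = L2_inner M f e" if "e \<in> E" for e
  proof -
    have "L2_inner M P e = (\<Sum>e'\<in>E. L2_inner M f e' * L2_inner M e' e)"
      unfolding P_def by (rule L2_inner_sum_left) (use EL that in auto)
    also have "\<dots> = (\<Sum>e'\<in>E. if e' = e then L2_inner M f e else 0)"
      using E that by (intro sum.cong) (auto simp: orthonormal_L2_def)
    finally show ?thesis using finE that by simp
  qed
  define y where "y = (\<lambda>x. f x - P x)"
  have yS: "y \<in> S" unfolding y_def by (rule L2_subspace_diff[OF S fS PS])
  have inL: "f \<in> L2 M" "P \<in> L2 M" "y \<in> L2 M" using SL fS PS yS by auto
  have ye: "L2_inner M y e = 0" if "e \<in> E" for e
    using L2_inner_lincomb_left[of f M P e 1 "-1"] inL EL that Pe[OF that] by (auto simp: y_def)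
  show ?case
  proof (cases "L2_inner M y y = 0")
    case True
    then have "AE x in M. y x = 0" using L2_inner_self_eq_0 inL by blast
    then have "AE x in M. f x = P x" by eventually_elim (simp add: y_def)
    then show ?thesis using E EX by (intro exI[of _ E]) (auto simp: P_def)
  next
    case False
    define N where "N = sqrt (L2_inner M y y)"
    have N: "N > 0" "N\<^sup>2 = L2_inner M y y"
      using False L2_inner_self_nonneg[of M y] by (auto simp: N_def)
    define e0 where "e0 = (\<lambda>x. (1 / N) *\<^sub>R y x)"
    have e0S: "e0 \<in> S" using L2_subspaceD(3)[OF S yS yS, of "1/N" 0] by (simp add: e0_def)
    have e0L: "e0 \<in> L2 M" using e0S SL by auto
    have e0l: "L2_inner M e0 g = L2_inner M y g / N" for g
      by (simp add: e0_def L2_inner_def)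
    have e0e0: "L2_inner M e0 e0 = 1"
    proof -
      have "L2_inner M e0 e0 = L2_inner M e0 y / N" by (simp add: e0l L2_inner_commute)
      also have "\<dots> = L2_inner M y y / N / N" by (simp add: e0l)
      finally show ?thesis using N False by (simp add: power2_eq_square[symmetric] field_simps)
    qed
    have e0E: "L2_inner M e0 e = 0" if "e \<in> E" for e using ye[OF that] by (simp add: e0l)
    have nin: "e0 \<notin> E" using e0e0 e0E by force
    have "L2_inner M e e0 = 0" if "e \<in> E" for e
      using e0E[OF that] by (subst L2_inner_commute)
    then have on: "orthonormal_L2 M (insert e0 E)"
      using E e0e0 e0E e0L nin unfolding orthonormal_L2_def by auto
    have "AE x in M. g x = (\<Sum>e\<in>insert e0 E. L2_inner M g e *\<^sub>R e x)" if g: "g \<in> insert f X" for g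
    proof (cases "g = f")
      case True
      \<comment> \<open>The projection \<open>P\<close> is orthogonal to \<open>y\<close>, so
        \<open>f\<close> and \<open>y\<close> have the same inner product with \<open>y\<close>. The
        new coefficient is therefore \<open>N\<close>, just what turns \<open>e0\<close> back into
        \<open>y\<close>.\<close>
      have fe0: "L2_inner M f e0 = N"
      proof -
        have "L2_inner M P y = 0"
        proof -
          have "L2_inner M P y = (\<Sum>e\<in>E. L2_inner M f e * L2_inner M e y)"
            unfolding P_def by (rule L2_inner_sum_left) (use EL inL in auto)
          then show ?thesis using ye by (simp add: L2_inner_commute)
        qed
        moreover have "L2_inner M y y = L2_inner M f y - L2_inner M P y"
          using L2_inner_lincomb_left[of f M P y 1 "-1"] inL by (simp add: y_def)
        ultimately have "L2_inner M f e0 = L2_inner M y y / N"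
          using e0l[of f] L2_inner_commute[of M f e0] L2_inner_commute[of M y f] by simp
        then show ?thesis using N(1) unfolding N(2)[symmetric] by (simp add: power2_eq_square)
      qed
      have "(\<Sum>e\<in>insert e0 E. L2_inner M f e *\<^sub>R e x) = f x" for x
        using nin finE N(1) fe0 by (simp add: e0_def y_def P_def)
      then show ?thesis using True by simp
    next
      case False
      then have gX: "g \<in> X" using g by auto
      then have ae: "AE x in M. g x = (\<Sum>e\<in>E. L2_inner M g e *\<^sub>R e x)" using EX by blast
      \<comment> \<open>An earlier vector is almost everywhere a combination of \<open>E\<close>, to
        which \<open>e0\<close> is orthogonal; enlarging the basis leaves its expansion
        unchanged.\<close>
      have "L2_inner M g e0 = L2_inner M (\<lambda>x. \<Sum>e\<in>E. L2_inner M g e *\<^sub>R e x) e0"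
        by (rule L2_inner_cong_AE)
          (use ae gX XS SL e0L EL in \<open>auto intro!: L2_sum L2_scaleR\<close>)
      also have "\<dots> = (\<Sum>e\<in>E. L2_inner M g e * L2_inner M e e0)"
        by (rule L2_inner_sum_left) (use EL e0L in auto)
      also have "\<dots> = 0" using e0E by (simp add: L2_inner_commute[of M _ e0])
      finally have "L2_inner M g e0 = 0" .
      then show ?thesis using ae nin finE by simp
    qed
    then show ?thesis using on E e0S by (intro exI[of _ "insert e0 E"]) auto
  qed
qed

definition L2_finite_dim :: "'a measure \<Rightarrow> ('a \<Rightarrow> 'b::euclidean_space) set \<Rightarrow> bool" where
  "L2_finite_dim M S \<longleftrightarrow> L2_subspace M S \<and>
     (\<exists>X. finite X \<and> X \<subseteq> S \<and> (\<forall>f\<in>S. \<exists>c. AE x in M. f x = (\<Sum>g\<in>X. c g *\<^sub>R g x)))"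

text \<open>Gram-Schmidt gives the expansion on a finite spanning set only. Both of its sides are
  linear in \<open>f\<close>, so it passes to combinations, and a finite union of null sets is
  null.\<close>

lemma L2_finite_dim_orthonormal_basis:
  fixes S :: "('a \<Rightarrow> 'b::euclidean_space) set"
  assumes "L2_finite_dim M S"
  obtains E where "E \<subseteq> S" "orthonormal_L2 M E"
    "\<And>f. f \<in> S \<Longrightarrow> AE x in M. f x = (\<Sum>e\<in>E. L2_inner M f e *\<^sub>R e x)"
proof -
  have S: "L2_subspace M S" using assms by (simp add: L2_finite_dim_def)
  obtain X where X: "finite X" "X \<subseteq> S"
    and sp: "\<forall>f\<in>S. \<exists>c. AE x in M. f x = (\<Sum>g\<in>X. c g *\<^sub>R g x)"
    using assms by (auto simp: L2_finite_dim_def)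
  obtain E where E: "E \<subseteq> S" "orthonormal_L2 M E"
    and EX: "\<forall>f\<in>X. AE x in M. f x = (\<Sum>e\<in>E. L2_inner M f e *\<^sub>R e x)"
    using gram_schmidt_L2[OF S X] by auto
  have SL: "S \<subseteq> L2 M" using S by (rule L2_subspaceD)
  have "AE x in M. f x = (\<Sum>e\<in>E. L2_inner M f e *\<^sub>R e x)" if f: "f \<in> S" for f
  proof -
    obtain c where c: "AE x in M. f x = (\<Sum>g\<in>X. c g *\<^sub>R g x)" using sp f by auto
    have ip: "L2_inner M f e = (\<Sum>g\<in>X. c g * L2_inner M g e)" if "e \<in> E" for e
    proof -
      have "L2_inner M f e = L2_inner M (\<lambda>x. \<Sum>g\<in>X. c g *\<^sub>R g x) e"
        by (rule L2_inner_cong_AE)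
          (use c f X E SL that in \<open>auto intro!: L2_sum L2_scaleR\<close>)
      also have "\<dots> = (\<Sum>g\<in>X. c g * L2_inner M g e)"
        by (rule L2_inner_sum_left) (use X E SL that in auto)
      finally show ?thesis .
    qed
    have "AE x in M. \<forall>g\<in>X. g x = (\<Sum>e\<in>E. L2_inner M g e *\<^sub>R e x)"
      using X(1) EX by (subst AE_ball_countable) (auto intro: countable_finite)
    with c show ?thesis
    proof eventually_elim
      case (elim x)
      have "f x = (\<Sum>g\<in>X. c g *\<^sub>R (\<Sum>e\<in>E. L2_inner M g e *\<^sub>R e x))"
        using elim by (metis (no_types, lifting) sum.cong)
      also have "\<dots> = (\<Sum>g\<in>X. \<Sum>e\<in>E. (c g * L2_inner M g e) *\<^sub>R e x)"
        by (simp add: scaleR_sum_right)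
      also have "\<dots> = (\<Sum>e\<in>E. \<Sum>g\<in>X. (c g * L2_inner M g e) *\<^sub>R e x)"
        by (rule sum.swap)
      also have "\<dots> = (\<Sum>e\<in>E. L2_inner M f e *\<^sub>R e x)"
        using ip by (simp add: scaleR_sum_left)
      finally show ?case .
    qed
  qed
  then show ?thesis using that E by blast
qed

text \<open>Allowing \<open>h\<close> to be any element equal to the combination almost everywhere makes the notion
  include compatibility with equality almost everywhere.\<close>

definition AE_linear :: "'a measure \<Rightarrow> ('a \<Rightarrow> 'b::euclidean_space) set \<Rightarrow> 'c measure \<Rightarrow>
    (('a \<Rightarrow> 'b) \<Rightarrow> 'c \<Rightarrow> 'd::euclidean_space) \<Rightarrow> bool" where
  "AE_linear M S M' \<Lambda> \<longleftrightarrow> (\<forall>f\<in>S. \<forall>g\<in>S. \<forall>h\<in>S. \<forall>a b.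
     (AE x in M. h x = a *\<^sub>R f x + b *\<^sub>R g x) \<longrightarrow> (AE x in M'. \<Lambda> h x = a *\<^sub>R \<Lambda> f x + b *\<^sub>R \<Lambda> g x))"

lemma AE_linearD:
  assumes "AE_linear M S M' \<Lambda>" "f \<in> S" "g \<in> S" "h \<in> S" "AE x in M. h x = a *\<^sub>R f x + b *\<^sub>R g x"
  shows "AE x in M'. \<Lambda> h x = a *\<^sub>R \<Lambda> f x + b *\<^sub>R \<Lambda> g x"
  using assms by (auto simp: AE_linear_def)

lemma AE_linear_sum:
  assumes S: "L2_subspace M S" and \<Lambda>: "AE_linear M S M' \<Lambda>" and "finite I"
    and "\<And>i. i \<in> I \<Longrightarrow> f i \<in> S" "h \<in> S" "AE x in M. h x = (\<Sum>i\<in>I. c i *\<^sub>R f i x)"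
  shows "AE x in M'. \<Lambda> h x = (\<Sum>i\<in>I. c i *\<^sub>R \<Lambda> (f i) x)"
  using assms(3-)
proof (induction I arbitrary: h rule: finite_induct)
  case empty
  \<comment> \<open>The empty sum makes \<open>h\<close> almost everywhere zero, hence equal to
    \<open>0 * h + 0 * h\<close>, and linearity makes its image vanish almost everywhere.\<close>
  then show ?case using AE_linearD[OF \<Lambda>, of h h h 0 0] by simp
next
  case (insert i I)
  let ?g = "\<lambda>x. \<Sum>i\<in>I. c i *\<^sub>R f i x"
  have g: "?g \<in> S" using insert by (intro L2_subspace_sum[OF S]) auto
  have "AE x in M'. \<Lambda> ?g x = (\<Sum>i\<in>I. c i *\<^sub>R \<Lambda> (f i) x)"
    using insert g by (intro insert.IH) auto
  moreover have "AE x in M'. \<Lambda> h x = c i *\<^sub>R \<Lambda> (f i) x + 1 *\<^sub>R \<Lambda> ?g x"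
    using insert g by (intro AE_linearD[OF \<Lambda>]) auto
  ultimately show ?case by eventually_elim (use insert in simp)
qed

lemma AE_linear_diff:
  assumes "L2_subspace M S" "AE_linear M S M' \<Lambda>" "f \<in> S" "g \<in> S"
  shows "AE x in M'. \<Lambda> (\<lambda>x. f x - g x) x = \<Lambda> f x - \<Lambda> g x"
  using AE_linearD[OF assms(2,3,4) L2_subspace_diff[OF assms(1,3,4)], of 1 "-1"] by simp

text \<open>In an orthonormal basis the operator is determined by finitely many images.
  Cauchy-Schwarz over the basis at each point, then integration and Parseval's identity for the
  coefficients, give as constant the sum of the squared norms of these images.\<close>

lemma AE_linear_bounded:
  fixes S :: "('a \<Rightarrow> 'b::euclidean_space) set" and \<Lambda> :: "('a \<Rightarrow> 'b) \<Rightarrow> 'c \<Rightarrow> 'd::euclidean_space"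
  assumes S: "L2_finite_dim M S" and \<Lambda>: "AE_linear M S M' \<Lambda>" and \<Lambda>L: "\<And>f. f \<in> S \<Longrightarrow> \<Lambda> f \<in> L2 M'"
  shows "\<exists>C. \<forall>f\<in>S. L2_inner M' (\<Lambda> f) (\<Lambda> f) \<le> C * L2_inner M f f"
proof -
  obtain E where E: "E \<subseteq> S" "orthonormal_L2 M E"
    and EX: "\<And>f. f \<in> S \<Longrightarrow> AE x in M. f x = (\<Sum>e\<in>E. L2_inner M f e *\<^sub>R e x)"
    using L2_finite_dim_orthonormal_basis[OF S] by blast
  have S': "L2_subspace M S" using S by (simp add: L2_finite_dim_def)
  have SL: "S \<subseteq> L2 M" using S' by (rule L2_subspaceD)
  have finE: "finite E" using E by (auto simp: orthonormal_L2_def)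
  define C where "C = (\<Sum>e\<in>E. L2_inner M' (\<Lambda> e) (\<Lambda> e))"
  have "L2_inner M' (\<Lambda> f) (\<Lambda> f) \<le> C * L2_inner M f f" if f: "f \<in> S" for f
  proof -
    let ?c = "\<lambda>e. L2_inner M f e"
    have bessel: "L2_inner M f f = (\<Sum>e\<in>E. (?c e)\<^sup>2)"
    proof -
      have "L2_inner M f f = L2_inner M (\<lambda>x. \<Sum>e\<in>E. ?c e *\<^sub>R e x) f"
        by (rule L2_inner_cong_AE)
          (use EX f E SL in \<open>auto intro!: L2_sum L2_scaleR\<close>)
      also have "\<dots> = (\<Sum>e\<in>E. ?c e * L2_inner M e f)"
        by (rule L2_inner_sum_left) (use E SL f in auto)
      also have "\<dots> = (\<Sum>e\<in>E. (?c e)\<^sup>2)"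
        unfolding power2_eq_square by (intro sum.cong refl) (subst L2_inner_commute, rule refl)
      finally show ?thesis .
    qed
    have le: "(\<Sum>e\<in>E. ?c e *\<^sub>R \<Lambda> e x) \<bullet> (\<Sum>e\<in>E. ?c e *\<^sub>R \<Lambda> e x)
        \<le> (\<Sum>e\<in>E. (?c e)\<^sup>2) * (\<Sum>e\<in>E. \<Lambda> e x \<bullet> \<Lambda> e x)" for x
    proof -
      have "norm (\<Sum>e\<in>E. ?c e *\<^sub>R \<Lambda> e x) \<le> (\<Sum>e\<in>E. \<bar>?c e\<bar> * norm (\<Lambda> e x))"
        by (rule sum_norm_le) simp
      then have "(norm (\<Sum>e\<in>E. ?c e *\<^sub>R \<Lambda> e x))\<^sup>2 \<le> (\<Sum>e\<in>E. \<bar>?c e\<bar> * norm (\<Lambda> e x))\<^sup>2"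
        by (rule power_mono) simp
      also have "\<dots> \<le> (\<Sum>e\<in>E. \<bar>?c e\<bar>\<^sup>2) * (\<Sum>e\<in>E. (norm (\<Lambda> e x))\<^sup>2)"
        by (rule Cauchy_Schwarz_ineq_sum)
      finally show ?thesis by (simp add: power2_norm_eq_inner)
    qed
    have LE: "\<Lambda> e \<in> L2 M'" if "e \<in> E" for e using \<Lambda>L E that by auto
    have ae: "AE x in M'. \<Lambda> f x = (\<Sum>e\<in>E. ?c e *\<^sub>R \<Lambda> e x)"
      by (rule AE_linear_sum[OF S' \<Lambda> finE, where f = "\<lambda>e. e"]) (use E EX f in auto)
    have "L2_inner M' (\<Lambda> f) (\<Lambda> f) =
        L2_inner M' (\<lambda>x. \<Sum>e\<in>E. ?c e *\<^sub>R \<Lambda> e x) (\<lambda>x. \<Sum>e\<in>E. ?c e *\<^sub>R \<Lambda> e x)"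
      by (rule L2_inner_cong_AE)
        (use ae \<Lambda>L f LE in \<open>auto intro!: L2_sum L2_scaleR\<close>)
    also have "\<dots> \<le> (\<integral>x. (\<Sum>e\<in>E. (?c e)\<^sup>2) * (\<Sum>e\<in>E. \<Lambda> e x \<bullet> \<Lambda> e x) \<partial>M')"
      unfolding L2_inner_def[of M' "\<lambda>x. \<Sum>e\<in>E. ?c e *\<^sub>R \<Lambda> e x"]
      by (intro integral_mono L2_inner_integrable integrable_mult_right
          Bochner_Integration.integrable_sum le L2_sum)
        (use LE in \<open>auto intro!: L2_scaleR\<close>)
    also have "\<dots> = (\<Sum>e\<in>E. (?c e)\<^sup>2) * C"
      using L2_inner_integrable[OF LE LE] by (simp add: C_def L2_inner_def)
    finally show ?thesis using bessel by (simp add: mult.commute)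
  qed
  then show ?thesis by blast
qed

section \<open>Convergence carried over by operators, and Riesz representation\<close>

lemma L2_norm_on_eq_sqrt: "L2_norm_on M f = sqrt (L2_inner M f f)"
  by (simp add: L2_norm_on_def L2_inner_def power2_norm_eq_inner)

lemma tendsto_L2I:
  assumes "\<And>n. f n \<in> L2 M" "g \<in> L2 M"
    and "(\<lambda>n. L2_inner M (\<lambda>x. f n x - g x) (\<lambda>x. f n x - g x)) \<longlonglongrightarrow> 0"
  shows "tendsto_L2 M f g"
  using assms tendsto_real_sqrt[OF assms(3)] by (simp add: tendsto_L2_def L2_norm_on_eq_sqrt)

lemma AE_linear_tendsto_0:
  assumes S: "L2_finite_dim M S" and \<Lambda>: "AE_linear M S M' \<Lambda>" "\<And>f. f \<in> S \<Longrightarrow> \<Lambda> f \<in> L2 M'"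
    and "\<And>n. f n \<in> S" "(\<lambda>n. L2_inner M (f n) (f n)) \<longlonglongrightarrow> 0"
  shows "(\<lambda>n. L2_inner M' (\<Lambda> (f n)) (\<Lambda> (f n))) \<longlonglongrightarrow> 0"
proof -
  obtain C where C: "\<forall>f\<in>S. L2_inner M' (\<Lambda> f) (\<Lambda> f) \<le> C * L2_inner M f f"
    using AE_linear_bounded[OF S \<Lambda>] by auto
  have "(\<lambda>n. C * L2_inner M (f n) (f n)) \<longlonglongrightarrow> 0"
    using tendsto_mult_left[OF assms(5), of C] by simp
  then show ?thesis
    by (rule Lim_null_comparison[rotated]) (use C assms(4) in \<open>auto simp: L2_inner_self_nonneg\<close>)
qed

text \<open>Boundedness is applied to the difference \<open>f n - g\<close>, whose image is the
  difference of the images almost everywhere; inner products do not see the exceptional set. The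
  lifting, the boundary trace, the broken gradient and \<open>B_op\<close> inherit convergence in
  this way.\<close>

lemma AE_linear_tendsto_L2:
  assumes S: "L2_finite_dim M S" and \<Lambda>: "AE_linear M S M' \<Lambda>" "\<And>f. f \<in> S \<Longrightarrow> \<Lambda> f \<in> L2 M'"
    and f: "\<And>n. f n \<in> S" "g \<in> S"
    and lim: "(\<lambda>n. L2_inner M (\<lambda>x. f n x - g x) (\<lambda>x. f n x - g x)) \<longlonglongrightarrow> 0"
  shows "tendsto_L2 M' (\<lambda>n. \<Lambda> (f n)) (\<Lambda> g)"
proof (rule tendsto_L2I)
  have S': "L2_subspace M S" using S by (simp add: L2_finite_dim_def)
  let ?d = "\<lambda>n x. f n x - g x"
  have d: "?d n \<in> S" for n using L2_subspace_diff[OF S'] f by blast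
  have "(\<lambda>n. L2_inner M' (\<Lambda> (?d n)) (\<Lambda> (?d n))) \<longlonglongrightarrow> 0"
    by (rule AE_linear_tendsto_0[OF S \<Lambda> d lim])
  moreover have "L2_inner M' (\<Lambda> (?d n)) (\<Lambda> (?d n)) =
      L2_inner M' (\<lambda>x. \<Lambda> (f n) x - \<Lambda> g x) (\<lambda>x. \<Lambda> (f n) x - \<Lambda> g x)" for n
    by (rule L2_inner_cong_AE) (use AE_linear_diff[OF S' \<Lambda>(1) f(1)[of n] f(2)] \<Lambda>(2) d f in \<open>auto intro!: L2_diff\<close>)
  ultimately show "(\<lambda>n. L2_inner M' (\<lambda>x. \<Lambda> (f n) x - \<Lambda> g x) (\<lambda>x. \<Lambda> (f n) x - \<Lambda> g x)) \<longlonglongrightarrow> 0"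
    by simp
qed (use \<Lambda> f in auto)

text \<open>The representer has the values of \<open>\<phi>\<close> on an orthonormal basis as its
  coefficients.\<close>

lemma riesz_L2_finite_dim:
  fixes S :: "('a \<Rightarrow> 'b::euclidean_space) set"
  assumes S: "L2_finite_dim M S"
    and \<phi>: "\<And>f g h a b. f \<in> S \<Longrightarrow> g \<in> S \<Longrightarrow> h \<in> S \<Longrightarrow> AE x in M. h x = a *\<^sub>R f x + b *\<^sub>R g x \<Longrightarrow>
      \<phi> h = a * \<phi> f + b * (\<phi> g :: real)"
  shows "\<exists>w\<in>S. \<forall>f\<in>S. L2_inner M w f = \<phi> f"
proof -
  obtain E where E: "E \<subseteq> S" "orthonormal_L2 M E"
    and EX: "\<And>f. f \<in> S \<Longrightarrow> AE x in M. f x = (\<Sum>e\<in>E. L2_inner M f e *\<^sub>R e x)"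
    using L2_finite_dim_orthonormal_basis[OF S] by blast
  have S': "L2_subspace M S" using S by (simp add: L2_finite_dim_def)
  have SL: "S \<subseteq> L2 M" using S' by (rule L2_subspaceD)
  have finE: "finite E" using E by (auto simp: orthonormal_L2_def)
  \<comment> \<open>The functional is viewed as an operator into functions on a one-point space. The
    only null set there is empty, so the expansion lemma for operators yields an exact
    equality.\<close>
  have lin: "AE_linear M S (count_space UNIV) (\<lambda>f (_::unit). \<phi> f)"
    unfolding AE_linear_def using \<phi> by (auto simp: AE_count_space)
  show ?thesis
  proof (intro bexI ballI)
    show "(\<lambda>x. \<Sum>e\<in>E. \<phi> e *\<^sub>R e x) \<in> S"
      by (rule L2_subspace_sum[OF S', where f = "\<lambda>e. e"]) (use E in auto)
    fix f assume f: "f \<in> S"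
    have "AE x in count_space UNIV. (\<lambda>_::unit. \<phi> f) x = (\<Sum>e\<in>E. L2_inner M f e *\<^sub>R \<phi> e)"
      by (rule AE_linear_sum[OF S' lin finE, where f = "\<lambda>e. e"]) (use E f EX in auto)
    then have "\<phi> f = (\<Sum>e\<in>E. L2_inner M f e * \<phi> e)" by (simp add: AE_count_space)
    moreover have "L2_inner M (\<lambda>x. \<Sum>e\<in>E. \<phi> e *\<^sub>R e x) f = (\<Sum>e\<in>E. \<phi> e * L2_inner M e f)"
      by (rule L2_inner_sum_left) (use E SL f in auto)
    ultimately show "L2_inner M (\<lambda>x. \<Sum>e\<in>E. \<phi> e *\<^sub>R e x) f = \<phi> f"
      by (simp add: L2_inner_commute[of M _ f] mult.commute)
  qed
qed

section \<open>Convergence of the augmented Lagrangian iteration\<close>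

text \<open>The limit from the right at 0. In the application \<open>A\<close> is the first-order
  term of a minimality condition and \<open>t * K\<close> the remainder.\<close>

lemma nonneg_if_all_perturbations_nonneg:
  fixes A K :: real
  assumes "\<And>t. 0 < t \<Longrightarrow> t < 1 \<Longrightarrow> 0 \<le> A + t * K"
  shows "0 \<le> A"
proof (rule tendsto_lowerbound)
  show "((\<lambda>t. A + t * K) \<longlongrightarrow> A) (at_right 0)"
    by (auto intro!: tendsto_eq_intros)
  show "\<forall>\<^sub>F t in at_right 0. 0 \<le> A + t * K"
    using assms by (auto simp: eventually_at_right_field intro!: exI[of _ 1])
qed simp

text \<open>Telescoping bounds all partial sums of \<open>b\<close> by \<open>a 0\<close>, and the
  terms of a convergent series tend to zero.\<close>

lemma descent_sequence:
  fixes a b :: "nat \<Rightarrow> real"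
  assumes "\<And>n. 0 \<le> a n" "\<And>n. 0 \<le> b n" "\<And>n. a (Suc n) + b n \<le> a n"
  shows "b \<longlonglongrightarrow> 0" "a n \<le> a 0"
proof -
  have sum: "(\<Sum>k<n. b k) + a n \<le> a 0" for n
    by (induction n) (use assms(3) in \<open>auto intro: order_trans[rotated]\<close>, smt (verit) assms(3))
  then have "(\<Sum>k<n. b k) \<le> a 0" for n using assms(1)[of n] by (smt (verit))
  then have "summable b" using assms(2) by (intro summableI_nonneg_bounded)
  then show "b \<longlonglongrightarrow> 0" by (rule summable_LIMSEQ_zero)
  show "a n \<le> a 0" using sum[of n] sum_nonneg[of "{..<n}" b] assms(2) by (smt (verit))
qed

text \<open>Variational inequality at a minimiser, obtained by comparison with convex combinations, so
  that no differentiability of \<open>F\<close> and \<open>G\<close> is needed.\<close>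

lemma augmented_minimiser_inequality:
  fixes F :: "('a \<Rightarrow> 'c::euclidean_space) \<Rightarrow> real" and G :: "('a \<Rightarrow> 'b::euclidean_space) \<Rightarrow> real"
  assumes V: "L2_subspace M V" and H: "L2_subspace M H"
    and F: "\<And>q q' t. q \<in> H \<Longrightarrow> q' \<in> H \<Longrightarrow> 0 < t \<Longrightarrow> t < 1 \<Longrightarrow>
      F (\<lambda>x. (1 - t) *\<^sub>R q x + t *\<^sub>R q' x) \<le> (1 - t) * F q + t * F q'"
    and G: "\<And>v v' t. v \<in> V \<Longrightarrow> v' \<in> V \<Longrightarrow> 0 < t \<Longrightarrow> t < 1 \<Longrightarrow>
      G (\<lambda>x. (1 - t) *\<^sub>R v x + t *\<^sub>R v' x) \<le> (1 - t) * G v + t * G v'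
        - t * (1 - t) * L2_inner M (\<lambda>x. v' x - v x) (\<lambda>x. v' x - v x)"
    and B: "\<And>v. v \<in> V \<Longrightarrow> B v \<in> H" "AE_linear M V M B"
    and in_spaces: "u \<in> V" "\<eta> \<in> H" "v \<in> V" "q \<in> H" "\<mu> \<in> H"
  defines "w \<equiv> \<lambda>x. B u x - \<eta> x" and "z \<equiv> \<lambda>x. B v x - q x"
  assumes min: "\<And>v q. v \<in> V \<Longrightarrow> q \<in> H \<Longrightarrow>
      F \<eta> + G u + L2_inner M \<mu> (\<lambda>x. B u x - \<eta> x)
        + r / 2 * L2_inner M (\<lambda>x. B u x - \<eta> x) (\<lambda>x. B u x - \<eta> x)
      \<le> F q + G v + L2_inner M \<mu> (\<lambda>x. B v x - q x)
        + r / 2 * L2_inner M (\<lambda>x. B v x - q x) (\<lambda>x. B v x - q x)"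
  shows "0 \<le> F q - F \<eta> + G v - G u - L2_inner M (\<lambda>x. v x - u x) (\<lambda>x. v x - u x)
    + L2_inner M \<mu> z - L2_inner M \<mu> w + r * (L2_inner M w z - L2_inner M w w)"
proof -
  have HL: "H \<subseteq> L2 M" using H by (rule L2_subspaceD)
  have wH: "w \<in> H" unfolding w_def by (intro L2_subspace_diff[OF H]) (use B in_spaces in auto)
  have zH: "z \<in> H" unfolding z_def by (intro L2_subspace_diff[OF H]) (use B in_spaces in auto)
  have L: "w \<in> L2 M" "z \<in> L2 M" "\<mu> \<in> L2 M" using wH zH in_spaces HL by auto
  let ?D = "L2_inner M (\<lambda>x. v x - u x) (\<lambda>x. v x - u x)"
  let ?i = "L2_inner M"
  let ?A = "F q - F \<eta> + G v - G u - ?D + ?i \<mu> z - ?i \<mu> w + r * (?i w z - ?i w w)"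
  \<comment> \<open>After division by \<open>t\<close> the remainder consists of \<open>?D\<close>,
    because strong convexity carries the factor \<open>t * (1 - t)\<close> instead of
    \<open>t\<close>, and of \<open>r / 2\<close> times the squared norm of \<open>w - z\<close>,
    from expanding the penalty along the segment.\<close>
  have "0 \<le> ?A + t * (?D + r / 2 * (?i w w - 2 * ?i w z + ?i z z))" if t: "0 < t" "t < 1" for t
  proof -
    define vt where "vt = (\<lambda>x. (1 - t) *\<^sub>R u x + t *\<^sub>R v x)"
    define qt where "qt = (\<lambda>x. (1 - t) *\<^sub>R \<eta> x + t *\<^sub>R q x)"
    define zt where "zt = (\<lambda>x. (1 - t) *\<^sub>R w x + t *\<^sub>R z x)"
    have vt: "vt \<in> V" unfolding vt_def by (intro L2_subspaceD(3)[OF V] in_spaces)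
    have qt: "qt \<in> H" unfolding qt_def by (intro L2_subspaceD(3)[OF H] in_spaces)
    have zt: "zt \<in> L2 M" unfolding zt_def by (intro L2_lincomb L)
    have dL: "(\<lambda>x. B vt x - qt x) \<in> L2 M" using B(1)[OF vt] qt HL by (intro L2_diff) auto
    \<comment> \<open>Linearity of \<open>B\<close> is available only almost everywhere; the inner
      products \<open>e1\<close> and \<open>e2\<close> depend on no more than that.\<close>
    have "AE x in M. B vt x = (1 - t) *\<^sub>R B u x + t *\<^sub>R B v x"
      by (rule AE_linearD[OF B(2)]) (use in_spaces vt in \<open>auto simp: vt_def\<close>)
    then have ae: "AE x in M. B vt x - qt x = zt x"
      by eventually_elim (simp add: zt_def w_def z_def qt_def algebra_simps)
    have "?i \<mu> (\<lambda>x. B vt x - qt x) = ?i \<mu> zt"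
      by (rule L2_inner_cong_AE) (use L zt ae dL in auto)
    also have "\<dots> = (1 - t) * ?i \<mu> w + t * ?i \<mu> z"
      unfolding zt_def by (rule L2_inner_lincomb_right) (use L in auto)
    finally have e1: "?i \<mu> (\<lambda>x. B vt x - qt x) = (1 - t) * ?i \<mu> w + t * ?i \<mu> z" .
    have "?i (\<lambda>x. B vt x - qt x) (\<lambda>x. B vt x - qt x) = ?i zt zt"
      by (rule L2_inner_cong_AE) (use L zt ae dL in auto)
    also have "\<dots> = (1 - t)\<^sup>2 * ?i w w + 2 * (1 - t) * t * ?i w z + t\<^sup>2 * ?i z z"
      unfolding zt_def by (rule L2_inner_lincomb_self) (use L in auto)
    finally have e2: "?i (\<lambda>x. B vt x - qt x) (\<lambda>x. B vt x - qt x) =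
      (1 - t)\<^sup>2 * ?i w w + 2 * (1 - t) * t * ?i w z + t\<^sup>2 * ?i z z" .
    have "F qt \<le> (1 - t) * F \<eta> + t * F q"
      unfolding qt_def by (intro F t in_spaces)
    moreover have "G vt \<le> (1 - t) * G u + t * G v - t * (1 - t) * ?D"
      unfolding vt_def by (intro G t in_spaces)
    moreover have "F \<eta> + G u + ?i \<mu> w + r / 2 * ?i w w \<le> F qt + G vt
        + ((1 - t) * ?i \<mu> w + t * ?i \<mu> z)
        + r / 2 * ((1 - t)\<^sup>2 * ?i w w + 2 * (1 - t) * t * ?i w z + t\<^sup>2 * ?i z z)"
      using min[OF vt qt] unfolding e1 e2 by (simp add: w_def)
    ultimately have "F \<eta> + G u + ?i \<mu> w + r / 2 * ?i w w \<le> ((1 - t) * F \<eta> + t * F q)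
        + ((1 - t) * G u + t * G v - t * (1 - t) * ?D)
        + ((1 - t) * ?i \<mu> w + t * ?i \<mu> z)
        + r / 2 * ((1 - t)\<^sup>2 * ?i w w + 2 * (1 - t) * t * ?i w z + t\<^sup>2 * ?i z z)"
      by linarith
    then have "0 \<le> t * (?A + t * (?D + r / 2 * (?i w w - 2 * ?i w z + ?i z z)))"
      by (simp add: power2_eq_square algebra_simps)
    then show ?thesis using t by (simp add: zero_le_mult_iff)
  qed
  then show ?thesis by (rule nonneg_if_all_perturbations_nonneg)
qed

text \<open>The discretisation enters only through convexity of \<open>F\<close>, strong convexity
  of \<open>G\<close> and linearity of \<open>B\<close>. The step bounds force \<open>r > 0\<close>,
  since \<open>0 < \<alpha>\<^sub>0 \<le> \<alpha>\<^sub>1 < 2 * r\<close>.\<close>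

lemma augmented_lagrangian_convergence:
  fixes F :: "('a \<Rightarrow> 'c::euclidean_space) \<Rightarrow> real" and G :: "('a \<Rightarrow> 'b::euclidean_space) \<Rightarrow> real"
    and r :: real
  assumes V: "L2_subspace M V" and H: "L2_subspace M H"
    and F: "\<And>q q' t. q \<in> H \<Longrightarrow> q' \<in> H \<Longrightarrow> 0 < t \<Longrightarrow> t < 1 \<Longrightarrow>
      F (\<lambda>x. (1 - t) *\<^sub>R q x + t *\<^sub>R q' x) \<le> (1 - t) * F q + t * F q'"
    and G: "\<And>v v' t. v \<in> V \<Longrightarrow> v' \<in> V \<Longrightarrow> 0 < t \<Longrightarrow> t < 1 \<Longrightarrow>
      G (\<lambda>x. (1 - t) *\<^sub>R v x + t *\<^sub>R v' x) \<le> (1 - t) * G v + t * G v'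
        - t * (1 - t) * L2_inner M (\<lambda>x. v' x - v x) (\<lambda>x. v' x - v x)"
    and B: "\<And>v. v \<in> V \<Longrightarrow> B v \<in> H" "AE_linear M V M B"
  defines "L \<equiv> \<lambda>v q \<mu>. F q + G v + L2_inner M \<mu> (\<lambda>x. B v x - q x)
      + r / 2 * L2_inner M (\<lambda>x. B v x - q x) (\<lambda>x. B v x - q x)"
  assumes saddle: "saddle_point V H H L u \<eta> lam"
    and steps: "\<And>n. 0 < \<alpha>\<^sub>0 \<and> \<alpha>\<^sub>0 \<le> \<rho> n \<and> \<rho> n \<le> \<alpha>\<^sub>1 \<and> \<alpha>\<^sub>1 < 2 * r"
    and iterates: "\<And>n. us n \<in> V" "\<And>n. \<eta>s n \<in> H" "\<And>n. lams n \<in> H"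
      "\<And>n v q. v \<in> V \<Longrightarrow> q \<in> H \<Longrightarrow> L (us n) (\<eta>s n) (lams n) \<le> L v q (lams n)"
      "\<And>n. AE x in M. lams (Suc n) x = lams n x + \<rho> n *\<^sub>R (B (us n) x - \<eta>s n x)"
  shows "AE x in M. \<eta> x = B u x"
    and "(\<lambda>n. L2_inner M (\<lambda>x. us n x - u x) (\<lambda>x. us n x - u x)) \<longlonglongrightarrow> 0"
    and "(\<lambda>n. L2_inner M (\<lambda>x. B (us n) x - \<eta>s n x) (\<lambda>x. B (us n) x - \<eta>s n x)) \<longlonglongrightarrow> 0"
    and "\<exists>K. \<forall>n. L2_inner M (lams n) (lams n) \<le> K"
proof -
  let ?i = "L2_inner M"
  let ?w = "\<lambda>n x. B (us n) x - \<eta>s n x"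
  have VL: "V \<subseteq> L2 M" and HL: "H \<subseteq> L2 M" using V H by (auto dest: L2_subspaceD)
  have uV: "u \<in> V" and \<eta>H: "\<eta> \<in> H" and lamH: "lam \<in> H"
    and sp1: "\<And>\<mu>. \<mu> \<in> H \<Longrightarrow> L u \<eta> \<mu> \<le> L u \<eta> lam"
    and sp2: "\<And>v q. v \<in> V \<Longrightarrow> q \<in> H \<Longrightarrow> L u \<eta> lam \<le> L v q lam"
    using saddle by (auto simp: saddle_point_def)
  note itV = iterates(1) and itH = iterates(2) and lamsH = iterates(3) and itmin = iterates(4)
    and itlam = iterates(5)
  have wH: "?w n \<in> H" for n using L2_subspace_diff[OF H] B(1) itV itH by blast
  have bH: "(\<lambda>x. B u x - \<eta> x) \<in> H" using L2_subspace_diff[OF H] B(1) uV \<eta>H by blast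
  let ?b = "\<lambda>x. B u x - \<eta> x"
  \<comment> \<open>With the test multiplier \<open>lam + (B u - \<eta>)\<close> the left saddle
    point inequality says that the squared norm of \<open>B u - \<eta>\<close> is at most 0.\<close>
  have "(\<lambda>x. 1 *\<^sub>R lam x + 1 *\<^sub>R ?b x) \<in> H" using L2_subspaceD(3)[OF H lamH bH] .
  from sp1[OF this] have "?i (\<lambda>x. 1 *\<^sub>R lam x + 1 *\<^sub>R ?b x) ?b \<le> ?i lam ?b"
    by (simp add: L_def)
  moreover have "?i (\<lambda>x. 1 *\<^sub>R lam x + 1 *\<^sub>R ?b x) ?b = 1 * ?i lam ?b + 1 * ?i ?b ?b"
    by (rule L2_inner_lincomb_left) (use lamH bH HL in auto)
  ultimately have "?i ?b ?b = 0" using L2_inner_self_nonneg[of M ?b] by simp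
  then have b0: "AE x in M. ?b x = 0" using L2_inner_self_eq_0 bH HL by blast
  then show ae\<eta>: "AE x in M. \<eta> x = B u x" by eventually_elim simp
  have ib: "?i f ?b = 0" if "f \<in> L2 M" for f
  proof -
    have "?i f ?b = ?i f (\<lambda>x. 0)"
      by (rule L2_inner_cong_AE) (use that bH HL b0 L2_zero in auto)
    then show ?thesis by (simp add: L2_inner_def)
  qed
  have bi: "?i ?b f = 0" if "f \<in> L2 M" for f
    using ib[OF that] by (subst L2_inner_commute)
  let ?D = "\<lambda>n. ?i (\<lambda>x. us n x - u x) (\<lambda>x. us n x - u x)"
  \<comment> \<open>In the sum of the two inequalities the values of \<open>F\<close> and
    \<open>G\<close> cancel, and every term containing the residual \<open>?b\<close> of the saddle
    point is zero. Each inequality contributes one squared distance, hence the factor 2; the penalty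
    survives only from the one at the iterate.\<close>
  have key: "?i (lams n) (?w n) - ?i lam (?w n) + r * ?i (?w n) (?w n) + 2 * ?D n \<le> 0" for n
  proof -
    have wL: "?w n \<in> L2 M" using wH HL by blast
    have lamL: "lam \<in> L2 M" "lams n \<in> L2 M" using lamH lamsH HL by auto
    have "0 \<le> F \<eta> - F (\<eta>s n) + G u - G (us n) - ?i (\<lambda>x. u x - us n x) (\<lambda>x. u x - us n x)
      + ?i (lams n) ?b - ?i (lams n) (?w n) + r * (?i (?w n) ?b - ?i (?w n) (?w n))"
      by (rule augmented_minimiser_inequality[where F = F and G = G and B = B, OF V H F G B])
        (use itV itH uV \<eta>H lamsH itmin[of _ _ n] in \<open>auto simp: L_def\<close>)
    moreover have "0 \<le> F (\<eta>s n) - F \<eta> + G (us n) - G u - ?D n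
      + ?i lam (?w n) - ?i lam ?b + r * (?i ?b (?w n) - ?i ?b ?b)"
      by (rule augmented_minimiser_inequality[where F = F and G = G and B = B, OF V H F G B])
        (use itV itH uV \<eta>H lamH sp2 in \<open>auto simp: L_def\<close>)
    moreover have "?i (\<lambda>x. u x - us n x) (\<lambda>x. u x - us n x) = ?D n"
      by (simp add: L2_inner_self L2_norm_on_def norm_minus_commute)
    ultimately show ?thesis using ib[OF lamL(1)] ib[OF lamL(2)] ib[OF wL] bi[OF wL] bi[of ?b] bH HL
      by (auto simp: algebra_simps)
  qed
  define a where "a n = ?i (\<lambda>x. lams n x - lam x) (\<lambda>x. lams n x - lam x)" for n
  have dH: "(\<lambda>x. lams n x - lam x) \<in> H" for n using L2_subspace_diff[OF H] lamsH lamH by blast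
  \<comment> \<open>Expansion of the square in the multiplier update; its mixed term is the quantity
    bounded by \<open>key\<close>.\<close>
  have ia: "a (Suc n) = a n + 2 * \<rho> n * (?i (lams n) (?w n) - ?i lam (?w n)) + (\<rho> n)\<^sup>2 * ?i (?w n) (?w n)" for n
  proof -
    let ?f = "\<lambda>x. 1 *\<^sub>R (lams n x - lam x) + \<rho> n *\<^sub>R ?w n x"
    have wL: "?w n \<in> L2 M" and dL: "(\<lambda>x. lams n x - lam x) \<in> L2 M" "(\<lambda>x. lams (Suc n) x - lam x) \<in> L2 M"
      using wH dH HL by auto
    have fL: "?f \<in> L2 M" by (intro L2_lincomb wL dL)
    have "AE x in M. lams (Suc n) x - lam x = ?f x"
      using itlam[of n] by eventually_elim simp
    then have "a (Suc n) = ?i ?f ?f"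
      unfolding a_def by (intro L2_inner_cong_AE dL fL)
    also have "\<dots> = 1\<^sup>2 * a n + 2 * 1 * \<rho> n * ?i (\<lambda>x. lams n x - lam x) (?w n) + (\<rho> n)\<^sup>2 * ?i (?w n) (?w n)"
      unfolding a_def by (rule L2_inner_lincomb_self[OF dL(1) wL])
    also have "?i (\<lambda>x. lams n x - lam x) (?w n) = ?i (lams n) (?w n) - ?i lam (?w n)"
      using L2_inner_lincomb_left[of "lams n" M lam "?w n" 1 "-1"] lamsH lamH wL HL by auto
    finally show ?thesis by simp
  qed
  \<comment> \<open>A lower bound for the decrease with coefficients that are positive and
    independent of \<open>n\<close>, from \<open>\<rho> n \<ge> \<alpha>\<^sub>0\<close> and
    \<open>2 * r - \<rho> n \<ge> 2 * r - \<alpha>\<^sub>1\<close>. Uniform positivity allows both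
    limits to be read off from \<open>b\<close> tending to 0.\<close>
  define b where "b n = 4 * \<alpha>\<^sub>0 * ?D n + \<alpha>\<^sub>0 * (2 * r - \<alpha>\<^sub>1) * ?i (?w n) (?w n)" for n
  have st: "0 < \<alpha>\<^sub>0" "\<alpha>\<^sub>1 < 2 * r" using steps by auto
  have bnn: "0 \<le> b n" for n using st by (simp add: b_def L2_inner_self_nonneg)
  have dec: "a (Suc n) + b n \<le> a n" for n
  proof -
    have "a (Suc n) \<le> a n + 2 * \<rho> n * (- r * ?i (?w n) (?w n) - 2 * ?D n) + (\<rho> n)\<^sup>2 * ?i (?w n) (?w n)"
      unfolding ia using steps[of n] key[of n] by (intro add_mono mult_left_mono) auto
    moreover have "4 * \<alpha>\<^sub>0 * ?D n \<le> 4 * \<rho> n * ?D n"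
      using steps[of n] by (intro mult_right_mono) (auto simp: L2_inner_self_nonneg)
    moreover have "\<alpha>\<^sub>0 * (2 * r - \<alpha>\<^sub>1) * ?i (?w n) (?w n) \<le> \<rho> n * (2 * r - \<rho> n) * ?i (?w n) (?w n)"
      using steps[of n] by (intro mult_right_mono mult_mono) (auto simp: L2_inner_self_nonneg)
    ultimately show ?thesis by (simp add: b_def power2_eq_square algebra_simps)
  qed
  have ann: "0 \<le> a n" for n by (simp add: a_def L2_inner_self_nonneg)
  have b0: "b \<longlonglongrightarrow> 0" and a0: "\<And>n. a n \<le> a 0"
    using descent_sequence[of a b, OF ann bnn dec] by auto
  show "?D \<longlonglongrightarrow> 0"
  proof (rule Lim_null_comparison)
    show "(\<lambda>n. b n / (4 * \<alpha>\<^sub>0)) \<longlonglongrightarrow> 0" using tendsto_divide[OF b0 tendsto_const[of "4 * \<alpha>\<^sub>0"]] st by simp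
    have "?D n * (4 * \<alpha>\<^sub>0) \<le> b n" for n
      using st by (simp add: b_def L2_inner_self_nonneg mult.commute)
    then show "\<forall>\<^sub>F n in sequentially. norm (?D n) \<le> b n / (4 * \<alpha>\<^sub>0)"
      using st by (intro always_eventually allI) (simp add: L2_inner_self_nonneg pos_le_divide_eq)
  qed
  show "(\<lambda>n. ?i (?w n) (?w n)) \<longlonglongrightarrow> 0"
  proof (rule Lim_null_comparison)
    let ?c = "\<alpha>\<^sub>0 * (2 * r - \<alpha>\<^sub>1)"
    have c: "?c > 0" using st by simp
    show "(\<lambda>n. b n / ?c) \<longlonglongrightarrow> 0" by (rule tendsto_divide_zero[OF b0])
    have "?i (?w n) (?w n) * ?c \<le> b n" for n
      using st by (simp add: b_def L2_inner_self_nonneg mult.commute)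
    then show "\<forall>\<^sub>F n in sequentially. norm (?i (?w n) (?w n)) \<le> b n / ?c"
      using c by (intro always_eventually allI) (simp add: L2_inner_self_nonneg pos_le_divide_eq)
  qed
  have "?i (lams n) (lams n) \<le> 2 * a 0 + 2 * ?i lam lam" for n
  proof -
    have "?i (\<lambda>x. 1 *\<^sub>R (lams n x - lam x) + 1 *\<^sub>R lam x) (\<lambda>x. 1 *\<^sub>R (lams n x - lam x) + 1 *\<^sub>R lam x)
      \<le> 2 * 1\<^sup>2 * a n + 2 * 1\<^sup>2 * ?i lam lam"
      unfolding a_def by (rule L2_inner_lincomb_self_le) (use dH lamH HL in auto)
    then show ?thesis using a0[of n] by simp
  qed
  then show "\<exists>K. \<forall>n. ?i (lams n) (lams n) \<le> K" by blast
qed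

section \<open>Surface measure of bounded subsets of hyperplanes\<close>

text \<open>Using \<open>d\<close> in place of \<open>d / 2\<close> loses a constant factor, which
  finiteness does not notice. In dimension one the weight of a nonempty set is 1, matched by
  \<open>d ^ 0\<close>.\<close>

lemma hausdorff_weight_codim1_le:
  fixes U :: "'a::euclidean_space set"
  assumes "diameter U \<le> d" "0 < d" "bounded U"
  shows "hausdorff_weight (real DIM('a) - 1) U \<le> unit_ball_vol (real DIM('a) - 1) * d ^ (DIM('a) - 1)"
proof -
  have D: "DIM('a) \<ge> 1" using DIM_positive[where 'a='a] by linarith
  then have s: "real DIM('a) - 1 = real (DIM('a) - 1)" by (simp add: of_nat_diff)
  have pos: "0 \<le> unit_ball_vol (real (DIM('a) - 1))" by simp
  have dU: "0 \<le> diameter U" using assms by (intro diameter_ge_0)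
  show ?thesis
  proof (cases "DIM('a) - 1 = 0")
    case True
    then show ?thesis unfolding s by (simp add: hausdorff_weight_def)
  next
    case False
    have "(diameter U / 2) powr real (DIM('a) - 1) \<le> d powr real (DIM('a) - 1)"
      using dU assms by (intro powr_mono2) auto
    also have "\<dots> = d ^ (DIM('a) - 1)" by (rule powr_realpow[OF assms(2)])
    finally have "(diameter U / 2) powr real (DIM('a) - 1) \<le> d ^ (DIM('a) - 1)" .
    then show ?thesis using False pos assms unfolding s
      by (auto simp: hausdorff_weight_def intro!: mult_left_mono)
  qed
qed

lemma hausdorff_weight_nonneg: "0 \<le> s \<Longrightarrow> 0 \<le> hausdorff_weight s U"
  by (simp add: hausdorff_weight_def)

text \<open>The sequence of covering sets demanded by the content is the finite family padded with
  empty sets, which have weight 0.\<close>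

lemma hausdorff_content_le_finite_cover:
  fixes A :: "'a::euclidean_space set"
  assumes "finite I" "A \<subseteq> (\<Union>i\<in>I. U i)" "\<And>i. i \<in> I \<Longrightarrow> bounded (U i) \<and> diameter (U i) \<le> \<delta>" "0 \<le> \<delta>"
    and "\<And>i. i \<in> I \<Longrightarrow> hausdorff_weight s (U i) \<le> W" and "0 \<le> s"
  shows "hausdorff_content s \<delta> A \<le> ennreal (real (card I) * W)"
proof -
  obtain f where f: "bij_betw f {..<card I} I"
    using assms(1) by (metis bij_betw_from_nat_into_finite)
  define V where "V i = (if i < card I then U (f i) else {})" for i
  have fI: "f i \<in> I" if "i < card I" for i using f that by (auto simp: bij_betw_def)
  have "A \<subseteq> (\<Union>i. V i)"
  proof
    fix x assume "x \<in> A"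
    then obtain i where "i \<in> I" "x \<in> U i" using assms by auto
    moreover then obtain j where "j < card I" "f j = i" using f by (metis bij_betw_def imageE lessThan_iff)
    ultimately have "x \<in> V j" by (simp add: V_def)
    then show "x \<in> (\<Union>i. V i)" by blast
  qed
  moreover have "bounded (V i) \<and> diameter (V i) \<le> \<delta>" for i
    using assms fI by (auto simp: V_def)
  ultimately have "hausdorff_content s \<delta> A \<le> (\<Sum>i. ennreal (hausdorff_weight s (V i)))"
    unfolding hausdorff_content_def by (intro INF_lower) auto
  also have "\<dots> = (\<Sum>i<card I. ennreal (hausdorff_weight s (V i)))"
    by (rule suminf_finite) (auto simp: V_def hausdorff_weight_def)
  also have "\<dots> \<le> (\<Sum>i<card I. ennreal W)"
    by (intro sum_mono ennreal_leI) (auto simp: V_def fI assms(5))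
  also have "\<dots> = ennreal (real (card I) * W)"
  proof (cases "I = {}")
    case False
    then obtain i where "i \<in> I" by auto
    then have "0 \<le> W" using hausdorff_weight_nonneg[OF assms(6), of "U i"] assms(5)[of i] by linarith
    then show ?thesis by (simp add: ennreal_mult' ennreal_of_nat_eq_real_of_nat)
  qed simp
  finally show ?thesis .
qed

text \<open>Along a coordinate \<open>b\<close> with \<open>a \<bullet> b \<noteq> 0\<close> the
  hyperplane is a Lipschitz graph over the other \<open>?n\<close> coordinates. Cubes of side
  \<open>d\<close> in these cut \<open>A\<close> into pieces of diameter at most
  \<open>L * d\<close>; their number grows like the inverse of \<open>d ^ ?n\<close>, so the total
  weight stays bounded as \<open>d\<close> shrinks.\<close>

lemma hausdorff_outer_hyperplane_finite:
  fixes A :: "'a::euclidean_space set"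
  assumes "bounded A" "a \<noteq> 0" "A \<subseteq> {x. a \<bullet> x = c}"
  shows "hausdorff_outer (real DIM('a) - 1) A < \<infinity>"
proof -
  let ?n = "DIM('a) - 1"
  obtain b where b: "b \<in> Basis" "a \<bullet> b \<noteq> 0"
    using assms(2) by (metis euclidean_all_zero_iff)
  let ?B = "Basis - {b}"
  have finB: "finite ?B" and cardB: "card ?B = ?n" using b by (auto simp: card_Diff_singleton)
  obtain R where R: "R > 0" "\<And>x. x \<in> A \<Longrightarrow> norm x \<le> R"
    using assms(1) by (metis bounded_pos)
  have coord: "\<bar>x \<bullet> b'\<bar> \<le> R" if "x \<in> A" "b' \<in> Basis" for x b'
    using R(2)[OF that(1)] Basis_le_norm[OF that(2), of x] by linarith
  define Q where "Q b' = \<bar>a \<bullet> b'\<bar> / \<bar>a \<bullet> b\<bar>" for b'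
  \<comment> \<open>Distances are bounded by the sum of the coordinate differences. Every
    \<open>b'\<close> in \<open>?B\<close> contributes at most \<open>d\<close> itself and
    \<open>Q b' * d\<close> through the coordinate \<open>b\<close>, which the equation of the
    hyperplane determines. The extra 1 keeps \<open>L\<close> positive in dimension one, where
    \<open>?B\<close> is empty.\<close>
  define L where "L = 1 + (\<Sum>b'\<in>?B. 1 + Q b')"
  have L: "L > 0" unfolding L_def Q_def by (intro add_pos_nonneg sum_nonneg) auto
  have graph: "dist x y \<le> L * d"
    if xy: "x \<in> A" "y \<in> A" and d: "\<And>b'. b' \<in> ?B \<Longrightarrow> \<bar>(x - y) \<bullet> b'\<bar> \<le> d" and "0 \<le> d" for x y d
  proof -
    have "a \<bullet> (x - y) = 0" using xy assms(3) by (auto simp: inner_diff_right)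
    then have "(\<Sum>b'\<in>Basis. (a \<bullet> b') * ((x - y) \<bullet> b')) = 0"
      by (subst (asm) euclidean_inner) 
    then have "(a \<bullet> b) * ((x - y) \<bullet> b) = - (\<Sum>b'\<in>?B. (a \<bullet> b') * ((x - y) \<bullet> b'))"
      using b by (simp add: sum.remove[of Basis b])
    then have "(x - y) \<bullet> b = - (\<Sum>b'\<in>?B. (a \<bullet> b') * ((x - y) \<bullet> b')) / (a \<bullet> b)"
      using b by (simp add: field_simps)
    also have "\<bar>\<dots>\<bar> = \<bar>\<Sum>b'\<in>?B. (a \<bullet> b') * ((x - y) \<bullet> b')\<bar> / \<bar>a \<bullet> b\<bar>"
      by (simp add: abs_divide)
    also have "\<dots> \<le> (\<Sum>b'\<in>?B. \<bar>a \<bullet> b'\<bar> * d) / \<bar>a \<bullet> b\<bar>"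
    proof (rule divide_right_mono)
      have "\<bar>\<Sum>b'\<in>?B. (a \<bullet> b') * ((x - y) \<bullet> b')\<bar> \<le> (\<Sum>b'\<in>?B. \<bar>(a \<bullet> b') * ((x - y) \<bullet> b')\<bar>)"
        by (rule sum_abs)
      also have "\<dots> \<le> (\<Sum>b'\<in>?B. \<bar>a \<bullet> b'\<bar> * d)"
        unfolding abs_mult using d by (intro sum_mono mult_left_mono) auto
      finally show "\<bar>\<Sum>b'\<in>?B. (a \<bullet> b') * ((x - y) \<bullet> b')\<bar> \<le> (\<Sum>b'\<in>?B. \<bar>a \<bullet> b'\<bar> * d)" .
    qed simp
    finally have xb: "\<bar>(x - y) \<bullet> b\<bar> \<le> (\<Sum>b'\<in>?B. Q b' * d)"
      by (simp add: sum_divide_distrib Q_def)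
    have "dist x y \<le> (\<Sum>b'\<in>Basis. \<bar>(x - y) \<bullet> b'\<bar>)"
      unfolding dist_norm by (rule norm_le_l1)
    also have "\<dots> = \<bar>(x - y) \<bullet> b\<bar> + (\<Sum>b'\<in>?B. \<bar>(x - y) \<bullet> b'\<bar>)"
      using b by (simp add: sum.remove[of Basis b])
    also have "\<dots> \<le> (\<Sum>b'\<in>?B. Q b' * d) + (\<Sum>b'\<in>?B. d)"
      using xb d by (intro add_mono sum_mono) auto
    also have "\<dots> = (L - 1) * d"
      by (simp add: L_def sum.distrib sum_distrib_left algebra_simps)
    also have "\<dots> \<le> L * d" using \<open>0 \<le> d\<close> by (simp add: algebra_simps)
    finally show ?thesis .
  qed
  \<comment> \<open>The bound does not depend on \<open>\<delta>\<close>: there are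
    \<open>m ^ ?n\<close> cubes of side \<open>2 * R / m\<close>, so the powers of \<open>m\<close>
    cancel.\<close>
  define K where "K = unit_ball_vol (real DIM('a) - 1) * (2 * L * R) ^ ?n"
  have "hausdorff_content (real DIM('a) - 1) \<delta> A \<le> ennreal K" if \<delta>: "\<delta> > 0" for \<delta>
  proof -
    obtain m :: nat where m: "real m > 2 * L * R / \<delta>" using reals_Archimedean2 by blast
    have m0: "real m > 0" using m L R \<delta> by (smt (verit) divide_pos_pos mult_pos_pos)
    define d where "d = 2 * R / real m"
    have d: "d > 0" using R m0 by (simp add: d_def)
    have Ld: "L * d \<le> \<delta>" using m m0 \<delta> by (simp add: d_def field_simps)
    define I where "I = (?B \<rightarrow>\<^sub>E {..<m})"
    define U where "U \<sigma> = {x \<in> A. \<forall>b'\<in>?B. d * real (\<sigma> b') \<le> x \<bullet> b' + R \<and> x \<bullet> b' + R \<le> d * (real (\<sigma> b') + 1)}" for \<sigma>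
    have I: "finite I" "card I = m ^ ?n"
      unfolding I_def using finB cardB by (auto intro: finite_PiE simp: card_PiE)
    have cover: "A \<subseteq> (\<Union>\<sigma>\<in>I. U \<sigma>)"
    proof
      fix x assume x: "x \<in> A"
      have "\<exists>j<m. d * real j \<le> x \<bullet> b' + R \<and> x \<bullet> b' + R \<le> d * (real j + 1)" if b': "b' \<in> ?B" for b'
      proof -
        define y where "y = x \<bullet> b' + R"
        have y: "0 \<le> y" "y \<le> 2 * R" using coord[OF x, of b'] b' by (auto simp: y_def)
        have ym: "y / d \<le> real m" using y m0 R by (simp add: d_def field_simps)
        show ?thesis
        proof (cases "y / d = real m")
          \<comment> \<open>The endpoint \<open>x \<bullet> b' = R\<close> would receive the index
            \<open>m\<close> by rounding down; it belongs to the last closed interval, with index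
            \<open>m - 1\<close>.\<close>
          case True
          then have "y = d * real m" using d by (simp add: field_simps)
          then show ?thesis using m0 d unfolding y_def[symmetric]
            by (intro exI[of _ "m - 1"]) (auto simp: of_nat_diff algebra_simps)
        next
          case False
          define j where "j = nat \<lfloor>y / d\<rfloor>"
          have j: "real j \<le> y / d" "y / d < real j + 1" using y d by (auto simp: j_def)
          then have "j < m" using False ym by linarith
          then show ?thesis using j d unfolding y_def[symmetric]
            by (intro exI[of _ j]) (auto simp: field_simps)
        qed
      qed
      then obtain \<sigma> where \<sigma>: "\<And>b'. b' \<in> ?B \<Longrightarrow> \<sigma> b' < m \<and> d * real (\<sigma> b') \<le> x \<bullet> b' + R \<and> x \<bullet> b' + R \<le> d * (real (\<sigma> b') + 1)"
        by metis
      have "restrict \<sigma> ?B \<in> I" "x \<in> U (restrict \<sigma> ?B)"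
        using \<sigma> x by (auto simp: I_def U_def)
      then show "x \<in> (\<Union>\<sigma>\<in>I. U \<sigma>)" by blast
    qed
    have bU: "bounded (U \<sigma>)" for \<sigma> using assms(1) by (rule bounded_subset) (auto simp: U_def)
    have dU: "diameter (U \<sigma>) \<le> L * d" for \<sigma>
    proof (rule diameter_le)
      show "U \<sigma> \<noteq> {} \<or> 0 \<le> L * d" using L d by simp
      fix x y assume xy: "x \<in> U \<sigma>" "y \<in> U \<sigma>"
      have "\<bar>(x - y) \<bullet> b'\<bar> \<le> d" if "b' \<in> ?B" for b'
      proof -
        have "d * real (\<sigma> b') \<le> x \<bullet> b' + R \<and> x \<bullet> b' + R \<le> d * (real (\<sigma> b') + 1)"
          "d * real (\<sigma> b') \<le> y \<bullet> b' + R \<and> y \<bullet> b' + R \<le> d * (real (\<sigma> b') + 1)"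
          using xy that unfolding U_def by blast+
        then show ?thesis unfolding inner_diff_left distrib_left by linarith
      qed
      then have "dist x y \<le> L * d" using xy d by (intro graph) (auto simp: U_def)
      then show "norm (x - y) \<le> L * d" by (simp add: dist_norm)
    qed
    have "hausdorff_content (real DIM('a) - 1) \<delta> A
        \<le> ennreal (real (card I) * (unit_ball_vol (real DIM('a) - 1) * (L * d) ^ ?n))"
    proof (rule hausdorff_content_le_finite_cover[OF I(1) cover])
      show "hausdorff_weight (real DIM('a) - 1) (U \<sigma>) \<le> unit_ball_vol (real DIM('a) - 1) * (L * d) ^ ?n" for \<sigma>
        using bU dU L d by (intro hausdorff_weight_codim1_le) auto
      show "0 \<le> real DIM('a) - 1" using DIM_positive[where 'a='a] by linarith
      show "bounded (U \<sigma>) \<and> diameter (U \<sigma>) \<le> \<delta>" for \<sigma> using bU dU Ld by (auto intro: order_trans)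
    qed (use \<delta> in simp)
    also have "real (card I) * (unit_ball_vol (real DIM('a) - 1) * (L * d) ^ ?n) = K"
    proof -
      have "real (card I) * (unit_ball_vol (real DIM('a) - 1) * (L * d) ^ ?n) =
          unit_ball_vol (real DIM('a) - 1) * (real m * (L * d)) ^ ?n"
        by (simp add: I power_mult_distrib)
      also have "real m * (L * d) = 2 * L * R" using m0 by (simp add: d_def)
      finally show ?thesis by (simp add: K_def)
    qed
    finally show ?thesis .
  qed
  then have "hausdorff_outer (real DIM('a) - 1) A \<le> ennreal K"
    unfolding hausdorff_outer_def by (intro SUP_least) auto
  then show ?thesis by (auto simp: less_top[symmetric] top_unique)
qed

section \<open>From the Hausdorff outer measure to the surface measure\<close>

lemma sets_hausdorff_measure: "sets (hausdorff_measure s) = sets borel"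
  unfolding hausdorff_measure_def
  by (metis sets.sets_measure_of_eq space_borel)

lemma space_hausdorff_measure: "space (hausdorff_measure s) = UNIV"
  unfolding hausdorff_measure_def by (simp add: space_measure_of_conv)

text \<open>A value of \<open>measure_of\<close> is either that of the given set function or 0, so
  the upper bound holds in both cases.\<close>

lemma emeasure_hausdorff_measure_le: "emeasure (hausdorff_measure s) A \<le> hausdorff_outer s A"
  unfolding hausdorff_measure_def by (simp add: emeasure_measure_of_conv)

text \<open>Subadditivity over finitely many hyperplanes leaves one bounded piece of one hyperplane
  at a time, and completion does not change the measure of the Borel set \<open>A\<close>.\<close>

lemma emeasure_surface_finite:
  fixes A :: "'a::euclidean_space set"
  assumes "bounded A" "closed A" "finite \<P>" "A \<subseteq> \<Union>\<P>"
    and "\<And>P. P \<in> \<P> \<Longrightarrow> \<exists>a c. a \<noteq> 0 \<and> P = {x. a \<bullet> x = c}"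
  shows "finite_measure (surface_on A)" "space (surface_on A) = A"
proof -
  let ?H = "hausdorff_measure (real DIM('a) - 1) :: 'a measure"
  have A: "A \<in> sets borel" using assms by simp
  show sp: "space (surface_on A) = A"
    by (simp add: surface_on_def space_restrict_space space_hausdorff_measure)
  have fin: "emeasure ?H (A \<inter> P) < \<infinity>" if "P \<in> \<P>" for P
  proof -
    obtain a c where "a \<noteq> 0" "P = {x. a \<bullet> x = c}" using assms(5)[OF \<open>P \<in> \<P>\<close>] by blast
    then have "hausdorff_outer (real DIM('a) - 1) (A \<inter> P) < \<infinity>"
      using assms(1) by (intro hausdorff_outer_hyperplane_finite[of _ a c]) auto
    then show ?thesis using emeasure_hausdorff_measure_le[of "real DIM('a) - 1" "A \<inter> P"]
      by (rule order_le_less_trans[rotated])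
  qed
  have sP: "A \<inter> P \<in> sets ?H" if "P \<in> \<P>" for P
    using assms(5)[OF that] A by (auto simp: sets_hausdorff_measure intro!: borel_closed closed_Int closed_hyperplane assms(2))
  have "emeasure ?H A = emeasure ?H (\<Union>P\<in>\<P>. A \<inter> P)"
    using assms(4) by (intro arg_cong[where f = "emeasure ?H"]) auto
  also have "\<dots> \<le> (\<Sum>P\<in>\<P>. emeasure ?H (A \<inter> P))"
    using sP by (intro emeasure_subadditive_finite assms) auto
  also have "\<dots> < \<infinity>" using fin assms(3) by (auto simp: ennreal_sum_less_top)
  finally have "emeasure ?H A < \<infinity>" .
  then have "emeasure (surface_on A) A < \<infinity>"
    unfolding surface_on_def using A
    by (subst emeasure_restrict_space) (auto simp: sets_hausdorff_measure space_hausdorff_measure)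
  then show "finite_measure (surface_on A)" by (intro finite_measureI) (auto simp: sp)
qed

lemma measurable_surface_on:
  "f \<in> borel_measurable borel \<Longrightarrow> f \<in> borel_measurable (surface_on A)"
  unfolding surface_on_def
  by (intro measurable_restrict_space1 measurable_completion)
    (simp add: measurable_def space_hausdorff_measure sets_hausdorff_measure)

section \<open>Polynomials\<close>

text \<open>On the line from a point of \<open>U\<close> to \<open>x\<close> the function is a
  univariate polynomial in \<open>t\<close> with a whole interval of zeros. All its coefficients
  vanish, and \<open>t = 1\<close> gives the value at \<open>x\<close>.\<close>

lemma real_polynomial_function_zero_on_open:
  fixes q :: "'a::euclidean_space \<Rightarrow> real"
  assumes q: "real_polynomial_function q" and U: "open U" "U \<noteq> {}" "\<And>x. x \<in> U \<Longrightarrow> q x = 0"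
  shows "q x = 0"
proof -
  obtain x0 where x0: "x0 \<in> U" using U by auto
  define g where "g = (\<lambda>t::real. x0 + t *\<^sub>R (x - x0))"
  have "polynomial_function g" unfolding g_def
    by (intro polynomial_function_add polynomial_function_const polynomial_function_mult polynomial_function_id)
  then have "real_polynomial_function (q \<circ> g)" using q by (rule real_polynomial_function_compose)
  then obtain a n where a: "q \<circ> g = (\<lambda>t. \<Sum>i\<le>n. a i * t ^ i)"
    using real_polynomial_function_iff_sum by metis
  have "open (g -` U)" unfolding g_def using U by (intro open_vimage continuous_intros) 
  moreover have "0 \<in> g -` U" using x0 by (simp add: g_def)
  ultimately obtain e where e: "e > 0" "ball 0 e \<subseteq> g -` U" by (metis open_contains_ball)
  then have "{0<..<e} \<subseteq> {t. (\<Sum>i\<le>n. a i * t ^ i) = 0}"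
    using U(3) by (auto simp: subset_iff dist_real_def simp flip: fun_cong[OF a])
  then have "infinite {t. (\<Sum>i\<le>n. a i * t ^ i) = 0}"
    using e(1) infinite_Ioo[of 0 e] infinite_super by blast
  then have "\<forall>i\<le>n. a i = 0" using polyfun_finite_roots by blast
  then have "(q \<circ> g) 1 = 0" using a by simp
  then show ?thesis by (simp add: g_def)
qed

text \<open>The points of \<open>U\<close> at which \<open>q\<close> is nonzero form an open null
  set, which must be empty. This is what makes the polynomial chosen by \<open>elem_poly\<close>
  unique.\<close>

lemma real_polynomial_function_AE_zero:
  fixes q :: "'a::euclidean_space \<Rightarrow> real"
  assumes q: "real_polynomial_function q" and U: "open U" "U \<noteq> {}" "AE x in lebesgue_on U. q x = 0"
  shows "q x = 0"
proof (rule real_polynomial_function_zero_on_open[OF q U(1,2)])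
  fix y assume y: "y \<in> U"
  have cont: "continuous_on UNIV q"
    using q continuous_real_polymonial_function continuous_at_imp_continuous_on by blast
  let ?N = "{x \<in> U. q x \<noteq> 0}"
  have "?N = U \<inter> q -` (- {0})" by auto
  then have op: "open ?N" using U(1) cont by (auto intro!: open_Int open_vimage)
  have "AE x in lebesgue. x \<in> U \<longrightarrow> q x = 0"
    using U by (subst (asm) AE_restrict_space_iff) auto
  then have "negligible ?N"
    using U(1) by (subst negligible_iff_null_sets) (auto simp: eventually_ae_filter intro: null_sets_completion_subset
        elim!: completion.complete2[rotated] )
  then have "?N = {}" using op open_not_negligible by blast
  then show "q y = 0" using y by auto
qed

section \<open>Polynomials of bounded degree and their gradients\<close>

definition monomial :: "('a::euclidean_space \<Rightarrow> nat) \<Rightarrow> 'a \<Rightarrow> real" where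
  "monomial \<alpha> x = (\<Prod>b\<in>Basis. (x \<bullet> b) ^ \<alpha> b)"

lemma poly_space_iff: "q \<in> poly_space j \<longleftrightarrow> (\<exists>c. q = (\<lambda>x. \<Sum>\<alpha>\<in>multi_indices j. c \<alpha> * monomial \<alpha> x))"
  by (simp add: poly_space_def monomial_def)

lemma finite_multi_indices: "finite (multi_indices j :: ('a::euclidean_space \<Rightarrow> nat) set)"
proof (rule finite_subset)
  show "multi_indices j \<subseteq> {\<alpha>. \<forall>b::'a. (b \<in> Basis \<longrightarrow> \<alpha> b \<in> {..j}) \<and> (b \<notin> Basis \<longrightarrow> \<alpha> b = 0)}"
  proof
    fix \<alpha> :: "'a \<Rightarrow> nat" assume \<alpha>: "\<alpha> \<in> multi_indices j"
    then have "\<alpha> b \<le> j" if "b \<in> Basis" for b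
      using member_le_sum[of b Basis \<alpha>] that by (auto simp: multi_indices_def)
    then show "\<alpha> \<in> {\<alpha>. \<forall>b::'a. (b \<in> Basis \<longrightarrow> \<alpha> b \<in> {..j}) \<and> (b \<notin> Basis \<longrightarrow> \<alpha> b = 0)}"
      using \<alpha> by (auto simp: multi_indices_def)
  qed
  show "finite {\<alpha>. \<forall>b::'a. (b \<in> Basis \<longrightarrow> \<alpha> b \<in> {..j}) \<and> (b \<notin> Basis \<longrightarrow> \<alpha> b = 0)}"
    by (rule finite_set_of_finite_funs) auto
qed

lemma real_polynomial_function_monomial: "real_polynomial_function (monomial \<alpha>)"
  unfolding monomial_def
  by (intro real_polynomial_function_prod real_polynomial_function_power
      real_polynomial_function.intros(1) bounded_linear_inner_left) auto

lemma poly_space_real_polynomial_function: "q \<in> poly_space j \<Longrightarrow> real_polynomial_function q"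
  unfolding poly_space_iff
  by (auto intro!: real_polynomial_function_sum real_polynomial_function.intros(4)
      real_polynomial_function.intros(2) real_polynomial_function_monomial finite_multi_indices)

lemma poly_space_lincomb:
  assumes "q \<in> poly_space j" "q' \<in> poly_space j"
  shows "(\<lambda>x. a * q x + b * q' x) \<in> poly_space j"
proof -
  obtain c c' where "q = (\<lambda>x. \<Sum>\<alpha>\<in>multi_indices j. c \<alpha> * monomial \<alpha> x)"
    "q' = (\<lambda>x. \<Sum>\<alpha>\<in>multi_indices j. c' \<alpha> * monomial \<alpha> x)"
    using assms by (auto simp: poly_space_iff)
  then have "(\<lambda>x. a * q x + b * q' x) = (\<lambda>x. \<Sum>\<alpha>\<in>multi_indices j. (a * c \<alpha> + b * c' \<alpha>) * monomial \<alpha> x)"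
    by (simp add: sum_distrib_left sum.distrib distrib_right mult.assoc)
  then show ?thesis unfolding poly_space_iff by (intro exI[of _ "\<lambda>\<alpha>. a * c \<alpha> + b * c' \<alpha>"])
qed

lemma poly_space_zero: "(\<lambda>x. 0) \<in> poly_space j"
  unfolding poly_space_iff by (intro exI[of _ "\<lambda>_. 0"]) simp

lemma poly_space_sum:
  assumes "\<And>i. i \<in> I \<Longrightarrow> q i \<in> poly_space j"
  shows "(\<lambda>x. \<Sum>i\<in>I. c i * q i x) \<in> poly_space j"
  using assms
proof (induction I rule: infinite_finite_induct)
  case (insert i I)
  then show ?case using poly_space_lincomb[of "q i" j "\<lambda>x. \<Sum>i\<in>I. c i * q i x" "c i" 1] by simp
qed (auto simp: poly_space_zero)

lemma monomial_in_poly_space: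
  assumes "\<alpha> \<in> multi_indices j"
  shows "monomial \<alpha> \<in> poly_space j"
  unfolding poly_space_iff
proof (intro exI ext)
  fix x
  have "(\<Sum>\<beta>\<in>multi_indices j. (if \<beta> = \<alpha> then 1 else 0) * monomial \<beta> x)
      = (\<Sum>\<beta>\<in>multi_indices j. if \<beta> = \<alpha> then monomial \<beta> x else 0)"
    by (intro sum.cong) auto
  then show "monomial \<alpha> x = (\<Sum>\<beta>\<in>multi_indices j. (if \<beta> = \<alpha> then 1 else 0) * monomial \<beta> x)"
    using assms by (simp add: finite_multi_indices)
qed

text \<open>\<open>grad\<close> is a definite description, so existence and uniqueness are both
  required. The vector representing the derivative \<open>D\<close> is \<open>adjoint D 1\<close>;
  two candidates are compared by testing with their difference.\<close>

lemma real_polynomial_function_gderiv: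
  fixes q :: "'a::euclidean_space \<Rightarrow> real"
  assumes "real_polynomial_function q"
  shows "GDERIV q x :> grad q x"
proof -
  obtain D where D: "(q has_derivative D) (at x)"
    using differentiable_at_real_polynomial_function[OF assms] by (auto simp: differentiable_def)
  then interpret D: bounded_linear D by (rule has_derivative_bounded_linear)
  have "D = (\<lambda>h. h \<bullet> adjoint D 1)"
    using adjoint_works[OF D.linear] by (auto simp: fun_eq_iff)
  then have g: "GDERIV q x :> adjoint D 1" using D by (simp add: gderiv_def)
  have "d = d'" if "GDERIV q x :> d" "GDERIV q x :> d'" for d d'
  proof -
    have "(\<lambda>h. h \<bullet> d) = (\<lambda>h. h \<bullet> d')"
      using that unfolding gderiv_def by (rule has_derivative_unique)
    then have "(d - d') \<bullet> d = (d - d') \<bullet> d'" by (rule fun_cong)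
    then have "(d - d') \<bullet> (d - d') = 0" by (simp add: inner_diff_right)
    then show ?thesis by simp
  qed
  then show ?thesis unfolding grad_def using g by (metis theI)
qed

text \<open>Reduces identities for \<open>grad\<close> to one-variable derivatives along basis
  vectors, where the usual rules and uniqueness of the derivative apply.\<close>

lemma gderiv_inner_DERIV:
  fixes q :: "'a::euclidean_space \<Rightarrow> real"
  assumes "GDERIV q x :> d"
  shows "DERIV (\<lambda>t. q (x + t *\<^sub>R b)) 0 :> d \<bullet> b"
proof -
  have "((\<lambda>t::real. x + t *\<^sub>R b) has_derivative (\<lambda>t. t *\<^sub>R b)) (at 0)"
    by (auto intro!: derivative_eq_intros)
  moreover have "(q has_derivative (\<lambda>h. h \<bullet> d)) (at (x + 0 *\<^sub>R b))"
    using assms by (simp add: gderiv_def)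
  ultimately have "((\<lambda>t. q (x + t *\<^sub>R b)) has_derivative (\<lambda>t. (t *\<^sub>R b) \<bullet> d)) (at 0)"
    by (rule has_derivative_compose)
  then show ?thesis
    by (simp add: has_field_derivative_def inner_commute mult_commute_abs)
qed

lemma grad_lincomb:
  fixes q q' :: "'a::euclidean_space \<Rightarrow> real"
  assumes "real_polynomial_function q" "real_polynomial_function q'"
  shows "grad (\<lambda>x. a * q x + b * q' x) x = a *\<^sub>R grad q x + b *\<^sub>R grad q' x"
proof (rule euclidean_eqI)
  fix e :: 'a assume "e \<in> Basis"
  have "real_polynomial_function (\<lambda>x. a * q x + b * q' x)"
    using assms by (intro real_polynomial_function.intros(2-4))
  then have "DERIV (\<lambda>t. a * q (x + t *\<^sub>R e) + b * q' (x + t *\<^sub>R e)) 0 :> grad (\<lambda>x. a * q x + b * q' x) x \<bullet> e"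
    by (intro gderiv_inner_DERIV real_polynomial_function_gderiv)
  moreover have "DERIV (\<lambda>t. a * q (x + t *\<^sub>R e) + b * q' (x + t *\<^sub>R e)) 0 :> a * (grad q x \<bullet> e) + b * (grad q' x \<bullet> e)"
    by (intro DERIV_add DERIV_cmult gderiv_inner_DERIV real_polynomial_function_gderiv assms)
  ultimately have "grad (\<lambda>x. a * q x + b * q' x) x \<bullet> e = a * (grad q x \<bullet> e) + b * (grad q' x \<bullet> e)"
    by (rule DERIV_unique)
  then show "grad (\<lambda>x. a * q x + b * q' x) x \<bullet> e = (a *\<^sub>R grad q x + b *\<^sub>R grad q' x) \<bullet> e"
    by (simp add: inner_add_left)
qed

text \<open>The product rule is trivial here because only the factor belonging to \<open>b\<close>
  varies. If \<open>\<alpha> b = 0\<close>, the truncated subtraction is harmless since the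
  coefficient is 0.\<close>

lemma grad_monomial_inner:
  assumes "b \<in> Basis"
  shows "grad (monomial \<alpha>) x \<bullet> b = real (\<alpha> b) * monomial (\<alpha>(b := \<alpha> b - 1)) x"
proof -
  have "DERIV (\<lambda>t. monomial \<alpha> (x + t *\<^sub>R b)) 0 :> grad (monomial \<alpha>) x \<bullet> b"
    by (intro gderiv_inner_DERIV real_polynomial_function_gderiv real_polynomial_function_monomial)
  moreover have "(\<lambda>t. monomial \<alpha> (x + t *\<^sub>R b)) =
      (\<lambda>t. (x \<bullet> b + t) ^ \<alpha> b * (\<Prod>b'\<in>Basis - {b}. (x \<bullet> b') ^ \<alpha> b'))"
    using assms by (auto simp: monomial_def prod.remove[of Basis b] inner_add_left inner_Basis fun_eq_iff
        intro!: prod.cong)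
  moreover have "DERIV (\<lambda>t. (x \<bullet> b + t) ^ \<alpha> b * (\<Prod>b'\<in>Basis - {b}. (x \<bullet> b') ^ \<alpha> b')) 0
      :> real (\<alpha> b) * (x \<bullet> b) ^ (\<alpha> b - 1) * (\<Prod>b'\<in>Basis - {b}. (x \<bullet> b') ^ \<alpha> b')"
    by (auto intro!: derivative_eq_intros)
  ultimately have "grad (monomial \<alpha>) x \<bullet> b =
      real (\<alpha> b) * (x \<bullet> b) ^ (\<alpha> b - 1) * (\<Prod>b'\<in>Basis - {b}. (x \<bullet> b') ^ \<alpha> b')"
    using DERIV_unique by metis
  then show ?thesis using assms
    by (simp add: monomial_def prod.remove[of Basis b])
qed

text \<open>Each monomial is either killed by the derivative or loses one degree, which is where the
  relation between \<open>l\<close> and \<open>k\<close> enters. Stated over the integers it remains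
  meaningful for \<open>k = 0\<close>.\<close>

lemma grad_poly_space_inner:
  fixes q :: "'a::euclidean_space \<Rightarrow> real"
  assumes q: "q \<in> poly_space k" and b: "b \<in> Basis" and l: "int l \<ge> int k - 1"
  shows "(\<lambda>x. grad q x \<bullet> b) \<in> poly_space l"
proof -
  obtain c where c: "q = (\<lambda>x. \<Sum>\<alpha>\<in>multi_indices k. c \<alpha> * monomial \<alpha> x)"
    using q by (auto simp: poly_space_iff)
  have "grad q x \<bullet> b = (\<Sum>\<alpha>\<in>multi_indices k. c \<alpha> * (grad (monomial \<alpha>) x \<bullet> b))" for x
  proof -
    have "DERIV (\<lambda>t. q (x + t *\<^sub>R b)) 0 :> grad q x \<bullet> b"
      by (intro gderiv_inner_DERIV real_polynomial_function_gderiv poly_space_real_polynomial_function[OF q])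
    moreover have "DERIV (\<lambda>t. q (x + t *\<^sub>R b)) 0 :> (\<Sum>\<alpha>\<in>multi_indices k. c \<alpha> * (grad (monomial \<alpha>) x \<bullet> b))"
      unfolding c by (intro DERIV_sum DERIV_cmult gderiv_inner_DERIV real_polynomial_function_gderiv
        real_polynomial_function_monomial)
    ultimately show ?thesis by (rule DERIV_unique)
  qed
  moreover have "(\<lambda>x. grad (monomial \<alpha>) x \<bullet> b) \<in> poly_space l" if \<alpha>: "\<alpha> \<in> multi_indices k" for \<alpha>
  proof (cases "\<alpha> b = 0")
    case True
    then show ?thesis using b by (simp add: grad_monomial_inner poly_space_zero)
  next
    case False
    have "(\<Sum>b'\<in>Basis. (\<alpha>(b := \<alpha> b - 1)) b') + 1 = (\<Sum>b'\<in>Basis. \<alpha> b')"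
      using b False by (simp add: sum.remove[of Basis b])
    then have "\<alpha>(b := \<alpha> b - 1) \<in> multi_indices l"
      using \<alpha> b l by (auto simp: multi_indices_def)
    then have "monomial (\<alpha>(b := \<alpha> b - 1)) \<in> poly_space l" by (rule monomial_in_poly_space)
    from poly_space_lincomb[OF this this, of "real (\<alpha> b)" 0] show ?thesis
      using b by (simp add: grad_monomial_inner)
  qed
  ultimately show ?thesis by (simp add: poly_space_sum)
qed

section \<open>Geometry of polyhedral domains and meshes\<close>

text \<open>A single notion with two uses: such a set is Lebesgue negligible, and a closed bounded
  one has finite surface measure.\<close>

definition in_hyperplanes :: "'a::euclidean_space set \<Rightarrow> bool" where
  "in_hyperplanes S \<longleftrightarrow> (\<exists>\<P>. finite \<P> \<and> S \<subseteq> \<Union>\<P> \<and> (\<forall>P\<in>\<P>. \<exists>a c. a \<noteq> 0 \<and> P = {x. a \<bullet> x = c}))"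

lemma in_hyperplanes_hyperplane: "a \<noteq> 0 \<Longrightarrow> S \<subseteq> {x. a \<bullet> x = c} \<Longrightarrow> in_hyperplanes S"
  unfolding in_hyperplanes_def by (intro exI[of _ "{{x. a \<bullet> x = c}}"]) auto

lemma in_hyperplanes_Union:
  assumes "finite \<S>" "\<And>S. S \<in> \<S> \<Longrightarrow> in_hyperplanes S"
  shows "in_hyperplanes (\<Union>\<S>)"
proof -
  have "\<forall>S\<in>\<S>. \<exists>\<P>. finite \<P> \<and> S \<subseteq> \<Union>\<P> \<and> (\<forall>P\<in>\<P>. \<exists>a c. a \<noteq> 0 \<and> P = {x. a \<bullet> x = c})"
    using assms(2) by (simp add: in_hyperplanes_def)
  then obtain Q where Q: "\<And>S. S \<in> \<S> \<Longrightarrow> finite (Q S) \<and> S \<subseteq> \<Union>(Q S) \<and> (\<forall>P\<in>Q S. \<exists>a c. a \<noteq> 0 \<and> P = {x. a \<bullet> x = c})"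
    by metis
  show ?thesis unfolding in_hyperplanes_def
  proof (intro exI[of _ "\<Union>S\<in>\<S>. Q S"] conjI)
    show "finite (\<Union>S\<in>\<S>. Q S)" using Q assms(1) by auto
    show "\<Union>\<S> \<subseteq> \<Union>(\<Union>S\<in>\<S>. Q S)"
    proof (rule Union_least)
      fix S assume S: "S \<in> \<S>"
      then have "S \<subseteq> \<Union>(Q S)" using Q by simp
      then show "S \<subseteq> \<Union>(\<Union>S\<in>\<S>. Q S)" using S by blast
    qed
    show "\<forall>P\<in>\<Union>S\<in>\<S>. Q S. \<exists>a c. a \<noteq> 0 \<and> P = {x. a \<bullet> x = c}"
    proof
      fix P assume "P \<in> (\<Union>S\<in>\<S>. Q S)"
      then obtain S where "S \<in> \<S>" "P \<in> Q S" by blast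
      then show "\<exists>a c. a \<noteq> 0 \<and> P = {x. a \<bullet> x = c}" using Q by simp
    qed
  qed
qed

lemma in_hyperplanes_subset: "in_hyperplanes S \<Longrightarrow> S' \<subseteq> S \<Longrightarrow> in_hyperplanes S'"
  unfolding in_hyperplanes_def by (meson subset_trans)

lemma in_hyperplanes_convex_empty_interior:
  assumes "convex S" "interior S = {}"
  shows "in_hyperplanes S"
proof -
  obtain a b where "a \<noteq> 0" "S \<subseteq> {x. a \<bullet> x = b}"
    using empty_interior_subset_hyperplane[OF assms] by metis
  then show ?thesis by (rule in_hyperplanes_hyperplane)
qed

text \<open>A polytope without interior points lies in one hyperplane. Otherwise its frontier is the
  union of its finitely many facets, each convex and of smaller affine dimension.\<close>

lemma in_hyperplanes_frontier_polytope:
  fixes C :: "'a::euclidean_space set"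
  assumes "polytope C"
  shows "in_hyperplanes (frontier C)"
proof (cases "interior C = {}")
  case True
  then have "in_hyperplanes C"
    using assms by (intro in_hyperplanes_convex_empty_interior polytope_imp_convex)
  then show ?thesis using assms polytope_imp_closed frontier_subset_closed in_hyperplanes_subset by blast
next
  case False
  have ph: "polyhedron C" using assms by (rule polytope_imp_polyhedron)
  have "frontier C = rel_frontier C" using False by (simp add: rel_frontier_nonempty_interior)
  also have "\<dots> = \<Union>{F. F facet_of C}" by (rule rel_frontier_of_polyhedron[OF ph])
  finally have "frontier C = \<Union>{F. F facet_of C}" .
  moreover have "in_hyperplanes F" if F: "F facet_of C" for F
  proof (rule in_hyperplanes_convex_empty_interior)
    show "convex F" using F face_of_imp_convex by (auto simp: facet_of_def)
    have "aff_dim F < aff_dim C" using F by (simp add: facet_of_def)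
    also have "\<dots> \<le> int DIM('a)" by (rule aff_dim_le_DIM)
    finally show "interior F = {}" using aff_dim_nonempty_interior by force
  qed
  ultimately show ?thesis using finite_polyhedron_facets[OF ph] by (auto intro: in_hyperplanes_Union)
qed

lemma in_hyperplanes_frontier_polyhedral:
  assumes "polyhedral S"
  shows "in_hyperplanes (frontier S)"
proof -
  obtain P where P: "finite P" "\<And>C. C \<in> P \<Longrightarrow> polytope C" "S = \<Union>P"
    using assms by (auto simp: polyhedral_def)
  have "in_hyperplanes (\<Union>(frontier ` P))"
    using P by (intro in_hyperplanes_Union) (auto intro: in_hyperplanes_frontier_polytope)
  then show ?thesis using frontier_Union_subset[OF P(1)] P(3) in_hyperplanes_subset by blast
qed

lemma negligible_in_hyperplanes: "in_hyperplanes S \<Longrightarrow> negligible S"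
proof -
  assume "in_hyperplanes S"
  then obtain \<P> where P: "finite \<P>" "S \<subseteq> \<Union>\<P>" "\<And>P. P \<in> \<P> \<Longrightarrow> \<exists>a c. a \<noteq> 0 \<and> P = {x. a \<bullet> x = c}"
    by (auto simp: in_hyperplanes_def)
  have "negligible P" if "P \<in> \<P>" for P using P(3)[OF that] by (auto intro: negligible_hyperplane)
  then have "negligible (\<Union>\<P>)" using P(1) by (intro negligible_Union)
  then show ?thesis using P(2) negligible_subset by blast
qed

lemma compact_polyhedral: "polyhedral S \<Longrightarrow> compact S"
  unfolding polyhedral_def using compact_Union polytope_imp_compact by blast

lemma polyhedral_affine_image:
  assumes "polyhedral K" "linear A"
  shows "polyhedral ((\<lambda>x. A x + b) ` K)"
proof -
  obtain P where P: "finite P" "\<And>C. C \<in> P \<Longrightarrow> polytope C" "K = \<Union>P"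
    using assms by (auto simp: polyhedral_def)
  have "polytope ((\<lambda>x. A x + b) ` C)" if "C \<in> P" for C
  proof -
    have "polytope ((+) b ` (A ` C))"
      unfolding polytope_translation_eq by (intro polytope_linear_image assms P that)
    then show ?thesis by (simp add: image_image add.commute)
  qed
  then show ?thesis using P unfolding polyhedral_def
    by (intro exI[of _ "(\<lambda>C. (\<lambda>x. A x + b) ` C) ` P"]) auto
qed

lemma interior_affine_image_nonempty:
  fixes A :: "'a::euclidean_space \<Rightarrow> 'a"
  assumes "interior K \<noteq> {}" "linear A" "bij A"
  shows "interior ((\<lambda>x. A x + b) ` K) \<noteq> {}"
proof -
  have "(\<lambda>x. A x + b) ` K = (+) b ` (A ` K)" by (simp add: image_image add.commute)
  then show ?thesis using assms
    by (simp add: interior_translation interior_bijective_linear_image)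
qed

text \<open>Polyhedrality is assumed of \<open>closure \<Omega>\<close> and so controls only the
  frontier of the closure, which could be smaller than that of \<open>\<Omega>\<close>, for instance
  if a slit were removed. The Lipschitz graph excludes this: arbitrarily close to a boundary point,
  below the graph, there are points outside the closure.\<close>

lemma frontier_lipschitz_boundary_subset:
  fixes \<Omega> :: "'a::euclidean_space set"
  assumes "open \<Omega>" "lipschitz_boundary \<Omega>"
  shows "frontier \<Omega> \<subseteq> frontier (closure \<Omega>)"
proof
  fix x assume x: "x \<in> frontier \<Omega>"
  obtain U \<nu> L \<gamma> where U: "open U" "x \<in> U" and \<nu>: "norm \<nu> = 1"
    and \<gamma>: "L-lipschitz_on {y. \<nu> \<bullet> y = 0} \<gamma>"
    and eq: "\<Omega> \<inter> U = {y \<in> U. \<gamma> (y - (\<nu> \<bullet> y) *\<^sub>R \<nu>) < \<nu> \<bullet> y}"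
    using assms(2) x unfolding lipschitz_boundary_def by meson
  have \<nu>\<nu>: "\<nu> \<bullet> \<nu> = 1" using \<nu> by (simp add: dot_square_norm)
  have xcl: "x \<in> closure \<Omega>" "x \<notin> \<Omega>"
    using x assms(1) by (auto simp: frontier_def interior_open)
  have le: "\<nu> \<bullet> x \<le> \<gamma> (x - (\<nu> \<bullet> x) *\<^sub>R \<nu>)" using xcl U eq by fastforce
  have cont: "continuous_on UNIV (\<lambda>y. \<gamma> (y - (\<nu> \<bullet> y) *\<^sub>R \<nu>))"
  proof (rule continuous_on_compose2[OF lipschitz_on_continuous_on[OF \<gamma>]])
    show "continuous_on UNIV (\<lambda>y. y - (\<nu> \<bullet> y) *\<^sub>R \<nu>)" by (intro continuous_intros)
    show "range (\<lambda>y. y - (\<nu> \<bullet> y) *\<^sub>R \<nu>) \<subseteq> {y. \<nu> \<bullet> y = 0}"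
      using \<nu>\<nu> by (auto simp: inner_diff_right)
  qed
  have outside: "y \<notin> closure \<Omega>" if y: "y \<in> U" "\<nu> \<bullet> y < \<gamma> (y - (\<nu> \<bullet> y) *\<^sub>R \<nu>)" for y
  proof -
    let ?W = "U \<inter> {y. \<nu> \<bullet> y < \<gamma> (y - (\<nu> \<bullet> y) *\<^sub>R \<nu>)}"
    have "open ?W" using U by (intro open_Int open_Collect_less cont continuous_intros)
    moreover have "?W \<inter> \<Omega> = {}"
    proof -
      have False if z: "z \<in> ?W" "z \<in> \<Omega>" for z
      proof -
        have "z \<in> {y \<in> U. \<gamma> (y - (\<nu> \<bullet> y) *\<^sub>R \<nu>) < \<nu> \<bullet> y}" using z unfolding eq[symmetric] by simp
        then show False using z by simp
      qed
      then show ?thesis by blast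
    qed
    ultimately have "?W \<inter> closure \<Omega> = {}" by (simp add: open_Int_closure_eq_empty)
    then show ?thesis using y by blast
  qed
  have "x \<notin> interior (closure \<Omega>)"
  proof
    assume "x \<in> interior (closure \<Omega>)"
    then have "open (interior (closure \<Omega>) \<inter> U)" "x \<in> interior (closure \<Omega>) \<inter> U" using U by auto
    then obtain e where e: "e > 0" "ball x e \<subseteq> interior (closure \<Omega>) \<inter> U" by (meson open_contains_ball)
    \<comment> \<open>Moving against \<open>\<nu>\<close> lowers the height but keeps the projection
      to the hyperplane orthogonal to \<open>\<nu>\<close>, hence also the value of
      \<open>\<gamma>\<close>.\<close>
    define y where "y = x - (e / 2) *\<^sub>R \<nu>"
    have "y \<in> ball x e" using e \<nu> by (simp add: y_def dist_norm)
    then have y: "y \<in> U" "y \<in> closure \<Omega>" using e interior_subset by blast+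
    have "\<nu> \<bullet> y = \<nu> \<bullet> x - e / 2" using \<nu>\<nu> by (simp add: y_def inner_diff_right)
    moreover then have "y - (\<nu> \<bullet> y) *\<^sub>R \<nu> = x - (\<nu> \<bullet> x) *\<^sub>R \<nu>" by (simp add: y_def algebra_simps)
    ultimately have "\<nu> \<bullet> y < \<gamma> (y - (\<nu> \<bullet> y) *\<^sub>R \<nu>)" using le e by simp
    then show False using outside y by blast
  qed
  then show "x \<in> frontier (closure \<Omega>)" using xcl by (simp add: frontier_def)
qed

section \<open>Outward normals: uniqueness and measurability\<close>

text \<open>Near \<open>x\<close> both normals cut out the same part of a ball. By scaling, the two
  half-spaces agree as cones, and a half-space determines its unit normal.\<close>

lemma outward_normal_unique:
  assumes "is_outward_normal \<kappa> x \<nu>" "is_outward_normal \<kappa> x \<nu>'"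
  shows "\<nu> = \<nu>'"
proof -
  obtain r r' where r: "r > 0" "\<kappa> \<inter> ball x r = {y \<in> ball x r. \<nu> \<bullet> (y - x) \<le> 0}"
    "r' > 0" "\<kappa> \<inter> ball x r' = {y \<in> ball x r'. \<nu>' \<bullet> (y - x) \<le> 0}" and n: "norm \<nu> = 1" "norm \<nu>' = 1"
    using assms by (auto simp: is_outward_normal_def)
  have nn: "\<nu> \<bullet> \<nu> = 1" "\<nu>' \<bullet> \<nu>' = 1" using n by (simp_all add: dot_square_norm)
  have iff: "\<nu> \<bullet> z \<le> 0 \<longleftrightarrow> \<nu>' \<bullet> z \<le> 0" for z
  proof -
    \<comment> \<open>Scales \<open>z\<close> so that it fits into both balls; the added 1 keeps the
      denominator positive for \<open>z = 0\<close>.\<close>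
    define t where "t = min r r' / (2 * (norm z + 1))"
    have t: "t > 0" using r by (simp add: t_def add_nonneg_pos)
    have "t * norm z < min r r'"
    proof -
      have "t * norm z \<le> t * (norm z + 1)" using t by simp
      also have "\<dots> = min r r' / 2" by (simp add: t_def field_simps add_nonneg_eq_0_iff)
      also have "\<dots> < min r r'" using r(1,3) by (simp add: min_def)
      finally show ?thesis .
    qed
    then have "x + t *\<^sub>R z \<in> ball x r" "x + t *\<^sub>R z \<in> ball x r'" using t by (auto simp: dist_norm)
    then have "\<nu> \<bullet> (x + t *\<^sub>R z - x) \<le> 0 \<longleftrightarrow> \<nu>' \<bullet> (x + t *\<^sub>R z - x) \<le> 0" using r by blast
    then show ?thesis using t by (simp add: mult_le_0_iff)
  qed
  \<comment> \<open>The vector \<open>\<nu> - c *\<^sub>R \<nu>'\<close> is orthogonal to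
    \<open>\<nu>'\<close> and hence lies in both half-spaces, which yields
    \<open>1 \<le> c * c\<close>. Testing with \<open>\<nu>'\<close> gives the sign of
    \<open>c\<close>, and then the squared distance \<open>2 - 2 * c\<close> cannot be
    positive.\<close>
  define c where "c = \<nu> \<bullet> \<nu>'"
  have "\<nu>' \<bullet> (\<nu> - c *\<^sub>R \<nu>') \<le> 0" using nn by (simp add: inner_diff_right c_def inner_commute)
  then have "\<nu> \<bullet> (\<nu> - c *\<^sub>R \<nu>') \<le> 0" using iff by blast
  then have c1: "1 \<le> c * c" using nn by (simp add: inner_diff_right c_def)
  have "\<not> \<nu>' \<bullet> \<nu>' \<le> 0" using nn by simp
  then have "c > 0" using iff[of \<nu>'] by (simp add: c_def)
  then have "1 \<le> c" using c1 power2_le_imp_le[of 1 c] by (simp add: power2_eq_square)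
  have "(\<nu> - \<nu>') \<bullet> (\<nu> - \<nu>') = 2 - 2 * c"
    using nn by (simp add: inner_diff_left inner_diff_right c_def inner_commute)
  then have "(\<nu> - \<nu>') \<bullet> (\<nu> - \<nu>') = 0" using \<open>1 \<le> c\<close> inner_ge_zero[of "\<nu> - \<nu>'"] by linarith
  then show ?thesis by simp
qed

lemma outward_normal_eq: "is_outward_normal \<kappa> x \<nu> \<Longrightarrow> outward_normal \<kappa> x = \<nu>"
  unfolding outward_normal_def using outward_normal_unique by (metis the_equality)

lemma norm_outward_normal_le: "norm (outward_normal \<kappa> x) \<le> 1"
proof (cases "\<exists>\<nu>. is_outward_normal \<kappa> x \<nu>")
  case True
  then obtain \<nu> where \<nu>: "is_outward_normal \<kappa> x \<nu>" by auto
  then have "norm \<nu> = 1" by (simp add: is_outward_normal_def)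
  then show ?thesis using outward_normal_eq[OF \<nu>] by simp
qed (simp add: outward_normal_def)

text \<open>If \<open>\<kappa>\<close> is a half-space with normal \<open>\<nu>\<close> in a ball around \<open>x\<close>, then inside that ball an outward
  normal exists exactly on the bounding hyperplane, and it is \<open>\<nu>\<close> there.\<close>

lemma is_outward_normal_near:
  fixes \<kappa> :: "'a::euclidean_space set"
  assumes "norm \<nu> = 1" "\<kappa> \<inter> ball x r = {y \<in> ball x r. \<nu> \<bullet> (y - x) \<le> 0}" "y \<in> ball x r"
  shows "is_outward_normal \<kappa> y \<nu>' \<longleftrightarrow> \<nu> \<bullet> (y - x) = 0 \<and> \<nu>' = \<nu>"
proof -
  have \<nu>\<nu>: "\<nu> \<bullet> \<nu> = 1" using assms(1) by (simp add: dot_square_norm)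
  obtain e where e: "e > 0" "ball y e \<subseteq> ball x r"
    using assms(3) open_ball open_contains_ball by meson
  have on: "is_outward_normal \<kappa> y \<nu>" if "\<nu> \<bullet> (y - x) = 0"
  proof -
    have "\<nu> \<bullet> (z - y) = \<nu> \<bullet> (z - x)" for z using that by (simp add: inner_diff_right)
    moreover have "z \<in> \<kappa> \<longleftrightarrow> \<nu> \<bullet> (z - x) \<le> 0" if "z \<in> ball y e" for z using assms(2) e(2) that by blast
    ultimately have "\<kappa> \<inter> ball y e = {z \<in> ball y e. \<nu> \<bullet> (z - y) \<le> 0}" by auto
    then show ?thesis using assms(1) e(1) by (auto simp: is_outward_normal_def)
  qed
  moreover have "\<nu> \<bullet> (y - x) = 0" if n: "is_outward_normal \<kappa> y \<nu>'"
  proof (rule ccontr)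
    assume ne: "\<nu> \<bullet> (y - x) \<noteq> 0"
    obtain s where s: "s > 0" "\<kappa> \<inter> ball y s = {z \<in> ball y s. \<nu>' \<bullet> (z - y) \<le> 0}" and n1: "norm \<nu>' = 1"
      using n by (auto simp: is_outward_normal_def)
    have n2: "\<nu>' \<bullet> \<nu>' = 1" using n1 by (simp add: dot_square_norm)
    have "y \<in> \<kappa>" using s by (metis (no_types, lifting) IntD1 centre_in_ball diff_self inner_zero_right mem_Collect_eq order_refl)
    then have "y \<in> {y \<in> ball x r. \<nu> \<bullet> (y - x) \<le> 0}" using assms(3) unfolding assms(2)[symmetric] by simp
    then have "\<nu> \<bullet> (y - x) < 0" using ne by simp
    \<comment> \<open>A point of \<open>\<kappa>\<close> off the bounding hyperplane is an interior
      point of \<open>\<kappa>\<close>. A small step along \<open>\<nu>'\<close> therefore stays in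
      \<open>\<kappa>\<close>, although it leaves the half-space belonging to
      \<open>\<nu>'\<close>.\<close>
    define W where "W = ball x r \<inter> {z. \<nu> \<bullet> (z - x) < 0} \<inter> ball y s"
    have "open W" unfolding W_def by (intro open_Int open_ball open_Collect_less continuous_intros)
    moreover have "y \<in> W" using \<open>\<nu> \<bullet> (y - x) < 0\<close> assms(3) s by (auto simp: W_def)
    ultimately obtain d where d: "d > 0" "ball y d \<subseteq> W" by (meson open_contains_ball)
    define z where "z = y + (d / 2) *\<^sub>R \<nu>'"
    have "z \<in> ball y d" using d n1 by (simp add: z_def dist_norm)
    then have z: "z \<in> ball x r" "\<nu> \<bullet> (z - x) < 0" "z \<in> ball y s" using d by (auto simp: W_def)
    then have "z \<in> {y \<in> ball x r. \<nu> \<bullet> (y - x) \<le> 0}" by simp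
    then have "z \<in> \<kappa>" unfolding assms(2)[symmetric] by simp
    then have "z \<in> {z \<in> ball y s. \<nu>' \<bullet> (z - y) \<le> 0}" using z unfolding s(2)[symmetric] by simp
    then have "\<nu>' \<bullet> (z - y) \<le> 0" by simp
    then show False using d n2 by (simp add: z_def)
  qed
  ultimately show ?thesis using outward_normal_unique by metis
qed

text \<open>Around each point of the set \<open>D\<close> where a normal exists there is a ball in
  which \<open>D\<close> is a piece of a hyperplane and the normal is constant. Hence
  \<open>D\<close> is a difference of two open sets, the normal is continuous on \<open>D\<close>,
  and it is 0 elsewhere by definition.\<close>

lemma borel_measurable_outward_normal:
  fixes \<kappa> :: "'a::euclidean_space set"
  shows "outward_normal \<kappa> \<in> borel_measurable borel"
proof -
  define D where "D = {x. \<exists>\<nu>. is_outward_normal \<kappa> x \<nu>}"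
  define HS where "HS x \<nu> r \<longleftrightarrow> r > 0 \<and> norm \<nu> = 1 \<and>
      \<kappa> \<inter> ball x r = {y \<in> ball x r. \<nu> \<bullet> (y - x) \<le> 0}" for x \<nu> r
  have "\<forall>x\<in>D. \<exists>\<nu> r. HS x \<nu> r"
    by (auto simp: D_def is_outward_normal_def HS_def)
  then obtain \<nu> r where HS: "\<And>x. x \<in> D \<Longrightarrow> HS x (\<nu> x) (r x)" by metis
  note \<nu>r = HS[unfolded HS_def]
  have near: "is_outward_normal \<kappa> y \<nu>' \<longleftrightarrow> \<nu> x \<bullet> (y - x) = 0 \<and> \<nu>' = \<nu> x"
    if "x \<in> D" "y \<in> ball x (r x)" for x y \<nu>'
    using \<nu>r[OF that(1)] that(2) by (intro is_outward_normal_near) auto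
  have eq\<nu>: "outward_normal \<kappa> y = \<nu> x" if "x \<in> D" "y \<in> ball x (r x)" "y \<in> D" for x y
  proof -
    from that(3) obtain \<nu>' where \<nu>': "is_outward_normal \<kappa> y \<nu>'" unfolding D_def by blast
    then have "\<nu>' = \<nu> x" unfolding near[OF that(1,2)] by simp
    then show ?thesis using outward_normal_eq[OF \<nu>'] by simp
  qed
  define W where "W = (\<Union>x\<in>D. ball x (r x))"
  have opW: "open W" unfolding W_def by auto
  have DW: "D \<subseteq> W" using \<nu>r by (auto simp: W_def)
  have "open (W - D)"
  proof -
    have "W - D = (\<Union>x\<in>D. ball x (r x) \<inter> {y. \<nu> x \<bullet> (y - x) \<noteq> 0})"
    proof -
      have "y \<in> D \<longleftrightarrow> \<nu> x \<bullet> (y - x) = 0" if "x \<in> D" "y \<in> ball x (r x)" for x y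
        unfolding D_def mem_Collect_eq near[OF that] by simp
      then show ?thesis by (auto simp: W_def)
    qed
    moreover have "open (ball x (r x) \<inter> {y. \<nu> x \<bullet> (y - x) \<noteq> 0})" for x
      by (intro open_Int open_ball open_Collect_neq continuous_intros)
    ultimately show ?thesis by auto
  qed
  moreover have "D = W - (W - D)" using DW by auto
  ultimately have Dm: "D \<in> sets borel" using opW by (metis borel_open sets.Diff)
  have "continuous_on D (outward_normal \<kappa>)"
  proof (rule continuous_on_eq_continuous_within[THEN iffD2], rule ballI)
    fix x assume x: "x \<in> D"
    have "\<forall>\<^sub>F y in at x within D. outward_normal \<kappa> y = \<nu> x"
    proof -
      have "outward_normal \<kappa> y = \<nu> x" if "y \<in> D" "y \<in> ball x (r x)" for y
        using eq\<nu>[OF x] that by blast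
      then show ?thesis using \<nu>r[OF x]
        by (auto simp: eventually_at dist_commute intro!: exI[of _ "r x"])
    qed
    moreover have "outward_normal \<kappa> x = \<nu> x"
      using eq\<nu>[OF x _ x] \<nu>r[OF x] by simp
    ultimately show "continuous (at x within D) (outward_normal \<kappa>)"
      unfolding continuous_within by (simp add: tendsto_eventually)
  qed
  then have "(\<lambda>x. if x \<in> D then outward_normal \<kappa> x else 0) \<in> borel_measurable borel"
    using Dm by (intro borel_measurable_continuous_on_if) auto
  moreover have "(\<lambda>x. if x \<in> D then outward_normal \<kappa> x else 0) = outward_normal \<kappa>"
    by (auto simp: D_def outward_normal_def)
  ultimately show ?thesis by simp
qed

text \<open>The modulus tends to 0 as the points approach each other, since the logarithm tends to
  infinity. Continuity supplies the measurability of the exponent for both the volume and the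
  surface measure.\<close>

lemma log_hoelder_imp_continuous_on:
  assumes "log_hoelder_on S p"
  shows "continuous_on S p"
proof -
  obtain C where C: "\<And>x y. x \<in> S \<Longrightarrow> y \<in> S \<Longrightarrow> \<bar>p x - p y\<bar> \<le> C / ln (exp 1 + 1 / norm (x - y))"
    using assms unfolding log_hoelder_on_def by blast
  show ?thesis unfolding continuous_on_def
  proof
    fix x assume x: "x \<in> S"
    show "(p \<longlongrightarrow> p x) (at x within S)"
    proof (rule LIM_zero_cancel, rule Lim_null_comparison)
      show "\<forall>\<^sub>F y in at x within S. norm (p y - p x) \<le> C / ln (exp 1 + 1 / norm (y - x))"
        using C x by (auto simp: eventually_at_filter)
      have "filterlim (\<lambda>y. norm (y - x)) (at_right 0) (at x within S)"
        unfolding filterlim_at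
        by (auto simp: eventually_at_filter intro!: tendsto_norm_zero LIM_zero tendsto_ident_at)
      then have "filterlim (\<lambda>y. 1 / norm (y - x)) at_top (at x within S)"
        using filterlim_compose[OF filterlim_inverse_at_top_right] by (simp add: inverse_eq_divide)
      then have "filterlim (\<lambda>y. exp 1 + 1 / norm (y - x)) at_top (at x within S)"
        by (intro filterlim_tendsto_add_at_top[OF tendsto_const])
      then have "filterlim (\<lambda>y. ln (exp 1 + 1 / norm (y - x))) at_top (at x within S)"
        by (rule filterlim_compose[OF ln_at_top])
      then show "((\<lambda>y. C / ln (exp 1 + 1 / norm (y - x))) \<longlongrightarrow> 0) (at x within S)"
        by (intro real_tendsto_divide_at_top[OF tendsto_const])
    qed
  qed
qed

section \<open>Broken polynomials on a mesh\<close>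

text \<open>Members are square integrable for any finite measure for which Borel functions are
  measurable, so one closure calculus serves the domain, the interior faces and the boundary.
  Boundedness on the whole space is arranged by cutting off with indicators.\<close>

definition bounded_borel :: "('a::euclidean_space \<Rightarrow> 'b::euclidean_space) \<Rightarrow> bool" where
  "bounded_borel f \<longleftrightarrow> f \<in> borel_measurable borel \<and> (\<exists>K. \<forall>x. norm (f x) \<le> K)"

lemma bounded_borel_zero: "bounded_borel (\<lambda>x. 0)"
  by (auto simp: bounded_borel_def)

lemma bounded_borel_scaleR:
  assumes "bounded_borel f" "bounded_borel g"
  shows "bounded_borel (\<lambda>x. f x *\<^sub>R g x)"
proof -
  obtain K K' where "\<And>x. norm (f x) \<le> K" "\<And>x. norm (g x) \<le> K'"
    using assms by (auto simp: bounded_borel_def)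
  moreover from this(1)[of 0] have "0 \<le> K" by (rule order_trans[rotated]) simp
  ultimately have "norm (f x *\<^sub>R g x) \<le> K * K'" for x by (auto intro: mult_mono)
  then show ?thesis using assms by (auto simp: bounded_borel_def)
qed

lemma bounded_borel_add:
  assumes "bounded_borel f" "bounded_borel g"
  shows "bounded_borel (\<lambda>x. f x + g x)"
proof -
  obtain K K' where "\<And>x. norm (f x) \<le> K" "\<And>x. norm (g x) \<le> K'"
    using assms by (auto simp: bounded_borel_def)
  then have "norm (f x + g x) \<le> K + K'" for x by (meson add_mono norm_triangle_le)
  then show ?thesis using assms by (auto simp: bounded_borel_def)
qed

lemma bounded_borel_sum:
  "(\<And>i. i \<in> I \<Longrightarrow> bounded_borel (f i)) \<Longrightarrow> bounded_borel (\<lambda>x. \<Sum>i\<in>I. f i x)"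
  by (induction I rule: infinite_finite_induct) (auto intro: bounded_borel_zero bounded_borel_add)

lemma bounded_borel_const: "bounded_borel (\<lambda>x. c)"
  by (auto simp: bounded_borel_def)

lemma bounded_borel_indicator:
  assumes "S \<in> sets borel" "S \<subseteq> C" "compact C" "continuous_on UNIV q"
  shows "bounded_borel (\<lambda>x. indicator S x *\<^sub>R q x)"
proof -
  have "bounded (q ` C)"
    using assms by (intro compact_imp_bounded compact_continuous_image) (auto intro: continuous_on_subset)
  then obtain K where K: "\<And>x. x \<in> C \<Longrightarrow> norm (q x) \<le> K" by (auto simp: bounded_iff)
  have "norm (indicator S x *\<^sub>R q x) \<le> max K 0" for x
    using K assms(2) by (cases "x \<in> S") (auto intro: order_trans[OF _ max.cobounded1])
  moreover have "(\<lambda>x. indicator S x *\<^sub>R q x) \<in> borel_measurable borel"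
    using assms by (intro borel_measurable_continuous_on_indicator) (auto intro: continuous_on_subset)
  ultimately show ?thesis by (auto simp: bounded_borel_def)
qed

lemma bounded_borel_in_L2:
  fixes f :: "'a::euclidean_space \<Rightarrow> 'b::euclidean_space"
  assumes "finite_measure M" "\<And>g :: 'a \<Rightarrow> 'b. g \<in> borel_measurable borel \<Longrightarrow> g \<in> borel_measurable M" "bounded_borel f"
  shows "f \<in> L2 M"
proof -
  obtain K where "\<And>x. norm (f x) \<le> K" using assms(3) by (auto simp: bounded_borel_def)
  moreover have "f \<in> borel_measurable M" using assms(2,3) unfolding bounded_borel_def by blast
  ultimately show ?thesis using assms(1) by (intro L2_bounded[where K = K])
qed

lemma AE_lebesgue_on_negligible:
  assumes "S \<in> sets lebesgue" "negligible N" "\<And>x. x \<in> S \<Longrightarrow> x \<notin> N \<Longrightarrow> P x"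
  shows "AE x in lebesgue_on S. P x"
proof -
  have "AE x in lebesgue. x \<in> S \<longrightarrow> P x"
    by (rule AE_I'[of N]) (use assms in \<open>auto simp: negligible_iff_null_sets\<close>)
  then show ?thesis using assms(1) by (simp add: AE_restrict_space_iff)
qed

lemma AE_lebesgue_on_subset:
  assumes "AE x in lebesgue_on S. P x" "U \<subseteq> S" "S \<in> sets lebesgue" "U \<in> sets lebesgue"
  shows "AE x in lebesgue_on U. P x"
proof -
  have "AE x in lebesgue. x \<in> S \<longrightarrow> P x" using assms(1,3) by (simp add: AE_restrict_space_iff)
  then have "AE x in lebesgue. x \<in> U \<longrightarrow> P x" by eventually_elim (use assms(2) in auto)
  then show ?thesis using assms(4) by (simp add: AE_restrict_space_iff)
qed

lemma L2_cong_AE: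
  assumes "f \<in> borel_measurable M" "g \<in> L2 M" "AE x in M. f x = g x"
  shows "f \<in> L2 M"
proof -
  have [measurable]: "f \<in> borel_measurable M" "g \<in> borel_measurable M"
    using assms by (auto simp: L2_def)
  have "AE x in M. (norm (g x))\<^sup>2 = (norm (f x))\<^sup>2" using assms(3) by eventually_elim simp
  then have "integrable M (\<lambda>x. (norm (f x))\<^sup>2)"
    using L2D(2)[OF assms(2)] by (subst (asm) integrable_cong_AE) auto
  then show ?thesis using assms by (auto simp: L2_def)
qed

lemma borel_measurable_lebesgue_onI: "g \<in> borel_measurable borel \<Longrightarrow> g \<in> borel_measurable (lebesgue_on S)"
  by (intro measurable_restrict_space1 measurable_completion) auto

text \<open>\<open>L2_finite_dim\<close> uses a set of generators, whereas concrete generators come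
  as a family that may repeat; the coefficients over each fibre are added.\<close>

lemma L2_finite_dimI:
  fixes f :: "'i \<Rightarrow> 'a \<Rightarrow> 'b::euclidean_space"
  assumes S: "L2_subspace M S" and "finite I" "\<And>i. i \<in> I \<Longrightarrow> f i \<in> S"
    and span: "\<And>h. h \<in> S \<Longrightarrow> \<exists>c. AE x in M. h x = (\<Sum>i\<in>I. c i *\<^sub>R f i x)"
  shows "L2_finite_dim M S"
  unfolding L2_finite_dim_def
proof (intro conjI exI[of _ "f ` I"] ballI)
  fix h assume "h \<in> S"
  then obtain c where c: "AE x in M. h x = (\<Sum>i\<in>I. c i *\<^sub>R f i x)" using span by blast
  have "(\<Sum>i\<in>I. c i *\<^sub>R f i x) = (\<Sum>g\<in>f ` I. (\<Sum>i | i \<in> I \<and> f i = g. c i) *\<^sub>R g x)" for x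
  proof -
    have "(\<Sum>i\<in>I. c i *\<^sub>R f i x) = (\<Sum>g\<in>f ` I. \<Sum>i | i \<in> I \<and> f i = g. c i *\<^sub>R f i x)"
      by (rule sum.image_gen[OF assms(2)])
    also have "\<dots> = (\<Sum>g\<in>f ` I. (\<Sum>i | i \<in> I \<and> f i = g. c i) *\<^sub>R g x)"
      by (intro sum.cong refl) (simp add: scaleR_sum_left)
    finally show ?thesis .
  qed
  with c have "AE x in M. h x = (\<Sum>g\<in>f ` I. (\<Sum>i | i \<in> I \<and> f i = g. c i) *\<^sub>R g x)" by simp
  then show "\<exists>c. AE x in M. h x = (\<Sum>g\<in>f ` I. c g *\<^sub>R g x)"
    by (intro exI[of _ "\<lambda>g. \<Sum>i | i \<in> I \<and> f i = g. c i"])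
qed (use assms in auto)

lemma poly_space_continuous_on: "q \<in> poly_space j \<Longrightarrow> continuous_on S q"
  by (intro continuous_at_imp_continuous_on ballI continuous_real_polymonial_function)
    (rule poly_space_real_polynomial_function)

section \<open>One fixed mesh and its piecewise polynomials\<close>

locale broken_mesh =
  fixes \<Omega> :: "'a::euclidean_space set" and T :: "'a set set"
  assumes open_domain: "open \<Omega>" and bounded_domain: "bounded \<Omega>"
    and finite_mesh: "finite T" and Union_mesh: "\<Union>T = closure \<Omega>"
    and disjoint_elems: "\<And>\<kappa> \<kappa>'. \<kappa> \<in> T \<Longrightarrow> \<kappa>' \<in> T \<Longrightarrow> \<kappa> \<noteq> \<kappa>' \<Longrightarrow> interior \<kappa> \<inter> interior \<kappa>' = {}"
    and compact_elem: "\<And>\<kappa>. \<kappa> \<in> T \<Longrightarrow> compact \<kappa>"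
    and negligible_frontier_elem: "\<And>\<kappa>. \<kappa> \<in> T \<Longrightarrow> negligible (frontier \<kappa>)"
    and interior_elem_nonempty: "\<And>\<kappa>. \<kappa> \<in> T \<Longrightarrow> interior \<kappa> \<noteq> {}"
    and frontier_in_hyperplanes: "in_hyperplanes (frontier \<Omega>)"
    and faces_in_hyperplanes: "\<And>e. e \<in> faces \<Omega> T \<Longrightarrow> in_hyperplanes e"

text \<open>Elements inherit polyhedrality and interior points from the reference polyhedra through
  invertible affine maps. The affine hull of a face has codimension one and is therefore a
  hyperplane. For the frontier of \<open>\<Omega>\<close> the Lipschitz condition leads to the
  frontier of its polyhedral closure.\<close>

lemma mesh_family_broken_mesh:
  fixes \<Omega> :: "'a::euclidean_space set"
  assumes dom: "polyhedral_domain \<Omega>" and mesh: "mesh_family \<Omega> T" and h: "0 < h" "h \<le> 1"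
  shows "broken_mesh \<Omega> (T h)"
proof -
  have hh: "h \<in> {0<..1}" using h by simp
  obtain \<R> where R: "\<And>K. K \<in> \<R> \<Longrightarrow> reference_polyhedron K"
    and part: "mesh_partition \<Omega> (T h)" and im: "\<And>\<kappa>. \<kappa> \<in> T h \<Longrightarrow> \<exists>K\<in>\<R>. affine_image_of K \<kappa>"
    using mesh hh unfolding mesh_family_def by (elim conjE exE) (blast)
  have aff: "aff_dim e = int DIM('a) - 1" if "e \<in> faces \<Omega> (T h)" for e
    using mesh hh that unfolding mesh_family_def by (elim conjE exE) (blast)
  have elem: "polyhedral \<kappa> \<and> interior \<kappa> \<noteq> {}" if \<kappa>: "\<kappa> \<in> T h" for \<kappa>
  proof -
    obtain K A b where K: "K \<in> \<R>" "linear A" "bij A" "\<kappa> = (\<lambda>x. A x + b) ` K"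
      using im[OF \<kappa>] by (auto simp: affine_image_of_def)
    have "polyhedral K" "interior K \<noteq> {}" using R[OF K(1)] by (auto simp: reference_polyhedron_def)
    then show ?thesis unfolding K(4)
      using K polyhedral_affine_image interior_affine_image_nonempty by blast
  qed
  show ?thesis
  proof
    show "open \<Omega>" "bounded \<Omega>" using dom by (auto simp: polyhedral_domain_def)
    show "finite (T h)" "\<Union>(T h) = closure \<Omega>" using part by (auto simp: mesh_partition_def)
    show "interior \<kappa> \<inter> interior \<kappa>' = {}" if "\<kappa> \<in> T h" "\<kappa>' \<in> T h" "\<kappa> \<noteq> \<kappa>'" for \<kappa> \<kappa>'
      using part that unfolding mesh_partition_def by blast
    show "compact \<kappa>" if "\<kappa> \<in> T h" for \<kappa> using elem[OF that] compact_polyhedral by blast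
    show "negligible (frontier \<kappa>)" if "\<kappa> \<in> T h" for \<kappa>
      using elem[OF that] in_hyperplanes_frontier_polyhedral negligible_in_hyperplanes by blast
    show "interior \<kappa> \<noteq> {}" if "\<kappa> \<in> T h" for \<kappa> using elem[OF that] by blast
    have "in_hyperplanes (frontier (closure \<Omega>))"
      using dom in_hyperplanes_frontier_polyhedral by (auto simp: polyhedral_domain_def)
    then show "in_hyperplanes (frontier \<Omega>)"
      using frontier_lipschitz_boundary_subset[of \<Omega>] dom in_hyperplanes_subset
      by (auto simp: polyhedral_domain_def)
    show "in_hyperplanes e" if e: "e \<in> faces \<Omega> (T h)" for e
    proof -
      obtain a b where "a \<noteq> 0" "affine hull e = {x. a \<bullet> x = b}"
        using aff[OF e] aff_dim_eq_hyperplane[of e] by auto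
      then show ?thesis using hull_subset[of e affine] by (intro in_hyperplanes_hyperplane) auto
    qed
  qed
qed

context broken_mesh
begin

abbreviation "\<mu> \<equiv> lebesgue_on \<Omega>"
abbreviation "\<Gamma> \<equiv> Gamma_int \<Omega> T"

lemma sets_domain: "\<Omega> \<in> sets lebesgue"
  using open_domain by auto

lemma finite_measure_domain: "finite_measure \<mu>"
  using open_domain bounded_domain by (intro finite_measure_lebesgue_on lmeasurable_open)

lemma sets_elem: "\<kappa> \<in> T \<Longrightarrow> \<kappa> \<in> sets lebesgue"
  using compact_elem lmeasurable_compact by blast

lemma elem_subset_closure: "\<kappa> \<in> T \<Longrightarrow> \<kappa> \<subseteq> closure \<Omega>"
  using Union_mesh by auto

lemma elem_minus_interior: "\<kappa> \<in> T \<Longrightarrow> \<kappa> - interior \<kappa> = frontier \<kappa>"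
  using compact_elem[of \<kappa>] by (simp add: frontier_def compact_imp_closed)

lemma AE_elem_interior: "\<kappa> \<in> T \<Longrightarrow> AE x in lebesgue_on \<kappa>. x \<in> interior \<kappa>"
  by (rule AE_lebesgue_on_negligible[OF sets_elem negligible_frontier_elem])
    (use elem_minus_interior in auto)

lemma negligible_frontiers: "negligible (\<Union>\<kappa>\<in>T. frontier \<kappa>)"
  using finite_mesh negligible_frontier_elem by (intro negligible_Union) auto

lemma AE_some_interior: "AE x in \<mu>. \<exists>\<kappa>\<in>T. x \<in> interior \<kappa>"
proof (rule AE_lebesgue_on_negligible[OF sets_domain negligible_frontiers])
  fix x assume x: "x \<in> \<Omega>" "x \<notin> (\<Union>\<kappa>\<in>T. frontier \<kappa>)"
  then have "x \<in> \<Union>T" using Union_mesh closure_subset by blast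
  then obtain \<kappa> where "\<kappa> \<in> T" "x \<in> \<kappa>" by auto
  then show "\<exists>\<kappa>\<in>T. x \<in> interior \<kappa>" using x elem_minus_interior by blast
qed

text \<open>The indicators of interiors leave at most one nonzero summand at each point and make the
  function a bounded Borel representative of a broken polynomial; outside all interiors it is
  0.\<close>

definition piecewise :: "('a set \<Rightarrow> 'a \<Rightarrow> 'b::euclidean_space) \<Rightarrow> 'a \<Rightarrow> 'b" where
  "piecewise q x = (\<Sum>\<kappa>\<in>T. indicator (interior \<kappa>) x *\<^sub>R q \<kappa> x)"

lemma piecewise_eq:
  assumes "\<kappa> \<in> T" "x \<in> interior \<kappa>"
  shows "piecewise q x = q \<kappa> x"
proof -
  have "indicator (interior \<kappa>') x *\<^sub>R q \<kappa>' x = (if \<kappa>' = \<kappa> then q \<kappa> x else 0)" if "\<kappa>' \<in> T" for \<kappa>'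
    using disjoint_elems[OF that assms(1)] assms by (auto simp: indicator_def)
  then have "piecewise q x = (\<Sum>\<kappa>'\<in>T. if \<kappa>' = \<kappa> then q \<kappa> x else 0)"
    unfolding piecewise_def by (rule sum.cong[OF refl])
  then show ?thesis using assms finite_mesh by simp
qed

lemma bounded_borel_piecewise:
  assumes "\<And>\<kappa>. \<kappa> \<in> T \<Longrightarrow> continuous_on UNIV (q \<kappa>)"
  shows "bounded_borel (piecewise q)"
  unfolding piecewise_def
  by (intro bounded_borel_sum bounded_borel_indicator[OF _ interior_subset compact_elem] assms) auto

lemma domain_bounded_borel_L2: "bounded_borel f \<Longrightarrow> f \<in> L2 \<mu>"
  using finite_measure_domain borel_measurable_lebesgue_onI by (rule bounded_borel_in_L2)

lemma domain_bounded_borel_integrable: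
  assumes "bounded_borel f"
  shows "integrable \<mu> f"
proof -
  obtain K where "\<And>x. norm (f x) \<le> K" using assms by (auto simp: bounded_borel_def)
  moreover have "f \<in> borel_measurable \<mu>"
    using assms by (intro borel_measurable_lebesgue_onI) (simp add: bounded_borel_def)
  ultimately show ?thesis
    by (intro finite_measure.integrable_const_bound[OF finite_measure_domain, where B = K] AE_I2)
qed

lemma piecewise_broken_poly:
  assumes "\<And>\<kappa>. \<kappa> \<in> T \<Longrightarrow> q \<kappa> \<in> poly_space j"
  shows "piecewise q \<in> broken_poly \<Omega> T j"
proof -
  have "integrable \<mu> (piecewise q)"
    by (intro domain_bounded_borel_integrable bounded_borel_piecewise poly_space_continuous_on[of _ j] assms)
  moreover have "AE x in lebesgue_on \<kappa>. piecewise q x = q \<kappa> x" if "\<kappa> \<in> T" for \<kappa>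
    using AE_elem_interior[OF that] by eventually_elim (rule piecewise_eq[OF that])
  ultimately show ?thesis using assms by (auto simp: broken_poly_def)
qed

lemma interior_elem_Int_domain:
  assumes "\<kappa> \<in> T"
  shows "interior \<kappa> \<inter> \<Omega> \<noteq> {}"
proof -
  have "interior \<kappa> \<subseteq> closure \<Omega>"
    using interior_subset elem_subset_closure[OF assms] by (rule order_trans)
  then have "interior \<kappa> \<inter> closure \<Omega> \<noteq> {}"
    using interior_elem_nonempty[OF assms] by blast
  then show ?thesis by (simp add: open_Int_closure_eq_empty)
qed

text \<open>\<open>elem_poly\<close> chooses among polynomials of any degree. A polynomial of degree
  at most \<open>j\<close> is among the candidates, and two candidates that agree almost everywhere
  on the element are equal, so the degree bound holds for the choice.\<close>

lemma elem_poly_exists: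
  assumes "u \<in> broken_poly \<Omega> T j" "\<kappa> \<in> T"
  shows "elem_poly \<kappa> u \<in> poly_space j" "AE x in lebesgue_on \<kappa>. u x = elem_poly \<kappa> u x"
proof -
  obtain q where q: "q \<in> poly_space j" "AE x in lebesgue_on \<kappa>. u x = q x"
    using assms by (auto simp: broken_poly_def)
  have "real_polynomial_function q" using q poly_space_real_polynomial_function by blast
  then have *: "real_polynomial_function (elem_poly \<kappa> u) \<and> (AE x in lebesgue_on \<kappa>. u x = elem_poly \<kappa> u x)"
    using q(2) someI_ex[of "\<lambda>q. real_polynomial_function q \<and> (AE x in lebesgue_on \<kappa>. u x = q x)"]
    unfolding elem_poly_def by blast
  then show "AE x in lebesgue_on \<kappa>. u x = elem_poly \<kappa> u x" by simp
  have "AE x in lebesgue_on \<kappa>. elem_poly \<kappa> u x - q x = 0"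
    using conjunct2[OF *] q(2) by eventually_elim simp
  then have "AE x in lebesgue_on (interior \<kappa>). elem_poly \<kappa> u x - q x = 0"
    by (rule AE_lebesgue_on_subset) (auto simp: sets_elem assms interior_subset)
  then have "elem_poly \<kappa> u x - q x = 0" for x
    using * \<open>real_polynomial_function q\<close> interior_elem_nonempty[OF assms(2)]
    by (intro real_polynomial_function_AE_zero[of "\<lambda>x. elem_poly \<kappa> u x - q x" "interior \<kappa>"])
      (auto intro!: real_polynomial_function_diff)
  then have "elem_poly \<kappa> u = q" by auto
  then show "elem_poly \<kappa> u \<in> poly_space j" using q by simp
qed

lemma elem_poly_real_polynomial:
  "u \<in> broken_poly \<Omega> T j \<Longrightarrow> \<kappa> \<in> T \<Longrightarrow> real_polynomial_function (elem_poly \<kappa> u)"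
  by (rule poly_space_real_polynomial_function[OF elem_poly_exists(1)])

lemma AE_eq_piecewise:
  assumes "u \<in> broken_poly \<Omega> T j"
  shows "AE x in \<mu>. u x = piecewise (\<lambda>\<kappa>. elem_poly \<kappa> u) x"
proof -
  have "AE x in lebesgue. x \<in> \<kappa> \<longrightarrow> u x = elem_poly \<kappa> u x" if "\<kappa> \<in> T" for \<kappa>
    using elem_poly_exists(2)[OF assms that] sets_elem[OF that] by (simp add: AE_restrict_space_iff)
  then have "AE x in lebesgue. \<forall>\<kappa>\<in>T. x \<in> \<kappa> \<longrightarrow> u x = elem_poly \<kappa> u x"
    using finite_mesh by (subst AE_ball_countable) (auto intro: countable_finite)
  then have "AE x in \<mu>. \<forall>\<kappa>\<in>T. x \<in> \<kappa> \<longrightarrow> u x = elem_poly \<kappa> u x"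
    using sets_domain by (subst AE_restrict_space_iff) auto
  with AE_some_interior show ?thesis
  proof eventually_elim
    case (elim x)
    then obtain \<kappa> where \<kappa>: "\<kappa> \<in> T" "x \<in> interior \<kappa>" by auto
    then have "x \<in> \<kappa>" using interior_subset by blast
    then have "u x = elem_poly \<kappa> u x" using elim \<kappa> by blast
    then show ?case using piecewise_eq[OF \<kappa>, of "\<lambda>\<kappa>. elem_poly \<kappa> u"] by simp
  qed
qed

text \<open>Uniqueness turns an identity almost everywhere in \<open>\<Omega>\<close> into one that
  holds everywhere, in particular on faces, where the hypothesis by itself says nothing.\<close>

lemma elem_poly_lincomb:
  assumes f: "f \<in> broken_poly \<Omega> T j" and g: "g \<in> broken_poly \<Omega> T j" and h: "h \<in> broken_poly \<Omega> T j"
    and ae: "AE x in \<mu>. h x = a * f x + b * g x" and \<kappa>: "\<kappa> \<in> T"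
  shows "elem_poly \<kappa> h = (\<lambda>x. a * elem_poly \<kappa> f x + b * elem_poly \<kappa> g x)"
proof
  fix x
  \<comment> \<open>The element is only known to lie in \<open>closure \<Omega>\<close>, while the
    hypothesis concerns \<open>\<Omega>\<close>; the intersection is open and nonempty.\<close>
  let ?U = "interior \<kappa> \<inter> \<Omega>"
  have U: "?U \<in> sets lebesgue" "?U \<subseteq> \<kappa>" using open_domain interior_subset by auto
  have ae\<kappa>: "AE x in lebesgue_on ?U. u x = elem_poly \<kappa> u x" if "u \<in> broken_poly \<Omega> T j" for u
    using elem_poly_exists(2)[OF that \<kappa>] by (rule AE_lebesgue_on_subset) (use U sets_elem[OF \<kappa>] in auto)
  let ?d = "\<lambda>x. elem_poly \<kappa> h x - (a * elem_poly \<kappa> f x + b * elem_poly \<kappa> g x)"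
  have "AE x in lebesgue_on ?U. h x = a * f x + b * g x"
    using ae by (rule AE_lebesgue_on_subset) (use U sets_domain in auto)
  then have "AE x in lebesgue_on ?U. ?d x = 0"
    using ae\<kappa>[OF f] ae\<kappa>[OF g] ae\<kappa>[OF h] by eventually_elim simp
  moreover have "real_polynomial_function ?d"
    by (intro real_polynomial_function_diff real_polynomial_function.intros(2-4)
        elem_poly_real_polynomial[OF f \<kappa>] elem_poly_real_polynomial[OF g \<kappa>]
        elem_poly_real_polynomial[OF h \<kappa>])
  ultimately have "?d x = 0"
    using open_domain interior_elem_Int_domain[OF \<kappa>]
    by (intro real_polynomial_function_AE_zero[of ?d ?U]) auto
  then show "elem_poly \<kappa> h x = a * elem_poly \<kappa> f x + b * elem_poly \<kappa> g x" by simp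
qed

lemma broken_poly_lincomb:
  assumes "f \<in> broken_poly \<Omega> T j" "g \<in> broken_poly \<Omega> T j"
  shows "(\<lambda>x. a * f x + b * g x) \<in> broken_poly \<Omega> T j"
proof -
  have "\<exists>q\<in>poly_space j. AE x in lebesgue_on \<kappa>. a * f x + b * g x = q x" if \<kappa>: "\<kappa> \<in> T" for \<kappa>
  proof (intro bexI)
    show "(\<lambda>x. a * elem_poly \<kappa> f x + b * elem_poly \<kappa> g x) \<in> poly_space j"
      using elem_poly_exists(1)[OF _ \<kappa>] assms by (intro poly_space_lincomb)
    show "AE x in lebesgue_on \<kappa>. a * f x + b * g x = a * elem_poly \<kappa> f x + b * elem_poly \<kappa> g x"
      using elem_poly_exists(2)[OF assms(1) \<kappa>] elem_poly_exists(2)[OF assms(2) \<kappa>]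
      by eventually_elim simp
  qed
  then show ?thesis using assms by (auto simp: broken_poly_def)
qed

text \<open>A common form of the scalar and the vector-valued space: for real values
  \<open>Basis\<close> is \<open>{1}\<close>, so subspace and dimension arguments are carried out
  once.\<close>

definition broken_space :: "nat \<Rightarrow> ('a \<Rightarrow> 'b::euclidean_space) set" where
  "broken_space j = {\<phi>. \<forall>b\<in>Basis. (\<lambda>x. \<phi> x \<bullet> b) \<in> broken_poly \<Omega> T j}"

lemma broken_space_scalar: "broken_space j = broken_poly \<Omega> T j"
  by (simp add: broken_space_def)

lemma broken_space_vec: "broken_space j = broken_poly_vec \<Omega> T j"
  by (simp add: broken_space_def broken_poly_vec_def)

lemma broken_space_AE_eq:
  fixes \<phi> :: "'a \<Rightarrow> 'b::euclidean_space"
  assumes "\<phi> \<in> broken_space j"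
  shows "AE x in \<mu>. \<phi> x = (\<Sum>b\<in>Basis. piecewise (\<lambda>\<kappa>. elem_poly \<kappa> (\<lambda>x. \<phi> x \<bullet> b)) x *\<^sub>R b)"
proof -
  have "AE x in \<mu>. \<forall>b\<in>Basis. \<phi> x \<bullet> b = piecewise (\<lambda>\<kappa>. elem_poly \<kappa> (\<lambda>x. \<phi> x \<bullet> b)) x"
    using assms by (subst AE_ball_countable) (auto simp: broken_space_def intro: AE_eq_piecewise countable_finite)
  then show ?thesis
  proof eventually_elim
    case (elim x)
    have "\<phi> x = (\<Sum>b\<in>Basis. (\<phi> x \<bullet> b) *\<^sub>R b)" by (simp add: euclidean_representation)
    also have "\<dots> = (\<Sum>b\<in>Basis. piecewise (\<lambda>\<kappa>. elem_poly \<kappa> (\<lambda>x. \<phi> x \<bullet> b)) x *\<^sub>R b)"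
      using elim by (intro sum.cong) auto
    finally show ?case .
  qed
qed

lemma broken_space_L2_subspace: "L2_subspace \<mu> (broken_space j :: ('a \<Rightarrow> 'b::euclidean_space) set)"
  unfolding L2_subspace_def
proof (intro conjI subsetI ballI allI)
  fix \<phi> :: "'a \<Rightarrow> 'b" assume \<phi>: "\<phi> \<in> broken_space j"
  show "\<phi> \<in> L2 \<mu>"
  proof (rule L2_cong_AE[OF _ _ broken_space_AE_eq[OF \<phi>]])
    show "\<phi> \<in> borel_measurable \<mu>"
      unfolding borel_measurable_euclidean_space[of \<phi>]
      using \<phi> by (auto simp: broken_space_def broken_poly_def)
    show "(\<lambda>x. \<Sum>b\<in>Basis. piecewise (\<lambda>\<kappa>. elem_poly \<kappa> (\<lambda>x. \<phi> x \<bullet> b)) x *\<^sub>R b) \<in> L2 \<mu>"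
      using \<phi> by (intro domain_bounded_borel_L2 bounded_borel_sum bounded_borel_scaleR bounded_borel_piecewise
          bounded_borel_const poly_space_continuous_on[of _ j] elem_poly_exists) (auto simp: broken_space_def)
  qed
next
  show "(\<lambda>x. 0) \<in> (broken_space j :: ('a \<Rightarrow> 'b) set)"
    by (auto simp: broken_space_def broken_poly_def intro!: bexI[OF _ poly_space_zero])
next
  fix \<phi> \<psi> :: "'a \<Rightarrow> 'b" and a b :: real assume "\<phi> \<in> broken_space j" "\<psi> \<in> broken_space j"
  then show "(\<lambda>x. a *\<^sub>R \<phi> x + b *\<^sub>R \<psi> x) \<in> broken_space j"
    by (auto simp: broken_space_def inner_add_left intro: broken_poly_lincomb)
qed

text \<open>Generated by monomials cut off to the interior of one element and multiplied by one
  basis vector of the range.\<close>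

lemma broken_space_finite_dim: "L2_finite_dim \<mu> (broken_space j :: ('a \<Rightarrow> 'b::euclidean_space) set)"
proof (rule L2_finite_dimI[OF broken_space_L2_subspace])
  let ?I = "T \<times> multi_indices j \<times> (Basis :: 'b set)"
  let ?f = "\<lambda>(\<kappa>, \<alpha>, b) x. (indicator (interior \<kappa>) x * monomial \<alpha> x) *\<^sub>R b"
  show "finite ?I" by (simp add: finite_mesh finite_multi_indices)
  show "?f i \<in> broken_space j" if i: "i \<in> ?I" for i
  proof -
    obtain \<kappa> \<alpha> b where [simp]: "i = (\<kappa>, \<alpha>, b)" and \<kappa>: "\<kappa> \<in> T" and \<alpha>: "\<alpha> \<in> multi_indices j" and b: "b \<in> Basis"
      using i by auto
    have "(\<lambda>x. indicator (interior \<kappa>) x * monomial \<alpha> x) = piecewise (\<lambda>\<kappa>'. if \<kappa>' = \<kappa> then monomial \<alpha> else (\<lambda>x. 0))"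
    proof
      fix x
      have "piecewise (\<lambda>\<kappa>'. if \<kappa>' = \<kappa> then monomial \<alpha> else (\<lambda>x. 0)) x =
          (\<Sum>\<kappa>'\<in>T. if \<kappa>' = \<kappa> then indicator (interior \<kappa>) x * monomial \<alpha> x else 0)"
        unfolding piecewise_def by (intro sum.cong) auto
      then show "indicator (interior \<kappa>) x * monomial \<alpha> x = piecewise (\<lambda>\<kappa>'. if \<kappa>' = \<kappa> then monomial \<alpha> else (\<lambda>x. 0)) x"
        using \<kappa> finite_mesh by simp
    qed
    moreover have "\<dots> \<in> broken_poly \<Omega> T j"
      using \<alpha> by (intro piecewise_broken_poly) (auto intro: monomial_in_poly_space poly_space_zero)
    ultimately have bp: "(\<lambda>x. indicator (interior \<kappa>) x * monomial \<alpha> x) \<in> broken_poly \<Omega> T j" by simp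
    have "(\<lambda>x. ?f i x \<bullet> b') \<in> broken_poly \<Omega> T j" if "b' \<in> Basis" for b'
      using broken_poly_lincomb[OF bp bp, of "b \<bullet> b'" 0] by (simp add: mult.commute mult.left_commute)
    then show ?thesis by (auto simp: broken_space_def)
  qed
  fix \<phi> :: "'a \<Rightarrow> 'b" assume \<phi>: "\<phi> \<in> broken_space j"
  have "\<exists>c. elem_poly \<kappa> (\<lambda>x. \<phi> x \<bullet> b) = (\<lambda>x. \<Sum>\<alpha>\<in>multi_indices j. c \<alpha> * monomial \<alpha> x)"
    if "\<kappa> \<in> T" "b \<in> Basis" for \<kappa> b
    using elem_poly_exists(1)[of "\<lambda>x. \<phi> x \<bullet> b" j \<kappa>] \<phi> that by (simp add: poly_space_iff broken_space_def)
  then obtain c where c: "\<And>\<kappa> b. \<kappa> \<in> T \<Longrightarrow> b \<in> Basis \<Longrightarrow>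
      elem_poly \<kappa> (\<lambda>x. \<phi> x \<bullet> b) = (\<lambda>x. \<Sum>\<alpha>\<in>multi_indices j. c \<kappa> b \<alpha> * monomial \<alpha> x)" by metis
  have "(\<Sum>b\<in>Basis. piecewise (\<lambda>\<kappa>. elem_poly \<kappa> (\<lambda>x. \<phi> x \<bullet> b)) x *\<^sub>R b) =
      (\<Sum>i\<in>?I. (\<lambda>(\<kappa>, \<alpha>, b). c \<kappa> b \<alpha>) i *\<^sub>R ?f i x)" for x
  proof -
    have "(\<Sum>i\<in>?I. (\<lambda>(\<kappa>, \<alpha>, b). c \<kappa> b \<alpha>) i *\<^sub>R ?f i x) =
      (\<Sum>\<kappa>\<in>T. \<Sum>\<alpha>\<in>multi_indices j. \<Sum>b\<in>Basis. (c \<kappa> b \<alpha> * (indicator (interior \<kappa>) x * monomial \<alpha> x)) *\<^sub>R b)"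
      by (simp add: sum.cartesian_product split_def)
    also have "\<dots> = (\<Sum>\<kappa>\<in>T. \<Sum>b\<in>Basis. \<Sum>\<alpha>\<in>multi_indices j. (c \<kappa> b \<alpha> * (indicator (interior \<kappa>) x * monomial \<alpha> x)) *\<^sub>R b)"
      by (intro sum.cong refl sum.swap)
    also have "\<dots> = (\<Sum>b\<in>Basis. \<Sum>\<kappa>\<in>T. \<Sum>\<alpha>\<in>multi_indices j. (c \<kappa> b \<alpha> * (indicator (interior \<kappa>) x * monomial \<alpha> x)) *\<^sub>R b)"
      by (rule sum.swap)
    also have "\<dots> = (\<Sum>b\<in>Basis. piecewise (\<lambda>\<kappa>. elem_poly \<kappa> (\<lambda>x. \<phi> x \<bullet> b)) x *\<^sub>R b)"
      unfolding piecewise_def using c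
      by (intro sum.cong refl) (simp add: scaleR_sum_left sum_distrib_left mult_ac)
    finally show ?thesis by simp
  qed
  then show "\<exists>c. AE x in \<mu>. \<phi> x = (\<Sum>i\<in>?I. c i *\<^sub>R ?f i x)"
    using broken_space_AE_eq[OF \<phi>] by (intro exI[of _ "\<lambda>(\<kappa>, \<alpha>, b). c \<kappa> b \<alpha>"]) simp
qed

end

section \<open>Traces, the lifting operator and the functionals\<close>

text \<open>Intended for operators built from element polynomials, which are linear at every point;
  the target measure is then arbitrary and may be a surface measure.\<close>

lemma AE_linearI:
  assumes "\<And>f g h a b x. f \<in> S \<Longrightarrow> g \<in> S \<Longrightarrow> h \<in> S \<Longrightarrow> AE x in M. h x = a *\<^sub>R f x + b *\<^sub>R g x \<Longrightarrow>
    \<Lambda> h x = a *\<^sub>R \<Lambda> f x + b *\<^sub>R \<Lambda> g x"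
  shows "AE_linear M S M' \<Lambda>"
  unfolding AE_linear_def by (intro ballI allI impI AE_I2) (rule assms)

context broken_mesh
begin

lemma elem_poly_continuous_on: "u \<in> broken_poly \<Omega> T j \<Longrightarrow> \<kappa> \<in> T \<Longrightarrow> continuous_on S (elem_poly \<kappa> u)"
  by (rule poly_space_continuous_on[OF elem_poly_exists(1)])

lemma bounded_borel_elem_poly:
  assumes "u \<in> broken_poly \<Omega> T j" "\<kappa> \<in> T"
  shows "bounded_borel (\<lambda>x. indicator \<kappa> x *\<^sub>R elem_poly \<kappa> u x)"
proof (rule bounded_borel_indicator[OF _ subset_refl])
  show "compact \<kappa>" using assms(2) by (rule compact_elem)
  then show "\<kappa> \<in> sets borel" by (simp add: compact_imp_closed)
qed (rule elem_poly_continuous_on[OF assms])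

text \<open>The index set of such a sum varies with \<open>x\<close>. Rewriting it over the fixed
  set \<open>T\<close> with indicators exposes it to the closure rules for
  \<open>bounded_borel\<close>.\<close>

lemma sum_elems_eq:
  fixes f :: "'a set \<Rightarrow> 'b::real_vector"
  shows "(\<Sum>\<kappa> | \<kappa> \<in> T \<and> x \<in> S \<kappa>. f \<kappa>) = (\<Sum>\<kappa>\<in>T. indicator (S \<kappa>) x *\<^sub>R f \<kappa>)"
proof -
  have "(\<Sum>\<kappa> | \<kappa> \<in> T \<and> x \<in> S \<kappa>. f \<kappa>) = (\<Sum>\<kappa>\<in>T. if x \<in> S \<kappa> then f \<kappa> else 0)"
    using finite_mesh by (rule sum.inter_filter)
  also have "\<dots> = (\<Sum>\<kappa>\<in>T. indicator (S \<kappa>) x *\<^sub>R f \<kappa>)"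
    by (intro sum.cong) auto
  finally show ?thesis .
qed

lemma bounded_borel_outward_normal: "bounded_borel (outward_normal \<kappa>)"
  unfolding bounded_borel_def using borel_measurable_outward_normal norm_outward_normal_le by blast

lemma bounded_borel_jump:
  assumes "u \<in> broken_poly \<Omega> T j"
  shows "bounded_borel (jump T u)"
proof -
  have "jump T u = (\<lambda>x. \<Sum>\<kappa>\<in>T. (indicator \<kappa> x *\<^sub>R elem_poly \<kappa> u x) *\<^sub>R outward_normal \<kappa> x)"
    unfolding jump_def by (subst sum_elems_eq) simp
  then show ?thesis
    by (simp only:) (intro bounded_borel_sum bounded_borel_scaleR bounded_borel_outward_normal
        bounded_borel_elem_poly[OF assms])
qed

lemma bounded_borel_boundary_trace:
  assumes "u \<in> broken_poly \<Omega> T j"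
  shows "bounded_borel (boundary_trace T u)"
proof -
  have "boundary_trace T u = (\<lambda>x. \<Sum>\<kappa>\<in>T. indicator \<kappa> x *\<^sub>R elem_poly \<kappa> u x)"
    unfolding boundary_trace_def by (subst sum_elems_eq) simp
  then show ?thesis by (simp only:) (intro bounded_borel_sum bounded_borel_elem_poly[OF assms])
qed

lemma broken_spaceD: "\<phi> \<in> broken_space j \<Longrightarrow> b \<in> Basis \<Longrightarrow> (\<lambda>x. \<phi> x \<bullet> b) \<in> broken_poly \<Omega> T j"
  by (simp add: broken_space_def)

lemma bounded_borel_average:
  assumes "\<phi> \<in> broken_space j"
  shows "bounded_borel (average T \<phi>)"
proof -
  have "average T \<phi> = (\<lambda>x. (1 / 2) *\<^sub>R (\<Sum>\<kappa>\<in>T. \<Sum>b\<in>Basis.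
      (indicator \<kappa> x *\<^sub>R elem_poly \<kappa> (\<lambda>y. \<phi> y \<bullet> b) x) *\<^sub>R b))"
    unfolding average_def elem_poly_vec_def by (subst sum_elems_eq) (simp add: scaleR_sum_right)
  then show ?thesis
    by (simp only:) (intro bounded_borel_sum bounded_borel_scaleR bounded_borel_const
        bounded_borel_elem_poly[OF broken_spaceD[OF assms]])
qed

lemma jump_lincomb:
  assumes "f \<in> broken_poly \<Omega> T j" "g \<in> broken_poly \<Omega> T j" "h \<in> broken_poly \<Omega> T j"
    and "AE x in \<mu>. h x = a * f x + b * g x"
  shows "jump T h x = a *\<^sub>R jump T f x + b *\<^sub>R jump T g x"
  unfolding jump_def
  by (simp add: elem_poly_lincomb[OF assms] scaleR_sum_right scaleR_left_distrib flip: sum.distrib)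

lemma boundary_trace_lincomb:
  assumes "f \<in> broken_poly \<Omega> T j" "g \<in> broken_poly \<Omega> T j" "h \<in> broken_poly \<Omega> T j"
    and "AE x in \<mu>. h x = a * f x + b * g x"
  shows "boundary_trace T h x = a * boundary_trace T f x + b * boundary_trace T g x"
  unfolding boundary_trace_def
  by (simp add: elem_poly_lincomb[OF assms] sum_distrib_left flip: sum.distrib)

lemma elem_poly_vec_lincomb:
  assumes "f \<in> broken_space j" "g \<in> broken_space j" "h \<in> broken_space j"
    and ae: "AE x in \<mu>. h x = a *\<^sub>R f x + b *\<^sub>R g x" and \<kappa>: "\<kappa> \<in> T"
  shows "elem_poly_vec \<kappa> h x = a *\<^sub>R elem_poly_vec \<kappa> f x + b *\<^sub>R elem_poly_vec \<kappa> g x"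
proof -
  have "elem_poly \<kappa> (\<lambda>y. h y \<bullet> e) = (\<lambda>x. a * elem_poly \<kappa> (\<lambda>y. f y \<bullet> e) x + b * elem_poly \<kappa> (\<lambda>y. g y \<bullet> e) x)"
    if e: "e \<in> Basis" for e
  proof (rule elem_poly_lincomb[OF _ _ _ _ \<kappa>])
    show "AE x in \<mu>. h x \<bullet> e = a * (f x \<bullet> e) + b * (g x \<bullet> e)"
      using ae by eventually_elim (simp add: inner_add_left)
  qed (use assms e in \<open>auto intro: broken_spaceD\<close>)
  then show ?thesis
    unfolding elem_poly_vec_def
    by (simp add: scaleR_sum_right scaleR_left_distrib flip: sum.distrib)
qed

lemma average_lincomb:
  assumes "f \<in> broken_space j" "g \<in> broken_space j" "h \<in> broken_space j"
    and "AE x in \<mu>. h x = a *\<^sub>R f x + b *\<^sub>R g x"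
  shows "average T h x = a *\<^sub>R average T f x + b *\<^sub>R average T g x"
  unfolding average_def
  by (simp add: elem_poly_vec_lincomb[OF assms] scaleR_sum_right scaleR_right_distrib mult.commute
      flip: sum.distrib)

lemma broken_grad_eq: "broken_grad T v = piecewise (\<lambda>\<kappa>. grad (elem_poly \<kappa> v))"
  unfolding broken_grad_def piecewise_def by (subst sum_elems_eq) simp

lemma broken_grad_in_broken_space:
  assumes "v \<in> broken_poly \<Omega> T k" "int l \<ge> int k - 1"
  shows "broken_grad T v \<in> broken_space l"
  unfolding broken_space_def
proof (intro CollectI ballI)
  fix b :: 'a assume b: "b \<in> Basis"
  have "(\<lambda>x. broken_grad T v x \<bullet> b) = piecewise (\<lambda>\<kappa> x. grad (elem_poly \<kappa> v) x \<bullet> b)"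
    by (simp add: broken_grad_eq piecewise_def inner_sum_left fun_eq_iff)
  moreover have "\<dots> \<in> broken_poly \<Omega> T l"
    by (intro piecewise_broken_poly grad_poly_space_inner[OF elem_poly_exists(1)[OF assms(1)] b assms(2)])
  ultimately show "(\<lambda>x. broken_grad T v x \<bullet> b) \<in> broken_poly \<Omega> T l" by simp
qed

lemma broken_grad_lincomb:
  assumes "f \<in> broken_poly \<Omega> T j" "g \<in> broken_poly \<Omega> T j" "h \<in> broken_poly \<Omega> T j"
    and "AE x in \<mu>. h x = a * f x + b * g x"
  shows "broken_grad T h x = a *\<^sub>R broken_grad T f x + b *\<^sub>R broken_grad T g x"
proof -
  have "grad (elem_poly \<kappa> h) x = a *\<^sub>R grad (elem_poly \<kappa> f) x + b *\<^sub>R grad (elem_poly \<kappa> g) x"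
    if \<kappa>: "\<kappa> \<in> T" for \<kappa>
    unfolding elem_poly_lincomb[OF assms \<kappa>]
    by (rule grad_lincomb[OF elem_poly_real_polynomial[OF assms(1) \<kappa>] elem_poly_real_polynomial[OF assms(2) \<kappa>]])
  then show ?thesis
    unfolding broken_grad_eq piecewise_def
    by (simp add: scaleR_sum_right scaleR_right_distrib mult.commute flip: sum.distrib)
qed

section \<open>Faces, the interior skeleton and square-integrable traces\<close>

lemma finite_faces: "finite (faces \<Omega> T)"
proof (rule finite_subset)
  show "faces \<Omega> T \<subseteq> (\<lambda>(\<kappa>, \<kappa>'). \<kappa> \<inter> \<kappa>') ` (T \<times> T) \<union> (\<lambda>\<kappa>. \<kappa> \<inter> frontier \<Omega>) ` T"
    unfolding faces_def by auto
qed (use finite_mesh in simp)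

lemma closed_faces: "e \<in> faces \<Omega> T \<Longrightarrow> closed e"
  unfolding faces_def using compact_elem by (auto intro!: closed_Int frontier_closed dest: compact_imp_closed)

lemma faces_subset_closure: "e \<in> faces \<Omega> T \<Longrightarrow> e \<subseteq> closure \<Omega>"
  unfolding faces_def using elem_subset_closure by blast

lemma closed_Gamma: "closed \<Gamma>"
  unfolding Gamma_int_def using finite_faces closed_faces by (intro closed_Union) auto

lemma Gamma_subset_closure: "\<Gamma> \<subseteq> closure \<Omega>"
  unfolding Gamma_int_def using faces_subset_closure by blast

lemma in_hyperplanes_Gamma: "in_hyperplanes \<Gamma>"
  unfolding Gamma_int_def
  by (rule in_hyperplanes_Union) (use finite_faces faces_in_hyperplanes in auto)

lemma frontier_subset_closure: "frontier \<Omega> \<subseteq> closure \<Omega>"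
  by (simp add: frontier_def)

lemma surface_measure_facts:
  assumes "closed A" "A \<subseteq> closure \<Omega>" "in_hyperplanes A"
  shows "finite_measure (surface_on A)" "space (surface_on A) = A"
proof -
  obtain \<P> where P: "finite \<P>" "A \<subseteq> \<Union>\<P>" "\<And>P. P \<in> \<P> \<Longrightarrow> \<exists>a c. a \<noteq> 0 \<and> P = {x. a \<bullet> x = c}"
    using assms(3) by (auto simp: in_hyperplanes_def)
  have "bounded A" using assms(2) bounded_domain bounded_closure bounded_subset by metis
  then show "finite_measure (surface_on A)" "space (surface_on A) = A"
    using emeasure_surface_finite[OF _ assms(1) P] by auto
qed

lemma surface_bounded_borel_L2:
  assumes "closed A" "A \<subseteq> closure \<Omega>" "in_hyperplanes A" "bounded_borel f"
  shows "f \<in> L2 (surface_on A)"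
  by (rule bounded_borel_in_L2[OF surface_measure_facts(1)[OF assms(1-3)] measurable_surface_on assms(4)])

lemmas Gamma_facts = closed_Gamma Gamma_subset_closure in_hyperplanes_Gamma
lemmas frontier_facts = frontier_closed[of \<Omega>] frontier_subset_closure frontier_in_hyperplanes

lemma jump_L2: "u \<in> broken_poly \<Omega> T j \<Longrightarrow> jump T u \<in> L2 (surface_on \<Gamma>)"
  by (rule surface_bounded_borel_L2[OF Gamma_facts bounded_borel_jump])

lemma average_L2: "\<phi> \<in> broken_space j \<Longrightarrow> average T \<phi> \<in> L2 (surface_on \<Gamma>)"
  by (rule surface_bounded_borel_L2[OF Gamma_facts bounded_borel_average])

lemma boundary_trace_L2: "u \<in> broken_poly \<Omega> T j \<Longrightarrow> boundary_trace T u \<in> L2 (surface_on (frontier \<Omega>))"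
  by (rule surface_bounded_borel_L2[OF frontier_facts bounded_borel_boundary_trace])

section \<open>The lifting and the operator \<open>B_op\<close>\<close>

lemma is_lifting_iff:
  "is_lifting \<Omega> T l u w \<longleftrightarrow> w \<in> broken_space l \<and> (\<forall>\<phi>\<in>broken_space l.
     L2_inner \<mu> w \<phi> = - L2_inner (surface_on \<Gamma>) (jump T u) (average T \<phi>))"
  by (simp add: is_lifting_def broken_space_vec L2_inner_def)

lemma lifting_exists:
  assumes u: "u \<in> broken_poly \<Omega> T k"
  shows "is_lifting \<Omega> T l u (lifting \<Omega> T l u)"
proof -
  have "\<exists>w\<in>broken_space l. \<forall>\<phi>\<in>broken_space l.
      L2_inner \<mu> w \<phi> = - L2_inner (surface_on \<Gamma>) (jump T u) (average T \<phi>)"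
  proof (rule riesz_L2_finite_dim[OF broken_space_finite_dim])
    fix f g h :: "'a \<Rightarrow> 'a" and a b :: real
    assume H: "f \<in> broken_space l" "g \<in> broken_space l" "h \<in> broken_space l"
      and ae: "AE x in \<mu>. h x = a *\<^sub>R f x + b *\<^sub>R g x"
    have "average T h = (\<lambda>x. a *\<^sub>R average T f x + b *\<^sub>R average T g x)"
      using average_lincomb[OF H ae] by (rule ext)
    then show "- L2_inner (surface_on \<Gamma>) (jump T u) (average T h) =
        a * - L2_inner (surface_on \<Gamma>) (jump T u) (average T f) +
        b * - L2_inner (surface_on \<Gamma>) (jump T u) (average T g)"
      by (simp add: L2_inner_lincomb_right[OF average_L2[OF H(1)] average_L2[OF H(2)] jump_L2[OF u]])
  qed
  then have "\<exists>w. is_lifting \<Omega> T l u w" unfolding is_lifting_iff by blast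
  then show ?thesis unfolding lifting_def by (rule someI_ex)
qed

lemma lifting_in_broken_space: "u \<in> broken_poly \<Omega> T k \<Longrightarrow> lifting \<Omega> T l u \<in> broken_space l"
  using lifting_exists unfolding is_lifting_iff by blast

text \<open>Each value of \<open>lifting\<close> is a chosen representative, so pointwise linearity
  cannot be expected. The defect \<open>w\<close> lies in the space and may serve as test function;
  the defining equations and linearity of the jump give it inner product 0 with itself.\<close>

lemma lifting_AE_linear: "AE_linear \<mu> (broken_space k) \<mu> (lifting \<Omega> T l)"
  unfolding AE_linear_def broken_space_scalar
proof (intro ballI allI impI)
  fix f g h :: "'a \<Rightarrow> real" and a b :: real
  assume V: "f \<in> broken_poly \<Omega> T k" "g \<in> broken_poly \<Omega> T k" "h \<in> broken_poly \<Omega> T k"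
    and "AE x in \<mu>. h x = a *\<^sub>R f x + b *\<^sub>R g x"
  then have ae: "AE x in \<mu>. h x = a * f x + b * g x" by simp
  let ?R = "lifting \<Omega> T l"
  define w where "w = (\<lambda>x. 1 *\<^sub>R ?R h x + (- 1) *\<^sub>R (a *\<^sub>R ?R f x + b *\<^sub>R ?R g x))"
  have S: "L2_subspace \<mu> (broken_space l :: ('a \<Rightarrow> 'a) set)" by (rule broken_space_L2_subspace)
  have SL: "broken_space l \<subseteq> (L2 \<mu> :: ('a \<Rightarrow> 'a) set)" using S by (rule L2_subspaceD)
  have wH: "w \<in> broken_space l"
    unfolding w_def using V by (intro L2_subspaceD(3)[OF S] lifting_in_broken_space)
  have L: "?R u \<in> L2 \<mu>" if "u \<in> broken_poly \<Omega> T k" for u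
    using lifting_in_broken_space[OF that] SL by blast
  have R: "L2_inner \<mu> (?R u) w = - L2_inner (surface_on \<Gamma>) (jump T u) (average T w)"
    if "u \<in> broken_poly \<Omega> T k" for u
    using lifting_exists[OF that, of l] wH unfolding is_lifting_iff by blast
  have jh: "jump T h = (\<lambda>x. a *\<^sub>R jump T f x + b *\<^sub>R jump T g x)"
    using jump_lincomb[OF V ae] by (rule ext)
  have wL: "w \<in> L2 \<mu>" using wH SL by blast
  have "L2_inner \<mu> w w = L2_inner \<mu> (\<lambda>x. 1 *\<^sub>R ?R h x + (- 1) *\<^sub>R (a *\<^sub>R ?R f x + b *\<^sub>R ?R g x)) w"
    by (simp only: w_def)
  also have "\<dots> = 1 * L2_inner \<mu> (?R h) w + (- 1) * (L2_inner \<mu> (\<lambda>x. a *\<^sub>R ?R f x + b *\<^sub>R ?R g x) w)"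
    by (rule L2_inner_lincomb_left) (use L V wL in \<open>auto intro: L2_lincomb\<close>)
  also have "L2_inner \<mu> (\<lambda>x. a *\<^sub>R ?R f x + b *\<^sub>R ?R g x) w = a * L2_inner \<mu> (?R f) w + b * L2_inner \<mu> (?R g) w"
    by (rule L2_inner_lincomb_left) (use L V wL in auto)
  also have "1 * L2_inner \<mu> (?R h) w + (- 1) * (a * L2_inner \<mu> (?R f) w + b * L2_inner \<mu> (?R g) w) = 0"
    unfolding R[OF V(1)] R[OF V(2)] R[OF V(3)] jh
    by (simp add: L2_inner_lincomb_left[OF jump_L2[OF V(1)] jump_L2[OF V(2)] average_L2[OF wH]])
  finally have "AE x in \<mu>. w x = 0" using L2_inner_self_eq_0[OF wL] by simp
  then show "AE x in \<mu>. ?R h x = a *\<^sub>R ?R f x + b *\<^sub>R ?R g x"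
    by eventually_elim (simp add: w_def algebra_simps)
qed

lemma broken_grad_AE_linear: "AE_linear \<mu> (broken_space k) \<mu> (broken_grad T)"
  by (rule AE_linearI, unfold broken_space_scalar real_scaleR_def) (rule broken_grad_lincomb)

lemma jump_AE_linear: "AE_linear \<mu> (broken_space k) M (jump T)"
  by (rule AE_linearI, unfold broken_space_scalar real_scaleR_def) (rule jump_lincomb)

lemma boundary_trace_AE_linear: "AE_linear \<mu> (broken_space k) M (boundary_trace T)"
  by (rule AE_linearI, unfold broken_space_scalar real_scaleR_def) (rule boundary_trace_lincomb)

lemma B_op_AE_linear: "AE_linear \<mu> (broken_space k) \<mu> (B_op \<Omega> T l)"
  unfolding AE_linear_def
proof (intro ballI allI impI)
  fix f g h :: "'a \<Rightarrow> real" and a b :: real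
  assume *: "f \<in> broken_space k" "g \<in> broken_space k" "h \<in> broken_space k"
    "AE x in \<mu>. h x = a *\<^sub>R f x + b *\<^sub>R g x"
  show "AE x in \<mu>. B_op \<Omega> T l h x = a *\<^sub>R B_op \<Omega> T l f x + b *\<^sub>R B_op \<Omega> T l g x"
    using AE_linearD[OF lifting_AE_linear *, of l] AE_linearD[OF broken_grad_AE_linear *]
    by eventually_elim (simp add: B_op_def algebra_simps)
qed

lemma B_op_in_broken_space:
  assumes "v \<in> broken_poly \<Omega> T k" "int l \<ge> int k - 1"
  shows "B_op \<Omega> T l v \<in> broken_space l"
  using L2_subspaceD(3)[OF broken_space_L2_subspace lifting_in_broken_space[OF assms(1)]
      broken_grad_in_broken_space[OF assms], of 1 1]
  by (simp add: B_op_def[abs_def])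

end

section \<open>Convexity of the functionals\<close>

text \<open>The triangle inequality and monotonicity reduce to nonnegative reals. Positive arguments
  use convexity of the power; if one argument is 0, the claim is \<open>s powr p \<le> s\<close> for
  the other weight \<open>s\<close>.\<close>

lemma norm_powr_convex:
  fixes a b :: "'a::real_normed_vector"
  assumes "1 \<le> p" "0 < t" "t < 1"
  shows "norm ((1 - t) *\<^sub>R a + t *\<^sub>R b) powr p \<le> (1 - t) * norm a powr p + t * norm b powr p"
proof -
  have conv: "((1 - t) * x + t * y) powr p \<le> (1 - t) * x powr p + t * y powr p"
    if "0 \<le> x" "0 \<le> y" for x y :: real
  proof -
    have small: "s powr p \<le> s" if "0 < s" "s < 1" for s :: real
      using powr_mono'[of 1 p s] that assms by simp
    consider "x = 0" | "y = 0" | "0 < x" "0 < y" using \<open>0 \<le> x\<close> \<open>0 \<le> y\<close> by fastforce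
    then show ?thesis
    proof cases
      case 1
      then show ?thesis using small[of t] assms \<open>0 \<le> y\<close> by (simp add: powr_mult mult_right_mono)
    next
      case 2
      then show ?thesis using small[of "1 - t"] assms \<open>0 \<le> x\<close> by (simp add: powr_mult mult_right_mono)
    next
      case 3
      then show ?thesis using convex_onD[OF powr_convex[OF assms(1)], of t x y] assms by simp
    qed
  qed
  have "norm ((1 - t) *\<^sub>R a + t *\<^sub>R b) \<le> (1 - t) * norm a + t * norm b"
    using norm_triangle_ineq[of "(1 - t) *\<^sub>R a" "t *\<^sub>R b"] assms by simp
  then have "norm ((1 - t) *\<^sub>R a + t *\<^sub>R b) powr p \<le> ((1 - t) * norm a + t * norm b) powr p"
    using assms by (intro powr_mono2) auto
  also have "\<dots> \<le> (1 - t) * norm a powr p + t * norm b powr p" by (rule conv) auto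
  finally show ?thesis .
qed

lemma convex_square_identity:
  fixes a b :: "'a::real_inner"
  shows "(norm ((1 - t) *\<^sub>R a + t *\<^sub>R b))\<^sup>2 = (1 - t) * (norm a)\<^sup>2 + t * (norm b)\<^sup>2 - t * (1 - t) * (norm (b - a))\<^sup>2"
  unfolding power2_norm_eq_inner
  by (simp add: inner_add_left inner_add_right inner_diff_left inner_diff_right inner_commute[of b a] algebra_simps)

lemma norm_square_convex:
  fixes a b :: "'a::real_inner"
  assumes "0 < t" "t < 1"
  shows "(norm ((1 - t) *\<^sub>R a + t *\<^sub>R b))\<^sup>2 \<le> (1 - t) * (norm a)\<^sup>2 + t * (norm b)\<^sup>2"
  unfolding convex_square_identity using assms by simp

lemma weighted_square_integrable:
  fixes f :: "'a \<Rightarrow> 'b::euclidean_space"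
  assumes "f \<in> L2 M" "w \<in> borel_measurable M" "\<And>x. x \<in> space M \<Longrightarrow> 0 \<le> w x \<and> w x \<le> (K::real)"
  shows "integrable M (\<lambda>x. (norm (f x))\<^sup>2 * w x)"
proof (rule Bochner_Integration.integrable_bound)
  show "integrable M (\<lambda>x. K * (norm (f x))\<^sup>2)"
    using L2D(2)[OF assms(1)] by (rule integrable_mult_right)
  have [measurable]: "f \<in> borel_measurable M" "w \<in> borel_measurable M" using assms L2D by auto
  show "(\<lambda>x. (norm (f x))\<^sup>2 * w x) \<in> borel_measurable M" by measurable
  have "norm ((norm (f x))\<^sup>2 * w x) \<le> norm (K * (norm (f x))\<^sup>2)" if "x \<in> space M" for x
  proof -
    have "0 \<le> w x" "w x \<le> K" using assms(3)[OF that] by auto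
    then show ?thesis by (simp add: abs_mult mult.commute mult_right_mono)
  qed
  then show "AE x in M. norm ((norm (f x))\<^sup>2 * w x) \<le> norm (K * (norm (f x))\<^sup>2)" by (rule AE_I2)
qed

text \<open>Pointwise convexity is integrated; the bounded weight makes all three integrals finite,
  as monotonicity of the Bochner integral requires.\<close>

lemma weighted_square_convex:
  fixes f g h :: "'a \<Rightarrow> 'b::euclidean_space"
  assumes L: "f \<in> L2 M" "g \<in> L2 M" "h \<in> L2 M"
    and w: "w \<in> borel_measurable M" "\<And>x. x \<in> space M \<Longrightarrow> 0 \<le> w x \<and> w x \<le> (K::real)"
    and t: "0 < t" "t < 1" and h: "\<And>x. h x = (1 - t) *\<^sub>R f x + t *\<^sub>R g x"
  shows "(\<integral>x. (norm (h x))\<^sup>2 * w x \<partial>M) \<le>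
    (1 - t) * (\<integral>x. (norm (f x))\<^sup>2 * w x \<partial>M) + t * (\<integral>x. (norm (g x))\<^sup>2 * w x \<partial>M)"
proof -
  note int = weighted_square_integrable[OF _ w]
  have "(\<integral>x. (norm (h x))\<^sup>2 * w x \<partial>M) \<le>
      (\<integral>x. (1 - t) * ((norm (f x))\<^sup>2 * w x) + t * ((norm (g x))\<^sup>2 * w x) \<partial>M)"
  proof (rule integral_mono)
    fix x assume x: "x \<in> space M"
    have "(norm (h x))\<^sup>2 * w x \<le> ((1 - t) * (norm (f x))\<^sup>2 + t * (norm (g x))\<^sup>2) * w x"
      unfolding h using norm_square_convex[OF t] w(2)[OF x] by (intro mult_right_mono) auto
    then show "(norm (h x))\<^sup>2 * w x \<le> (1 - t) * ((norm (f x))\<^sup>2 * w x) + t * ((norm (g x))\<^sup>2 * w x)"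
      by (simp add: algebra_simps)
  qed (use int[OF L(1)] int[OF L(2)] int[OF L(3)] in simp_all)
  also have "\<dots> = (1 - t) * (\<integral>x. (norm (f x))\<^sup>2 * w x \<partial>M) + t * (\<integral>x. (norm (g x))\<^sup>2 * w x \<partial>M)"
    using int[OF L(1)] int[OF L(2)] by simp
  finally show ?thesis .
qed

text \<open>The bound is uniform over exponents of modulus at most 1 and depends on the base alone.
  With finitely many face sizes it bounds the weight although the exponent varies from point to
  point.\<close>

lemma powr_le_exp_abs_ln:
  fixes d e :: real
  assumes "\<bar>e\<bar> \<le> 1"
  shows "d powr e \<le> exp \<bar>ln d\<bar>"
proof -
  have "e * ln d \<le> \<bar>e\<bar> * \<bar>ln d\<bar>" by (metis abs_ge_self abs_mult)
  also have "\<dots> \<le> 1 * \<bar>ln d\<bar>" using assms by (intro mult_right_mono) auto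
  finally show ?thesis by (simp add: powr_def)
qed

text \<open>The modulus equals \<open>2 * (q - 1) / q\<close>, which is at most 1 because
  \<open>q \<le> 2\<close>. At \<open>q = 1\<close> the convention for division by zero gives 0 on
  both sides.\<close>

lemma abs_conj_exponent_le:
  assumes "1 \<le> q" "q \<le> 2"
  shows "\<bar>- 2 / conj_exponent q\<bar> \<le> 1"
proof -
  have "\<bar>- 2 / conj_exponent q\<bar> = 2 * (q - 1) / q"
    using assms by (simp add: conj_exponent_def abs_mult)
  also have "\<dots> \<le> 1" using assms by (simp add: field_simps)
  finally show ?thesis .
qed

context broken_mesh
begin

text \<open>On a domain of finite measure the integrand is dominated by
  \<open>1 + (norm (f x))\<^sup>2\<close>, as \<open>p\<close> lies between 1 and 2. With
  integrability secured, the pointwise convexity of the power can be integrated.\<close>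

lemma F_fun_convex:
  assumes p: "p \<in> borel_measurable \<mu>" "\<And>x. x \<in> \<Omega> \<Longrightarrow> 1 \<le> p x \<and> p x \<le> 2"
    and q: "q \<in> L2 \<mu>" "q' \<in> L2 \<mu>" and t: "0 < t" "t < 1"
  shows "F_fun \<Omega> p (\<lambda>x. (1 - t) *\<^sub>R q x + t *\<^sub>R q' x) \<le> (1 - t) * F_fun \<Omega> p q + t * F_fun \<Omega> p q'"
proof -
  interpret finite_measure \<mu> by (rule finite_measure_domain)
  have int: "integrable \<mu> (\<lambda>x. norm (f x) powr p x)" if f: "f \<in> L2 \<mu>" for f :: "'a \<Rightarrow> 'a"
  proof (rule Bochner_Integration.integrable_bound)
    show "integrable \<mu> (\<lambda>x. 1 + (norm (f x))\<^sup>2)"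
      by (intro Bochner_Integration.integrable_add integrable_const L2D(2)[OF f])
    have [measurable]: "f \<in> borel_measurable \<mu>" using f by (rule L2D)
    note p(1)[measurable]
    show "(\<lambda>x. norm (f x) powr p x) \<in> borel_measurable \<mu>" by measurable
    have "norm (f x) powr p x \<le> 1 + (norm (f x))\<^sup>2" if x: "x \<in> \<Omega>" for x
    proof (cases "norm (f x) \<le> 1")
      case True
      then have "norm (f x) powr p x \<le> 1" using p(2)[OF x] by (intro powr_le1) auto
      then show ?thesis by (smt (verit) zero_le_power2)
    next
      case False
      then have "norm (f x) powr p x \<le> norm (f x) powr 2" using p(2)[OF x] by (intro powr_mono) auto
      then show ?thesis using False by simp
    qed
    then show "AE x in \<mu>. norm (norm (f x) powr p x) \<le> norm (1 + (norm (f x))\<^sup>2)"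
      by (intro AE_I2) simp
  qed
  have "F_fun \<Omega> p (\<lambda>x. (1 - t) *\<^sub>R q x + t *\<^sub>R q' x) \<le>
      (\<integral>x. (1 - t) * (norm (q x) powr p x) + t * (norm (q' x) powr p x) \<partial>\<mu>)"
    unfolding F_fun_def
  proof (rule integral_mono)
    show "norm ((1 - t) *\<^sub>R q x + t *\<^sub>R q' x) powr p x \<le> (1 - t) * (norm (q x) powr p x) + t * (norm (q' x) powr p x)"
      if "x \<in> space \<mu>" for x using p(2)[of x] that t by (intro norm_powr_convex) auto
  qed (intro Bochner_Integration.integrable_add integrable_mult_right int L2_lincomb q)+
  also have "\<dots> = (1 - t) * F_fun \<Omega> p q + t * F_fun \<Omega> p q'"
    unfolding F_fun_def using int[OF q(1)] int[OF q(2)] by simp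
  finally show ?thesis .
qed

definition face_weight :: "('a \<Rightarrow> real) \<Rightarrow> 'a \<Rightarrow> real" where
  "face_weight p x = face_size \<Omega> T x powr (- 2 / conj_exponent (p x))"

text \<open>The choice in \<open>face_size\<close> depends on \<open>x\<close> only through the set
  \<open>N x\<close> of faces containing it. There are finitely many such sets, and each level set
  of \<open>N\<close> is a finite intersection of closed faces and complements of faces.\<close>

lemma face_size_finite_range:
  "face_size \<Omega> T \<in> borel_measurable borel" "finite (range (face_size \<Omega> T))"
proof -
  define \<phi> where "\<phi> S = diameter (SOME e. e \<in> S)" for S :: "'a set set"
  define N where "N x = {e \<in> faces \<Omega> T. x \<in> e}" for x
  have fs: "face_size \<Omega> T x = \<phi> (N x)" for x by (simp add: face_size_def \<phi>_def N_def)
  have NP: "N x \<in> Pow (faces \<Omega> T)" for x by (auto simp: N_def)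
  have "range (face_size \<Omega> T) \<subseteq> \<phi> ` Pow (faces \<Omega> T)" using fs NP by auto
  then show "finite (range (face_size \<Omega> T))" using finite_faces by (meson finite_Pow_iff finite_imageI finite_subset)
  have "{x. N x = S} \<in> sets borel" if "S \<in> Pow (faces \<Omega> T)" for S
  proof -
    have "{x. N x = S} = (\<Inter>e\<in>faces \<Omega> T. if e \<in> S then e else - e)"
      using that by (auto simp: N_def split: if_splits)
    moreover have "(\<Inter>e\<in>faces \<Omega> T. if e \<in> S then e else - e) \<in> sets borel"
    proof (cases "faces \<Omega> T = {}")
      case False
      then show ?thesis using finite_faces closed_faces by (intro sets.finite_INT) auto
    qed simp
    ultimately show ?thesis by simp
  qed
  then have "(\<lambda>x. \<Sum>S\<in>Pow (faces \<Omega> T). indicator {x. N x = S} x * \<phi> S) \<in> borel_measurable borel"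
    by (intro borel_measurable_sum borel_measurable_times borel_measurable_indicator borel_measurable_const) auto
  moreover have "(\<Sum>S\<in>Pow (faces \<Omega> T). indicator {x. N x = S} x * \<phi> S) = face_size \<Omega> T x" for x
  proof -
    have "(\<Sum>S\<in>Pow (faces \<Omega> T). indicator {x. N x = S} x * \<phi> S) = (\<Sum>S\<in>Pow (faces \<Omega> T). if S = N x then \<phi> S else 0)"
      by (intro sum.cong) auto
    then show ?thesis using NP[of x] finite_faces fs[of x] by (simp add: finite_Pow_iff)
  qed
  ultimately show "face_size \<Omega> T \<in> borel_measurable borel" by simp
qed

lemma face_weight_bounds:
  assumes p: "continuous_on (closure \<Omega>) p" "\<And>x. x \<in> closure \<Omega> \<Longrightarrow> 1 \<le> p x \<and> p x \<le> 2"
    and A: "closed A" "A \<subseteq> closure \<Omega>" "in_hyperplanes A"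
  shows "face_weight p \<in> borel_measurable (surface_on A)"
    and "\<exists>K. \<forall>x\<in>A. 0 \<le> face_weight p x \<and> face_weight p x \<le> K"
proof -
  have sp: "space (surface_on A) = A" by (rule surface_measure_facts(2)[OF A])
  \<comment> \<open>The exponent is continuous only on \<open>closure \<Omega>\<close>; an extension
    by a constant is Borel on the whole space and agrees with it on \<open>A\<close>.\<close>
  define pb where "pb x = (if x \<in> closure \<Omega> then p x else 1)" for x
  have [measurable]: "pb \<in> borel_measurable borel"
    unfolding pb_def using p(1) by (intro borel_measurable_continuous_on_if) auto
  note face_size_finite_range(1)[measurable]
  have "(\<lambda>x. face_size \<Omega> T x powr (- 2 / conj_exponent (pb x))) \<in> borel_measurable borel"
    unfolding conj_exponent_def by measurable
  then have "(\<lambda>x. face_size \<Omega> T x powr (- 2 / conj_exponent (pb x))) \<in> borel_measurable (surface_on A)"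
    by (rule measurable_surface_on)
  moreover have "face_weight p \<in> borel_measurable (surface_on A) \<longleftrightarrow>
      (\<lambda>x. face_size \<Omega> T x powr (- 2 / conj_exponent (pb x))) \<in> borel_measurable (surface_on A)"
    by (rule measurable_cong) (use A sp in \<open>auto simp: face_weight_def pb_def\<close>)
  ultimately show "face_weight p \<in> borel_measurable (surface_on A)" by simp
  obtain K where K: "\<And>y. y \<in> (\<lambda>x. exp \<bar>ln x\<bar>) ` range (face_size \<Omega> T) \<Longrightarrow> y \<le> K"
    using bdd_above_finite[OF finite_imageI[OF face_size_finite_range(2), of "\<lambda>x. exp \<bar>ln x\<bar>"]]
    by (auto simp: bdd_above_def)
  have "face_weight p x \<le> K" if x: "x \<in> A" for x
  proof -
    have "face_weight p x \<le> exp \<bar>ln (face_size \<Omega> T x)\<bar>"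
      unfolding face_weight_def using p(2)[of x] x A by (intro powr_le_exp_abs_ln abs_conj_exponent_le) auto
    also have "\<dots> \<le> K" by (rule K) auto
    finally show ?thesis .
  qed
  then show "\<exists>K. \<forall>x\<in>A. 0 \<le> face_weight p x \<and> face_weight p x \<le> K"
    by (intro exI[of _ K]) (auto simp: face_weight_def)
qed

lemma G_fun_strongly_convex:
  assumes p: "continuous_on (closure \<Omega>) p" "\<And>x. x \<in> closure \<Omega> \<Longrightarrow> 1 \<le> p x \<and> p x \<le> 2"
    and \<xi>: "\<xi> \<in> L2 \<mu>" and g: "g \<in> L2 (surface_on (frontier \<Omega>))"
    and v: "v \<in> broken_poly \<Omega> T k" "v' \<in> broken_poly \<Omega> T k" and t: "0 < t" "t < 1"
  shows "G_fun \<Omega> T p \<xi> g (\<lambda>x. (1 - t) *\<^sub>R v x + t *\<^sub>R v' x) \<le>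
    (1 - t) * G_fun \<Omega> T p \<xi> g v + t * G_fun \<Omega> T p \<xi> g v'
      - t * (1 - t) * L2_inner \<mu> (\<lambda>x. v' x - v x) (\<lambda>x. v' x - v x)"
proof -
  let ?vt = "\<lambda>x. (1 - t) *\<^sub>R v x + t *\<^sub>R v' x"
  have vt: "?vt \<in> broken_poly \<Omega> T k" using broken_poly_lincomb[OF v] by simp
  have ae: "AE x in \<mu>. ?vt x = (1 - t) * v x + t * v' x" by simp
  have VL: "broken_poly \<Omega> T k \<subseteq> L2 \<mu>"
    using L2_subspaceD(1)[OF broken_space_L2_subspace[where 'b = real]] by (simp add: broken_space_scalar)
  have L: "(\<lambda>x. v x - \<xi> x) \<in> L2 \<mu>" "(\<lambda>x. v' x - \<xi> x) \<in> L2 \<mu>" "(\<lambda>x. ?vt x - \<xi> x) \<in> L2 \<mu>" "(\<lambda>x. v' x - v x) \<in> L2 \<mu>"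
    using v vt VL \<xi> by (auto intro!: L2_diff)
  have sq: "integrable \<mu> (\<lambda>x. \<bar>f x\<bar>\<^sup>2)" if "f \<in> L2 \<mu>" for f :: "'a \<Rightarrow> real"
    using L2D(2)[OF that] by simp
  \<comment> \<open>An exact identity, since the integrand is quadratic and \<open>\<xi>\<close>
    cancels in the difference of the two arguments. It supplies the whole subtracted square; the
    face terms are needed only as convex functions.\<close>
  have 1: "(\<integral>x. \<bar>?vt x - \<xi> x\<bar>\<^sup>2 \<partial>\<mu>) = (1 - t) * (\<integral>x. \<bar>v x - \<xi> x\<bar>\<^sup>2 \<partial>\<mu>) + t * (\<integral>x. \<bar>v' x - \<xi> x\<bar>\<^sup>2 \<partial>\<mu>)
      - t * (1 - t) * L2_inner \<mu> (\<lambda>x. v' x - v x) (\<lambda>x. v' x - v x)"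
  proof -
    have "\<bar>?vt x - \<xi> x\<bar>\<^sup>2 = (1 - t) * \<bar>v x - \<xi> x\<bar>\<^sup>2 + t * \<bar>v' x - \<xi> x\<bar>\<^sup>2 - t * (1 - t) * \<bar>v' x - v x\<bar>\<^sup>2" for x
      by (simp add: power2_eq_square algebra_simps)
    then have "(\<integral>x. \<bar>?vt x - \<xi> x\<bar>\<^sup>2 \<partial>\<mu>) =
        (\<integral>x. (1 - t) * \<bar>v x - \<xi> x\<bar>\<^sup>2 + t * \<bar>v' x - \<xi> x\<bar>\<^sup>2 - t * (1 - t) * \<bar>v' x - v x\<bar>\<^sup>2 \<partial>\<mu>)"
      by (simp only:)
    also have "\<dots> = (1 - t) * (\<integral>x. \<bar>v x - \<xi> x\<bar>\<^sup>2 \<partial>\<mu>) + t * (\<integral>x. \<bar>v' x - \<xi> x\<bar>\<^sup>2 \<partial>\<mu>)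
      - t * (1 - t) * (\<integral>x. \<bar>v' x - v x\<bar>\<^sup>2 \<partial>\<mu>)"
      using sq[OF L(1)] sq[OF L(2)] sq[OF L(4)] by (simp del: power2_abs)
    also have "(\<integral>x. \<bar>v' x - v x\<bar>\<^sup>2 \<partial>\<mu>) = L2_inner \<mu> (\<lambda>x. v' x - v x) (\<lambda>x. v' x - v x)"
      by (simp add: L2_inner_def power2_eq_square)
    finally show ?thesis .
  qed
  have 2: "(\<integral>x. (norm (jump T ?vt x))\<^sup>2 * face_weight p x \<partial>surface_on \<Gamma>) \<le>
      (1 - t) * (\<integral>x. (norm (jump T v x))\<^sup>2 * face_weight p x \<partial>surface_on \<Gamma>) +
      t * (\<integral>x. (norm (jump T v' x))\<^sup>2 * face_weight p x \<partial>surface_on \<Gamma>)"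
  proof -
    obtain K where K: "\<forall>x\<in>\<Gamma>. 0 \<le> face_weight p x \<and> face_weight p x \<le> K"
      using face_weight_bounds(2)[OF p Gamma_facts] by blast
    have "0 \<le> face_weight p x \<and> face_weight p x \<le> K" if "x \<in> space (surface_on \<Gamma>)" for x
      using that K unfolding surface_measure_facts(2)[OF Gamma_facts] by blast
    from weighted_square_convex[OF jump_L2[OF v(1)] jump_L2[OF v(2)] jump_L2[OF vt]
          face_weight_bounds(1)[OF p Gamma_facts] this t jump_lincomb[OF v vt ae]]
    show ?thesis .
  qed
  let ?b = "\<lambda>u x. boundary_trace T u x - g x"
  have 3: "(\<integral>x. (norm (?b ?vt x))\<^sup>2 * face_weight p x \<partial>surface_on (frontier \<Omega>)) \<le>
      (1 - t) * (\<integral>x. (norm (?b v x))\<^sup>2 * face_weight p x \<partial>surface_on (frontier \<Omega>)) +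
      t * (\<integral>x. (norm (?b v' x))\<^sup>2 * face_weight p x \<partial>surface_on (frontier \<Omega>))"
  proof -
    obtain K where K: "\<forall>x\<in>frontier \<Omega>. 0 \<le> face_weight p x \<and> face_weight p x \<le> K"
      using face_weight_bounds(2)[OF p frontier_facts] by blast
    have bL: "?b u \<in> L2 (surface_on (frontier \<Omega>))" if "u \<in> broken_poly \<Omega> T k" for u
      by (intro L2_diff boundary_trace_L2[OF that] g)
    have eq: "?b ?vt x = (1 - t) *\<^sub>R ?b v x + t *\<^sub>R ?b v' x" for x
      unfolding boundary_trace_lincomb[OF v vt ae] by (simp add: algebra_simps)
    have "0 \<le> face_weight p x \<and> face_weight p x \<le> K" if "x \<in> space (surface_on (frontier \<Omega>))" for x
      using that K unfolding surface_measure_facts(2)[OF frontier_facts] by blast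
    from weighted_square_convex[OF bL[OF v(1)] bL[OF v(2)] bL[OF vt]
          face_weight_bounds(1)[OF p frontier_facts] this t eq]
    show ?thesis .
  qed
  have G: "G_fun \<Omega> T p \<xi> g u = (\<integral>x. \<bar>u x - \<xi> x\<bar>\<^sup>2 \<partial>\<mu>) +
      (\<integral>x. (norm (jump T u x))\<^sup>2 * face_weight p x \<partial>surface_on \<Gamma>) +
      (\<integral>x. (norm (?b u x))\<^sup>2 * face_weight p x \<partial>surface_on (frontier \<Omega>))" for u
    by (simp add: G_fun_def face_weight_def)
  show ?thesis unfolding G using 1 2 3 unfolding distrib_left by linarith
qed

end

section \<open>Convergence of the iterates on a fixed mesh\<close>

theorem theorem1p3:
  fixes \<Omega> :: "'a::euclidean_space set"
    and T :: "real \<Rightarrow> 'a set set"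
    and p \<xi> u\<^sub>D g\<^sub>D :: "'a \<Rightarrow> real"
    and p\<^sub>1 h r \<alpha>\<^sub>0 \<alpha>\<^sub>1 :: real
    and k l :: nat
    and u :: "'a \<Rightarrow> real" and \<eta> lam :: "'a \<Rightarrow> 'a"
    and \<rho> :: "nat \<Rightarrow> real"
    and us :: "nat \<Rightarrow> 'a \<Rightarrow> real" and \<eta>s lams :: "nat \<Rightarrow> 'a \<Rightarrow> 'a"
  assumes domain: "polyhedral_domain \<Omega>"
    and exponent: "1 < p\<^sub>1" "p\<^sub>1 \<le> 2" "\<forall>x\<in>closure \<Omega>. p\<^sub>1 \<le> p x \<and> p x \<le> 2" "log_hoelder_on (closure \<Omega>) p"
    and xi: "\<xi> \<in> L2 (lebesgue_on \<Omega>)"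
    and boundary_datum: "u\<^sub>D \<in> W1p \<Omega> p" "is_trace \<Omega> u\<^sub>D g\<^sub>D" "g\<^sub>D \<in> L2 (surface_on (frontier \<Omega>))"
    and mesh: "mesh_family \<Omega> T"
    and h: "0 < h" "h \<le> 1"
    and degrees: "int l \<ge> int k - 1"
    and r: "r \<ge> 0"
    and saddle: "saddle_point (broken_poly \<Omega> (T h) k) (broken_poly_vec \<Omega> (T h) l)
        (broken_poly_vec \<Omega> (T h) l) (Lagr \<Omega> (T h) l p \<xi> g\<^sub>D r) u \<eta> lam"
    and steps: "\<forall>n. 0 < \<alpha>\<^sub>0 \<and> \<alpha>\<^sub>0 \<le> \<rho> n \<and> \<rho> n \<le> \<alpha>\<^sub>1 \<and> \<alpha>\<^sub>1 < 2 * r"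
    and iterates: "algorithm1 \<Omega> (broken_poly \<Omega> (T h) k) (broken_poly_vec \<Omega> (T h) l)
        (B_op \<Omega> (T h) l) (Lagr \<Omega> (T h) l p \<xi> g\<^sub>D r) \<rho> us \<eta>s lams"
  shows "tendsto_L2 (lebesgue_on \<Omega>) us u \<and>
    tendsto_L2 (lebesgue_on \<Omega>) \<eta>s \<eta> \<and>
    (AE x in lebesgue_on \<Omega>. \<eta> x = B_op \<Omega> (T h) l u x) \<and>
    tendsto_L2 (lebesgue_on \<Omega>) (\<lambda>n x. lams (Suc n) x - lams n x) (\<lambda>x. 0) \<and>
    (\<exists>M. \<forall>n. L2_norm_on (lebesgue_on \<Omega>) (lams n) \<le> M) \<and>
    tendsto_L2 (surface_on (Gamma_int \<Omega> (T h))) (\<lambda>n. jump (T h) (\<lambda>x. us n x - u x)) (\<lambda>x. 0) \<and>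
    tendsto_L2 (surface_on (frontier \<Omega>)) (\<lambda>n. boundary_trace (T h) (us n)) (boundary_trace (T h) u) \<and>
    tendsto_L2 (lebesgue_on \<Omega>) (\<lambda>n. lifting \<Omega> (T h) l (us n)) (lifting \<Omega> (T h) l u) \<and>
    tendsto_L2 (lebesgue_on \<Omega>) (\<lambda>n. broken_grad (T h) (us n)) (broken_grad (T h) u)"
proof -
  interpret broken_mesh \<Omega> "T h" by (rule mesh_family_broken_mesh[OF domain mesh h])
  let ?V = "broken_poly \<Omega> (T h) k" and ?H = "broken_poly_vec \<Omega> (T h) l"
  let ?B = "B_op \<Omega> (T h) l" and ?F = "F_fun \<Omega> p" and ?G = "G_fun \<Omega> (T h) p \<xi> g\<^sub>D"
  let ?i = "L2_inner (lebesgue_on \<Omega>)"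
  have Vdim: "L2_finite_dim (lebesgue_on \<Omega>) ?V"
    using broken_space_finite_dim[where 'b = real] by (simp only: broken_space_scalar)
  have V: "L2_subspace (lebesgue_on \<Omega>) ?V" and H: "L2_subspace (lebesgue_on \<Omega>) ?H"
    using broken_space_L2_subspace[where 'b = real] broken_space_L2_subspace[where 'b = 'a]
    by (simp_all only: broken_space_scalar broken_space_vec)
  have VL: "?V \<subseteq> L2 (lebesgue_on \<Omega>)" and HL: "?H \<subseteq> L2 (lebesgue_on \<Omega>)"
    using V H by (auto dest: L2_subspaceD)
  have pc: "continuous_on (closure \<Omega>) p" by (rule log_hoelder_imp_continuous_on[OF exponent(4)])
  have pb: "1 \<le> p x \<and> p x \<le> 2" if "x \<in> closure \<Omega>" for x using exponent that by force
  have pm: "p \<in> borel_measurable (lebesgue_on \<Omega>)"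
    using continuous_on_subset[OF pc closure_subset] sets_domain
    by (rule continuous_imp_measurable_on_sets_lebesgue)
  have F: "?F (\<lambda>x. (1 - t) *\<^sub>R q x + t *\<^sub>R q' x) \<le> (1 - t) * ?F q + t * ?F q'"
    if "q \<in> ?H" "q' \<in> ?H" "0 < t" "t < 1" for q q' t
    using that HL closure_subset[of \<Omega>] by (intro F_fun_convex pm pb) auto
  have G: "?G (\<lambda>x. (1 - t) *\<^sub>R v x + t *\<^sub>R v' x) \<le> (1 - t) * ?G v + t * ?G v'
      - t * (1 - t) * ?i (\<lambda>x. v' x - v x) (\<lambda>x. v' x - v x)"
    if "v \<in> ?V" "v' \<in> ?V" "0 < t" "t < 1" for v v' t
    by (rule G_fun_strongly_convex[OF pc pb xi boundary_datum(3) that])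
  have BH: "?B v \<in> ?H" if "v \<in> ?V" for v
    using B_op_in_broken_space[OF that degrees] by (simp only: broken_space_vec)
  have Blin: "AE_linear (lebesgue_on \<Omega>) ?V (lebesgue_on \<Omega>) ?B"
    using B_op_AE_linear by (simp only: broken_space_scalar)
  have Leq: "Lagr \<Omega> (T h) l p \<xi> g\<^sub>D r = (\<lambda>v q \<mu>. ?F q + ?G v + ?i \<mu> (\<lambda>x. ?B v x - q x)
      + r / 2 * ?i (\<lambda>x. ?B v x - q x) (\<lambda>x. ?B v x - q x))"
    by (intro ext) (simp add: Lagr_def L2_inner_self)
  have usV: "us n \<in> ?V" and \<eta>sH: "\<eta>s n \<in> ?H" for n
    using iterates by (auto simp: algorithm1_def)
  have lamsH: "lams n \<in> ?H" for n
    using iterates by (cases n) (auto simp: algorithm1_def)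
  have itmin: "Lagr \<Omega> (T h) l p \<xi> g\<^sub>D r (us n) (\<eta>s n) (lams n) \<le> Lagr \<Omega> (T h) l p \<xi> g\<^sub>D r v q (lams n)"
    if "v \<in> ?V" "q \<in> ?H" for n v q
    using iterates that by (auto simp: algorithm1_def)
  have itlam: "AE x in lebesgue_on \<Omega>. lams (Suc n) x = lams n x + \<rho> n *\<^sub>R (?B (us n) x - \<eta>s n x)" for n
    using iterates by (auto simp: algorithm1_def)
  have uV: "u \<in> ?V" and \<eta>H: "\<eta> \<in> ?H" using saddle by (auto simp: saddle_point_def)
  note conv = augmented_lagrangian_convergence[where F = ?F and G = ?G and B = ?B and r = r
      and M = "lebesgue_on \<Omega>" and V = ?V and H = ?H and us = us and \<eta>s = \<eta>s and lams = lams
      and \<rho> = \<rho> and u = u and \<eta> = \<eta> and lam = lam,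
      OF V H F G BH Blin saddle[unfolded Leq] steps[rule_format] usV \<eta>sH lamsH
        itmin[unfolded Leq] itlam]
  have \<eta>: "AE x in lebesgue_on \<Omega>. \<eta> x = ?B u x" by (rule conv(1))
  have du: "(\<lambda>n. ?i (\<lambda>x. us n x - u x) (\<lambda>x. us n x - u x)) \<longlonglongrightarrow> 0" by (rule conv(2))
  let ?w = "\<lambda>n x. ?B (us n) x - \<eta>s n x"
  have dw: "(\<lambda>n. ?i (?w n) (?w n)) \<longlonglongrightarrow> 0" by (rule conv(3))
  obtain K where K: "\<And>n. ?i (lams n) (lams n) \<le> K" using conv(4) by blast
  have in_L2: "us n \<in> L2 (lebesgue_on \<Omega>)" "\<eta>s n \<in> L2 (lebesgue_on \<Omega>)" "lams n \<in> L2 (lebesgue_on \<Omega>)"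
    "u \<in> L2 (lebesgue_on \<Omega>)" "\<eta> \<in> L2 (lebesgue_on \<Omega>)" "?B (us n) \<in> L2 (lebesgue_on \<Omega>)"
    "?B u \<in> L2 (lebesgue_on \<Omega>)" "?w n \<in> L2 (lebesgue_on \<Omega>)" for n
    using usV \<eta>sH lamsH uV \<eta>H BH VL HL by (auto intro!: L2_diff)
  have 1: "tendsto_L2 (lebesgue_on \<Omega>) us u" by (rule tendsto_L2I[OF _ _ du]) (use in_L2 in auto)
  have limB: "tendsto_L2 (lebesgue_on \<Omega>) (\<lambda>n. ?B (us n)) (?B u)"
    by (rule AE_linear_tendsto_L2[OF Vdim Blin _ usV uV du]) (use BH HL in auto)
  let ?dB = "\<lambda>n x. ?B (us n) x - ?B u x"
  have dB: "(\<lambda>n. ?i (?dB n) (?dB n)) \<longlonglongrightarrow> 0"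
    using tendsto_power[of _ 0 sequentially 2] limB by (force simp: tendsto_L2_def L2_inner_self)
  have 2: "tendsto_L2 (lebesgue_on \<Omega>) \<eta>s \<eta>"
  proof (rule tendsto_L2I)
    have "?i (\<lambda>x. \<eta>s n x - \<eta> x) (\<lambda>x. \<eta>s n x - \<eta> x) \<le> 2 * ?i (?dB n) (?dB n) + 2 * ?i (?w n) (?w n)" for n
    proof -
      \<comment> \<open>As \<open>\<eta>\<close> is \<open>?B u\<close> almost everywhere, the error
        in \<open>\<eta>s n\<close> is the error in \<open>?B (us n)\<close> minus the residual, and
        both tend to 0.\<close>
      let ?f = "\<lambda>x. 1 *\<^sub>R ?dB n x + (- 1) *\<^sub>R ?w n x"
      have "AE x in lebesgue_on \<Omega>. \<eta>s n x - \<eta> x = ?f x" using \<eta> by eventually_elim simp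
      then have "?i (\<lambda>x. \<eta>s n x - \<eta> x) (\<lambda>x. \<eta>s n x - \<eta> x) = ?i ?f ?f"
        by (intro L2_inner_cong_AE) (use in_L2 in \<open>auto intro!: L2_diff L2_lincomb\<close>)
      also have "\<dots> \<le> 2 * 1\<^sup>2 * ?i (?dB n) (?dB n) + 2 * (- 1)\<^sup>2 * ?i (?w n) (?w n)"
        by (rule L2_inner_lincomb_self_le) (use in_L2 in \<open>auto intro!: L2_diff\<close>)
      finally show ?thesis by simp
    qed
    moreover have "(\<lambda>n. 2 * ?i (?dB n) (?dB n) + 2 * ?i (?w n) (?w n)) \<longlonglongrightarrow> 0"
      using tendsto_add[OF tendsto_mult_left[OF dB, of 2] tendsto_mult_left[OF dw, of 2]] by simp
    ultimately show "(\<lambda>n. ?i (\<lambda>x. \<eta>s n x - \<eta> x) (\<lambda>x. \<eta>s n x - \<eta> x)) \<longlonglongrightarrow> 0"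
      by (intro Lim_null_comparison[of "\<lambda>n. ?i (\<lambda>x. \<eta>s n x - \<eta> x) (\<lambda>x. \<eta>s n x - \<eta> x)"])
        (auto simp: L2_inner_self_nonneg)
  qed (use in_L2 in auto)
  have 3: "tendsto_L2 (lebesgue_on \<Omega>) (\<lambda>n x. lams (Suc n) x - lams n x) (\<lambda>x. 0)"
  proof (rule tendsto_L2I)
    let ?d = "\<lambda>n x. lams (Suc n) x - lams n x"
    have "?i (?d n) (?d n) \<le> \<alpha>\<^sub>1\<^sup>2 * ?i (?w n) (?w n)" for n
    proof -
      \<comment> \<open>The increment of the multiplier is \<open>\<rho> n\<close> times the
        residual; the vanishing second term puts it into the shape of a linear combination.\<close>
      let ?f = "\<lambda>x. \<rho> n *\<^sub>R ?w n x + 0 *\<^sub>R ?w n x"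
      have "AE x in lebesgue_on \<Omega>. ?d n x = ?f x" using itlam[of n] by eventually_elim simp
      then have "?i (?d n) (?d n) = ?i ?f ?f"
        by (intro L2_inner_cong_AE L2_lincomb L2_diff in_L2)
      also have "\<dots> = (\<rho> n)\<^sup>2 * ?i (?w n) (?w n)"
        using L2_inner_lincomb_self[OF in_L2(8) in_L2(8), of "\<rho> n" n 0 n] by simp
      also have "\<dots> \<le> \<alpha>\<^sub>1\<^sup>2 * ?i (?w n) (?w n)"
        using steps[rule_format, of n] by (intro mult_right_mono power_mono) (auto simp: L2_inner_self_nonneg)
      finally show ?thesis .
    qed
    moreover have "(\<lambda>n. \<alpha>\<^sub>1\<^sup>2 * ?i (?w n) (?w n)) \<longlonglongrightarrow> 0" using tendsto_mult_left[OF dw] by simp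
    ultimately show "(\<lambda>n. ?i (\<lambda>x. ?d n x - 0) (\<lambda>x. ?d n x - 0)) \<longlonglongrightarrow> 0"
      by (intro Lim_null_comparison[of "\<lambda>n. ?i (\<lambda>x. ?d n x - 0) (\<lambda>x. ?d n x - 0)"])
        (auto simp: L2_inner_self_nonneg)
  qed (use in_L2 L2_zero in \<open>auto intro!: L2_diff\<close>)
  have 4: "\<exists>M. \<forall>n. L2_norm_on (lebesgue_on \<Omega>) (lams n) \<le> M"
    using K by (intro exI[of _ "sqrt K"]) (simp add: L2_norm_on_eq_sqrt)
  have 5: "tendsto_L2 (surface_on (Gamma_int \<Omega> (T h))) (\<lambda>n. jump (T h) (\<lambda>x. us n x - u x)) (\<lambda>x. 0)"
  proof (rule tendsto_L2I)
    have dV: "(\<lambda>x. us n x - u x) \<in> ?V" for n using L2_subspace_diff[OF V usV uV] .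
    show "jump (T h) (\<lambda>x. us n x - u x) \<in> L2 (surface_on (Gamma_int \<Omega> (T h)))" for n
      by (rule jump_L2[OF dV])
    \<comment> \<open>The claim concerns the jump of the difference rather than the difference of
      two jumps, so the operator bound is applied directly to the null sequence
      \<open>us n - u\<close>.\<close>
    have "(\<lambda>n. L2_inner (surface_on (Gamma_int \<Omega> (T h))) (jump (T h) (\<lambda>x. us n x - u x)) (jump (T h) (\<lambda>x. us n x - u x))) \<longlonglongrightarrow> 0"
      by (rule AE_linear_tendsto_0[OF Vdim jump_AE_linear[unfolded broken_space_scalar] jump_L2 dV du])
    then show "(\<lambda>n. L2_inner (surface_on (Gamma_int \<Omega> (T h))) (\<lambda>x. jump (T h) (\<lambda>x. us n x - u x) x - 0) (\<lambda>x. jump (T h) (\<lambda>x. us n x - u x) x - 0)) \<longlonglongrightarrow> 0"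
      by simp
  qed (rule L2_zero)
  have 6: "tendsto_L2 (surface_on (frontier \<Omega>)) (\<lambda>n. boundary_trace (T h) (us n)) (boundary_trace (T h) u)"
    by (rule AE_linear_tendsto_L2[OF Vdim boundary_trace_AE_linear[unfolded broken_space_scalar] boundary_trace_L2 usV uV du])
  have 7: "tendsto_L2 (lebesgue_on \<Omega>) (\<lambda>n. lifting \<Omega> (T h) l (us n)) (lifting \<Omega> (T h) l u)"
    by (rule AE_linear_tendsto_L2[OF Vdim lifting_AE_linear[unfolded broken_space_scalar] _ usV uV du])
      (use lifting_in_broken_space HL in \<open>auto simp: broken_space_vec\<close>)
  have 8: "tendsto_L2 (lebesgue_on \<Omega>) (\<lambda>n. broken_grad (T h) (us n)) (broken_grad (T h) u)"
    by (rule AE_linear_tendsto_L2[OF Vdim broken_grad_AE_linear[unfolded broken_space_scalar] _ usV uV du])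
      (use broken_grad_in_broken_space[OF _ degrees] HL in \<open>auto simp: broken_space_vec\<close>)
  show ?thesis using 1 2 \<eta> 3 4 5 6 7 8 by (intro conjI)
qed

end
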